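(* Let $n\ge 3$ be odd. 1. If $m\in\mathbb N_{\ge 3}$ with $m\neq n$, then $\mathcal L(D_{2n})\neq\mathcal L(D_{2m})$. 2. If $G$ is a finite nilpotent group but not a non-abelian $2$-group, then $\mathcal L(D_{2n})\neq\mathcal L(G)$. 3. If $H$ is a strongly primary monoid, then $\mathcal L(D_{2n})\neq\mathcal L(H)$.
   Context: $D_{2n}$ denotes a dihedral group of order $2n$. A monoid means a commutative cancellative semigroup with identity; $H^\times$ is the group of invertible elements of a monoid $H$. An atom of $H$ is a non-invertible element that is not a product of two non-invertible elements. For $a\in H$, $\mathsf L(a)\subset\mathbb N_0$ is the set of all $k$ such that $a$ is (up to a unit) a product of $k$ atoms, with $\mathsf L(a)=\{0\}$ if $a\in H^\times$; $\mathcal L(H)=\{\mathsf L(a): a\in H\}$ is the system of sets of lengths. A monoid $H$ is strongly primary if $H\ne H^\times$ and, for each $a\in H\setminus H^\times$, there is some $k\in\mathbb N$ with $(H\setminus H^\times)^k\subset aH$. For a finite group $G$ (written multiplicatively, identity $1_G$), a sequence over $G$ is an element of the free abelian monoid $\mathcal F(G)$ with basis $G$ (a finite unordered list, repetition allowed), the operation being concatenation. A sequence is product-one if its terms can be ordered so that their product equals $1_G$ (the empty sequence is product-one). $\mathcal B(G)$ is the monoid of product-one sequences over $G$, and $\mathcal L(G):=\mathcal L(\mathcal B(G))$. *)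

theory Defs
  imports "HOL-Algebra.Divisibility" "HOL-Algebra.Generated_Groups"
begin

text \<open>
  A monoid in the sense of factorization theory (commutative and cancellative, with identity) is
  a \<^locale>\<open>comm_monoid_cancel\<close>; its group of invertible elements is \<^const>\<open>Units\<close>.
\<close>

abbreviation nonunits :: "('a, 'b) monoid_scheme \<Rightarrow> 'a set"
  where "nonunits H \<equiv> carrier H - Units H"

definition atoms :: "('a, 'b) monoid_scheme \<Rightarrow> 'a set"
  where "atoms H = {a \<in> nonunits H. \<not> (\<exists>b \<in> nonunits H. \<exists>c \<in> nonunits H. a = b \<otimes>\<^bsub>H\<^esub> c)}"

lemma (in comm_monoid_cancel) atoms_iff_irreducible:
  "a \<in> atoms G \<longleftrightarrow> a \<in> carrier G \<and> irreducible G a"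
proof
  assume a: "a \<in> atoms G"
  have "b \<in> Units G" if b: "b \<in> carrier G" "properfactor G b a" for b
  proof -
    from b(2) obtain c where c: "c \<in> carrier G" "a = b \<otimes> c"
      by (auto simp: properfactor_def factor_def)
    have "c \<notin> Units G"
      using b c by (metis associatedI2' associated_def properfactor_def)
    then show ?thesis
      using a b c by (auto simp: atoms_def)
  qed
  with a show "a \<in> carrier G \<and> irreducible G a"
    by (auto simp: atoms_def irreducible_def)
next
  assume a: "a \<in> carrier G \<and> irreducible G a"
  then have "a \<in> nonunits G"
    by (simp add: irreducible_def)
  with a show "a \<in> atoms G"
    unfolding atoms_def by (blast elim: irreducible_prodE)
qed

definition length_set :: "('a, 'b) monoid_scheme \<Rightarrow> 'a \<Rightarrow> nat set"
  where "length_set H a =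
    (if a \<in> Units H then {0}
     else {k. \<exists>u \<in> Units H. \<exists>as. set as \<subseteq> atoms H \<and> length as = k \<and>
                a = u \<otimes>\<^bsub>H\<^esub> foldr (\<otimes>\<^bsub>H\<^esub>) as \<one>\<^bsub>H\<^esub>})"

definition length_system :: "('a, 'b) monoid_scheme \<Rightarrow> nat set set"
  where "length_system H = {length_set H a |a. a \<in> carrier H}"

primrec set_power :: "('a, 'b) monoid_scheme \<Rightarrow> 'a set \<Rightarrow> nat \<Rightarrow> 'a set"
  where
    "set_power H A 0 = {\<one>\<^bsub>H\<^esub>}"
  | "set_power H A (Suc k) = A <#>\<^bsub>H\<^esub> set_power H A k"

definition strongly_primary :: "('a, 'b) monoid_scheme \<Rightarrow> bool"
  where "strongly_primary H \<longleftrightarrow>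
    comm_monoid_cancel H \<and> carrier H \<noteq> Units H \<and>
    (\<forall>a \<in> nonunits H. \<exists>k \<ge> 1. set_power H (nonunits H) k \<subseteq> a <#\<^bsub>H\<^esub> carrier H)"

text \<open>
  Sequences over \<open>G\<close> are multisets of elements of \<open>G\<close>; an ordering of the terms is a list with
  the given underlying multiset.
\<close>

definition product_one :: "('a, 'b) monoid_scheme \<Rightarrow> 'a multiset \<Rightarrow> bool"
  where "product_one G S \<longleftrightarrow> (\<exists>xs. mset xs = S \<and> foldr (\<otimes>\<^bsub>G\<^esub>) xs \<one>\<^bsub>G\<^esub> = \<one>\<^bsub>G\<^esub>)"

definition product_one_monoid :: "('a, 'b) monoid_scheme \<Rightarrow> 'a multiset monoid"
  where "product_one_monoid G =
    \<lparr>carrier = {S. set_mset S \<subseteq> carrier G \<and> product_one G S}, mult = (+), one = {#}\<rparr>"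

lemma (in monoid) foldr_mult_append:
  assumes "set xs \<subseteq> carrier G" "set ys \<subseteq> carrier G"
  shows "foldr (\<otimes>) (xs @ ys) \<one> = foldr (\<otimes>) xs \<one> \<otimes> foldr (\<otimes>) ys \<one>"
  using assms by (induction xs) (auto simp: m_assoc)

lemma (in monoid) product_one_add:
  assumes "set_mset S \<subseteq> carrier G" "set_mset T \<subseteq> carrier G" "product_one G S" "product_one G T"
  shows "product_one G (S + T)"
proof -
  obtain xs ys where "mset xs = S" "foldr (\<otimes>) xs \<one> = \<one>" "mset ys = T" "foldr (\<otimes>) ys \<one> = \<one>"
    using assms by (auto simp: product_one_def)
  moreover from this have "foldr (\<otimes>) (xs @ ys) \<one> = \<one>"
    using assms by (subst foldr_mult_append) auto
  ultimately show ?thesis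
    unfolding product_one_def by (intro exI[of _ "xs @ ys"]) auto
qed

lemma (in monoid) product_one_monoid_cancel: "comm_monoid_cancel (product_one_monoid G)"
proof (rule comm_monoid_cancelI)
  show "comm_monoid (product_one_monoid G)"
    by (rule comm_monoidI)
       (auto simp: product_one_monoid_def product_one_add union_ac product_one_def[of _ "{#}"])
qed (auto simp: product_one_monoid_def)

abbreviation group_length_system :: "('a, 'b) monoid_scheme \<Rightarrow> nat set set"
  where "group_length_system G \<equiv> length_system (product_one_monoid G)"

text \<open>
  The dihedral group of order \<open>2n\<close> as the semidirect product of the integers modulo \<open>n\<close> (represented
  by \<open>{0..<n}\<close>) with a group of order two acting by negation: the pair \<open>(a, s)\<close> stands for the
  rotation \<open>\<rho>\<^sup>a\<close> if \<open>s\<close> is false, and for the reflection \<open>\<rho>\<^sup>a \<tau>\<close> if \<open>s\<close> is true, where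
  \<open>\<tau> \<rho> = \<rho>\<^sup>-\<^sup>1 \<tau>\<close>.
\<close>

definition dihedral :: "nat \<Rightarrow> (int \<times> bool) monoid"
  where "dihedral n =
    \<lparr>carrier = {0..<int n} \<times> UNIV,
     mult = (\<lambda>(a, s) (b, t). ((if s then a - b else a + b) mod int n, s \<noteq> t)),
     one = (0, False)\<rparr>"

lemma group_dihedral:
  assumes "n > 0"
  shows "group (dihedral n)"
proof (rule groupI)
  fix x assume "x \<in> carrier (dihedral n)"
  then obtain a s where x: "x = (a, s)" "0 \<le> a" "a < int n"
    by (auto simp: dihedral_def)
  show "\<exists>y \<in> carrier (dihedral n). y \<otimes>\<^bsub>dihedral n\<^esub> x = \<one>\<^bsub>dihedral n\<^esub>"
    using assms x
    by (intro bexI[of _ "(if s then a else (- a) mod int n, s)"])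
       (auto simp: dihedral_def mod_simps)
qed (use assms in \<open>auto simp: dihedral_def mod_simps algebra_simps\<close>)

lemma order_dihedral: "order (dihedral n) = 2 * n"
  by (simp add: order_def dihedral_def card_cartesian_product)

text \<open>
  \<open>\<gamma>\<^sub>1 = G\<close> and \<open>\<gamma>\<^sub>i\<^sub>+\<^sub>1 = [\<gamma>\<^sub>i, G]\<close>, the index being shifted by one so that the series starts at \<open>0\<close>.
\<close>

primrec lower_central :: "('a, 'b) monoid_scheme \<Rightarrow> nat \<Rightarrow> 'a set"
  where
    "lower_central G 0 = carrier G"
  | "lower_central G (Suc i) =
      generate G {x \<otimes>\<^bsub>G\<^esub> y \<otimes>\<^bsub>G\<^esub> inv\<^bsub>G\<^esub> x \<otimes>\<^bsub>G\<^esub> inv\<^bsub>G\<^esub> y |x y. x \<in> lower_central G i \<and> y \<in> carrier G}"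

definition nilpotent_group :: "('a, 'b) monoid_scheme \<Rightarrow> bool"
  where "nilpotent_group G \<longleftrightarrow> group G \<and> (\<exists>c. lower_central G c = {\<one>\<^bsub>G\<^esub>})"

end

theory Submission
  imports Defs "HOL-Algebra.Multiplicative_Group" "HOL-Algebra.Sylow"
begin

text \<open>
  All claims are read off from finitely many features of the system of sets of lengths. If \<open>D(G)\<close>
  is the largest size of an atom over \<open>G\<close>, then \<open>D(G)\<close> is the largest element of a set of lengths
  containing \<open>2\<close>; for odd \<open>n\<close> it equals \<open>2 n\<close> for the dihedral group of order \<open>2 n\<close>, because two
  reflections whose product has order \<open>n\<close>, each repeated \<open>n\<close> times, form an atom \<open>S\<close>. The square of
  \<open>S\<close> is a product of \<open>2 n\<close> squares of reflections, and the powers of \<open>S\<close> yield arbitrarily long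
  arithmetic progressions with difference \<open>D - 2\<close> and elasticity \<open>D / 2\<close>.

  If another finite group \<open>G\<close> has these progressions, it has an atom \<open>U\<close> of size \<open>D = 2 n\<close> that either
  contains an element of order \<open>D\<close> or consists of involutions, and in the latter case all atoms over
  the support of \<open>U\<close> have size \<open>2\<close> or \<open>D\<close>. In a dihedral group of order \<open>2 m\<close> with \<open>m\<close> even this is
  impossible, since a few reflections admit product-one sequences that are short but no products of
  squares. For nilpotent \<open>G\<close> an element of order \<open>D\<close> makes \<open>G\<close> cyclic of order \<open>D\<close>, and then no set of
  lengths contains both \<open>3\<close> and \<open>3 n\<close>, unlike in the dihedral case. If \<open>U\<close> consists of involutions, an
  element that commutes with them and is not a product of them would lengthen \<open>U\<close>; so \<open>G\<close> is an
  elementary abelian \<open>2\<close>-group. Merging two terms of \<open>U\<close> then gives progressions with difference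
  \<open>D - 3\<close>, which do not occur for the dihedral group of order \<open>2 n\<close>.

  In a strongly primary monoid every sufficiently long product is divisible by an element with two
  factorization lengths, so that singletons \<open>{k}\<close> with \<open>k\<close> large are not sets of lengths.
\<close>

section \<open>Product-one sequences and their factorizations\<close>

abbreviation seqs :: "('a, 'b) monoid_scheme \<Rightarrow> 'a multiset set"
  where "seqs G \<equiv> carrier (product_one_monoid G)"

abbreviation seq_atoms :: "('a, 'b) monoid_scheme \<Rightarrow> 'a multiset set"
  where "seq_atoms G \<equiv> atoms (product_one_monoid G)"

text \<open>The empty sequence is the only unit, so factorizations up to order and units are
  multisets of atoms, and their lengths are the sizes of these multisets.\<close>

definition factorizations :: "('a, 'b) monoid_scheme \<Rightarrow> 'a multiset \<Rightarrow> 'a multiset multiset set"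
  where "factorizations G S = {M. set_mset M \<subseteq> seq_atoms G \<and> \<Sum>\<^sub># M = S}"

context group
begin

abbreviation lprod :: "'a list \<Rightarrow> 'a"
  where "lprod xs \<equiv> foldr (\<otimes>) xs \<one>"

lemma lprod_closed [simp]: "set xs \<subseteq> carrier G \<Longrightarrow> lprod xs \<in> carrier G"
  by (induction xs) auto

lemma lprod_rotate:
  assumes "set xs \<subseteq> carrier G" "set ys \<subseteq> carrier G" "lprod (xs @ ys) = \<one>"
  shows "lprod (ys @ xs) = \<one>"
proof -
  have "lprod xs \<otimes> lprod ys = \<one>"
    using assms by (simp only: foldr_mult_append)
  then have "lprod ys \<otimes> lprod xs = \<one>"
    using assms by (simp add: inv_comm)
  then show ?thesis
    using assms by (simp only: foldr_mult_append)
qed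

lemma lprod_replicate: "g \<in> carrier G \<Longrightarrow> lprod (replicate k g) = g [^] k"
  by (induction k) (simp_all add: nat_pow_Suc2[symmetric] del: nat_pow_Suc)

lemma seqs_iff: "S \<in> seqs G \<longleftrightarrow> set_mset S \<subseteq> carrier G \<and> (\<exists>xs. mset xs = S \<and> lprod xs = \<one>)"
  by (simp add: product_one_monoid_def product_one_def)

lemma seqsI: "set xs \<subseteq> carrier G \<Longrightarrow> lprod xs = \<one> \<Longrightarrow> mset xs \<in> seqs G"
  by (auto simp: seqs_iff)

lemma seqsE:
  assumes "S \<in> seqs G"
  obtains xs where "mset xs = S" "set xs \<subseteq> carrier G" "lprod xs = \<one>"
  using assms by (auto simp: seqs_iff)

lemma seqs_carrier: "S \<in> seqs G \<Longrightarrow> x \<in># S \<Longrightarrow> x \<in> carrier G"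
  by (auto simp: seqs_iff)

lemma seqs_empty [simp]: "{#} \<in> seqs G"
  by (auto simp: seqs_iff)

lemma seqs_add [simp]: "S \<in> seqs G \<Longrightarrow> T \<in> seqs G \<Longrightarrow> S + T \<in> seqs G"
  by (simp add: product_one_monoid_def product_one_add)

lemma seqs_sum: "(\<And>S. S \<in># M \<Longrightarrow> S \<in> seqs G) \<Longrightarrow> \<Sum>\<^sub># M \<in> seqs G"
  by (induction M) auto

text \<open>Rotating a word conjugates its product, so an ordering with product one can be made to
  start at any chosen term.\<close>

lemma seqs_ConsE:
  assumes "S \<in> seqs G" "x \<in># S"
  obtains xs where "mset (x # xs) = S" "set (x # xs) \<subseteq> carrier G" "lprod (x # xs) = \<one>"
proof -
  obtain ys where ys: "mset ys = S" "set ys \<subseteq> carrier G" "lprod ys = \<one>"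
    using assms by (elim seqsE)
  then obtain us vs where "ys = us @ x # vs"
    using assms(2) by (metis set_mset_mset split_list)
  with ys have "lprod ((x # vs) @ us) = \<one>"
    by (intro lprod_rotate[of us "x # vs"]) auto
  with ys \<open>ys = us @ x # vs\<close> show ?thesis
    by (intro that[of "vs @ us"]) auto
qed

lemma seqs_power:
  assumes "g \<in> carrier G" "g [^] (k::nat) = \<one>"
  shows "replicate_mset k g \<in> seqs G"
proof -
  have "set (replicate k g) \<subseteq> carrier G" using assms by auto
  then show ?thesis using seqsI[of "replicate k g"] assms by (simp only: lprod_replicate mset_replicate)
qed

text \<open>Equal terms are placed next to each other; each block then has product one on its
  own.\<close>

lemma seqs_powers:
  assumes "\<And>x. x \<in># S \<Longrightarrow> x \<in> carrier G \<and> x [^] count S x = \<one>"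
  shows "S \<in> seqs G"
proof -
  have "S = (\<Sum>x\<in>set_mset S. replicate_mset (count S x) x)"
    by (rule multiset_eqI) (auto simp: count_sum count_eq_zero_iff if_distrib cong: if_cong)
  also have "\<dots> = \<Sum>\<^sub># (image_mset (\<lambda>x. replicate_mset (count S x) x) (mset_set (set_mset S)))"
    by (simp add: sum_unfold_sum_mset)
  also have "\<dots> \<in> seqs G"
    by (rule seqs_sum) (use assms in \<open>auto intro!: seqs_power\<close>)
  finally show ?thesis .
qed

lemma seqs_pair:
  assumes "g \<in> carrier G" "h \<in> carrier G"
  shows "{#g, h#} \<in> seqs G \<longleftrightarrow> h = inv g"
proof
  assume "{#g, h#} \<in> seqs G"
  then obtain xs where xs: "mset (g # xs) = {#g, h#}" "set (g # xs) \<subseteq> carrier G" "lprod (g # xs) = \<one>"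
    by (rule seqs_ConsE[of _ g]) auto
  then have "mset xs = {#h#}" by simp
  then have "xs = [h]" by simp
  with xs assms have "g \<otimes> h = \<one>" by simp
  then show "h = inv g" using assms by (metis inv_comm inv_equality)
next
  assume "h = inv g"
  then show "{#g, h#} \<in> seqs G"
    using assms seqsI[of "[g, h]"] by simp
qed

lemma Units_seqs: "Units (product_one_monoid G) = {{#}}"
  by (auto simp: Units_def product_one_monoid_def product_one_def[of _ "{#}"])

lemma seq_atoms_iff:
  "A \<in> seq_atoms G \<longleftrightarrow>
     A \<in> seqs G \<and> A \<noteq> {#} \<and> (\<forall>S\<in>seqs G. \<forall>T\<in>seqs G. A = S + T \<longrightarrow> S = {#} \<or> T = {#})"
  unfolding atoms_def Units_seqs by (auto simp: product_one_monoid_def)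

lemma seq_atoms_seqs: "A \<in> seq_atoms G \<Longrightarrow> A \<in> seqs G"
  by (simp add: seq_atoms_iff)

lemma seq_atoms_carrier: "A \<in> seq_atoms G \<Longrightarrow> x \<in># A \<Longrightarrow> x \<in> carrier G"
  using seqs_carrier seq_atoms_seqs by blast

text \<open>In a non-abelian group the complement of a product-one subsequence may fail to be
  product-one, so \<open>A - S\<close> is required to be one as well.\<close>

lemma seq_atom_subset:
  assumes "A \<in> seq_atoms G" "S \<in> seqs G" "A - S \<in> seqs G" "S \<subseteq># A" "S \<noteq> {#}"
  shows "S = A"
proof -
  have "A = S + (A - S)" using assms by simp
  then show ?thesis using assms seq_atoms_iff by (metis add.right_neutral)
qed

lemma foldr_seqs: "foldr (\<otimes>\<^bsub>product_one_monoid G\<^esub>) as \<one>\<^bsub>product_one_monoid G\<^esub> = \<Sum>\<^sub># (mset as)"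
  by (induction as) (auto simp: product_one_monoid_def)

text \<open>The empty sequence is treated apart because \<open>length_set\<close> has a special
  value at units; it fits the formula since a nonempty multiset of atoms has a nonempty sum.\<close>

lemma length_set_seqs:
  assumes "S \<in> seqs G"
  shows "length_set (product_one_monoid G) S = size ` factorizations G S"
proof (cases "S = {#}")
  case True
  have "M = {#}" if "M \<in> factorizations G S" for M
  proof (rule ccontr)
    assume "M \<noteq> {#}"
    then obtain A where "A \<in># M" by blast
    with that True have "A = {#}" "A \<in> seq_atoms G"
      by (auto simp: factorizations_def sum_mset_0_iff)
    then show False by (simp add: seq_atoms_iff)
  qed
  moreover have "{#} \<in> factorizations G S"
    using True by (simp add: factorizations_def)
  ultimately have "factorizations G S = {{#}}" by blast
  then show ?thesis
    using True by (simp add: length_set_def Units_seqs)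
next
  case False
  have "length_set (product_one_monoid G) S =
      {k. \<exists>as. set as \<subseteq> seq_atoms G \<and> length as = k \<and> S = \<Sum>\<^sub># (mset as)}"
    using False by (simp add: length_set_def Units_seqs foldr_seqs) (simp add: product_one_monoid_def)
  also have "\<dots> = size ` factorizations G S"
  proof (intro equalityI subsetI)
    fix k assume "k \<in> {k. \<exists>as. set as \<subseteq> seq_atoms G \<and> length as = k \<and> S = \<Sum>\<^sub># (mset as)}"
    then obtain as where "set as \<subseteq> seq_atoms G" "length as = k" "S = \<Sum>\<^sub># (mset as)" by blast
    then show "k \<in> size ` factorizations G S"
      by (intro image_eqI[of _ _ "mset as"]) (auto simp: factorizations_def)
  next
    fix k assume "k \<in> size ` factorizations G S"
    then obtain M where M: "set_mset M \<subseteq> seq_atoms G" "\<Sum>\<^sub># M = S" "k = size M"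
      by (auto simp: factorizations_def)
    obtain as where "mset as = M" using ex_mset by blast
    with M have "set as \<subseteq> seq_atoms G \<and> length as = k \<and> S = \<Sum>\<^sub># (mset as)"
      by auto
    then show "k \<in> {k. \<exists>as. set as \<subseteq> seq_atoms G \<and> length as = k \<and> S = \<Sum>\<^sub># (mset as)}"
      by blast
  qed
  finally show ?thesis .
qed

lemma group_length_system_eq:
  "group_length_system G = {size ` factorizations G S |S. S \<in> seqs G}"
  unfolding length_system_def using length_set_seqs by (metis (no_types, lifting))

lemma factorization_exists:
  assumes "S \<in> seqs G"
  shows "\<exists>M. M \<in> factorizations G S"
  using assms
proof (induction "size S" arbitrary: S rule: less_induct)
  case less
  show ?case
  proof (cases "S = {#} \<or> S \<in> seq_atoms G")
    case True
    then show ?thesis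
      by (auto simp: factorizations_def intro: exI[of _ "{#}"] exI[of _ "{#S#}"])
  next
    case False
    then obtain T U where TU: "T \<in> seqs G" "U \<in> seqs G" "S = T + U" "T \<noteq> {#}" "U \<noteq> {#}"
      using less.prems by (auto simp: seq_atoms_iff)
    then have "size T < size S" "size U < size S"
      by (auto simp: nonempty_has_size)
    then obtain M N where "M \<in> factorizations G T" "N \<in> factorizations G U"
      using less.hyps TU by blast
    then have "M + N \<in> factorizations G S"
      using TU by (auto simp: factorizations_def)
    then show ?thesis by blast
  qed
qed

lemma factorizations_in_seqs: "M \<in> factorizations G S \<Longrightarrow> S \<in> seqs G"
  unfolding factorizations_def using seqs_sum[of M] seq_atoms_seqs by blast

lemma factorizations_add:
  "M \<in> factorizations G S \<Longrightarrow> N \<in> factorizations G T \<Longrightarrow> M + N \<in> factorizations G (S + T)"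
  by (auto simp: factorizations_def)

lemma length_in_system: "M \<in> factorizations G S \<Longrightarrow> size ` factorizations G S \<in> group_length_system G"
  using factorizations_in_seqs group_length_system_eq by blast

lemma in_factorization_seqs: "M \<in> factorizations G S \<Longrightarrow> A \<in># M \<Longrightarrow> A \<in> seq_atoms G"
  by (auto simp: factorizations_def)

lemma in_factorization_le: "M \<in> factorizations G S \<Longrightarrow> A \<in># M \<Longrightarrow> A \<subseteq># S"
  by (auto simp: factorizations_def sum_mset.remove)

text \<open>Deleting the identity from an ordering leaves the product unchanged, so the identity
  splits off as a factor.\<close>

lemma one_in_seq_atom:
  assumes "A \<in> seq_atoms G" "\<one> \<in># A"
  shows "A = {#\<one>#}"
proof -
  obtain xs where xs: "mset (\<one> # xs) = A" "set (\<one> # xs) \<subseteq> carrier G" "lprod (\<one> # xs) = \<one>"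
    using assms seqs_ConsE seq_atoms_seqs by metis
  then have "mset xs \<in> seqs G" by (intro seqsI) auto
  moreover have "{#\<one>#} \<in> seqs G" using seqsI[of "[\<one>]"] by simp
  moreover have "A = {#\<one>#} + mset xs" using xs by simp
  ultimately have "{#\<one>#} = {#} \<or> mset xs = {#}"
    using assms(1) unfolding seq_atoms_iff by blast
  then show ?thesis using xs by auto
qed

lemma seq_atom_pair:
  assumes "g \<in> carrier G" "g \<noteq> \<one>"
  shows "{#g, inv g#} \<in> seq_atoms G"
  unfolding seq_atoms_iff
proof (intro conjI ballI impI)
  \<comment> \<open>A product-one sequence of size one consists of the identity, so a proper
    splitting into two single terms is impossible.\<close>
  have single: "size S \<noteq> 1" if "S \<in> seqs G" "S \<subseteq># {#g, inv g#}" for S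
  proof
    assume "size S = 1"
    then obtain x where x: "S = {#x#}" by (metis size_1_singleton_mset)
    then have "x = g \<or> x = inv g" using that(2) by auto
    moreover have "x = \<one>"
      using that(1) x by (auto simp: seqs_iff)
    ultimately show False using assms inv_eq_1_iff[of g] by auto
  qed
  fix S T assume ST: "S \<in> seqs G" "T \<in> seqs G" "{#g, inv g#} = S + T"
  then have "size S + size T = 2" by (metis size_union size_add_mset size_empty Suc_1 One_nat_def)
  moreover have "size S \<noteq> 1" "size T \<noteq> 1"
    using ST single by (metis mset_subset_eq_add_left mset_subset_eq_add_right)+
  ultimately have "size S = 0 \<or> size T = 0" by linarith
  then show "S = {#} \<or> T = {#}" by simp
qed (use assms in \<open>simp_all add: seqs_pair\<close>)

text \<open>
  The atom consisting of the identity alone is a prime element; counting it with weight two makes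
  all atoms have weight at least two.
\<close>

definition weight :: "'a multiset \<Rightarrow> nat"
  where "weight S = size S + count S \<one>"

lemma weight_sum: "weight (\<Sum>\<^sub># M) = (\<Sum>A\<in>#M. weight A)"
  by (induction M) (auto simp: weight_def)

lemma weight_atom:
  assumes "A \<in> seq_atoms G"
  shows "weight A = 2 \<and> A = {#\<one>#} \<or> weight A = size A \<and> \<one> \<notin># A \<and> size A \<ge> 2"
proof (cases "\<one> \<in># A")
  case True
  then show ?thesis using one_in_seq_atom[OF assms] by (auto simp: weight_def)
next
  case False
  have "size A \<noteq> 0" using assms by (simp add: seq_atoms_iff)
  moreover have "size A \<noteq> 1"
  proof
    assume "size A = 1"
    then obtain x where "A = {#x#}" by (metis size_1_singleton_mset)
    with assms have "x = \<one>" by (auto simp: seq_atoms_iff seqs_iff)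
    with False \<open>A = {#x#}\<close> show False by simp
  qed
  ultimately have "size A \<ge> 2" by linarith
  then show ?thesis using False by (simp add: weight_def count_eq_zero_iff)
qed

lemma weight_atom_ge: "A \<in> seq_atoms G \<Longrightarrow> weight A \<ge> 2"
  using weight_atom by fastforce

lemma size_two_atom:
  assumes "A \<in> seq_atoms G" "size A = 2" "g \<in># A"
  shows "A = {#g, inv g#}"
proof -
  obtain B where B: "A = add_mset g B" using assms(3) by (metis mset_add)
  then have "size B = 1" using assms(2) by simp
  then obtain h where "B = {#h#}" by (metis size_1_singleton_mset)
  then show ?thesis
    using B assms seqs_pair[of g h] seq_atoms_seqs seq_atoms_carrier by fastforce
qed

end

section \<open>Sizes of atoms\<close>

lemma sum_mset_le_const:
  fixes f :: "'a \<Rightarrow> nat"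
  assumes "\<And>A. A \<in># M \<Longrightarrow> f A \<le> c"
  shows "(\<Sum>A\<in>#M. f A) \<le> c * size M"
  using assms by (induction M) (auto simp: add_mono)

lemma sum_mset_ge_const:
  fixes f :: "'a \<Rightarrow> nat"
  assumes "\<And>A. A \<in># M \<Longrightarrow> c \<le> f A"
  shows "c * size M \<le> (\<Sum>A\<in>#M. f A)"
  using assms by (induction M) (auto simp: add_mono)

text \<open>This is the case of equality in \<open>sum_mset_le_const\<close>. It determines the
  weights of the atoms in factorizations of extreme length.\<close>

lemma sum_mset_eq_const_le:
  fixes f :: "'a \<Rightarrow> nat"
  assumes "\<And>A. A \<in># M \<Longrightarrow> f A \<le> c" "(\<Sum>A\<in>#M. f A) = c * size M" "A \<in># M"
  shows "f A = c"
proof -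
  obtain M' where M': "M = add_mset A M'" using assms(3) by (metis mset_add)
  with assms(1) have "(\<Sum>A\<in>#M'. f A) \<le> c * size M'" "f A \<le> c"
    by (auto intro: sum_mset_le_const)
  with assms(2) M' show ?thesis by simp
qed

lemma sum_mset_eq_const_ge:
  fixes f :: "'a \<Rightarrow> nat"
  assumes "\<And>A. A \<in># M \<Longrightarrow> c \<le> f A" "(\<Sum>A\<in>#M. f A) = c * size M" "A \<in># M"
  shows "f A = c"
proof -
  obtain M' where M': "M = add_mset A M'" using assms(3) by (metis mset_add)
  with assms(1) have "c * size M' \<le> (\<Sum>A\<in>#M'. f A)" "c \<le> f A"
    by (auto intro: sum_mset_ge_const)
  with assms(2) M' show ?thesis by simp
qed

lemma mset_pigeonhole:
  assumes "finite X" "set_mset M \<subseteq> X" "b * card X < size M"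
  shows "\<exists>U\<in>#M. b < count M U"
proof (rule ccontr)
  assume "\<not> ?thesis"
  then have "size M \<le> card (set_mset M) * b"
    unfolding size_multiset_overloaded_eq by (intro sum_bounded_above[where K = b, simplified]) auto
  also have "\<dots> \<le> card X * b"
    using assms by (intro mult_right_mono card_mono) auto
  finally show False using assms(3) by (simp add: mult.commute)
qed

lemma count_sum_mset_ge: "count M U * count U g \<le> count (\<Sum>\<^sub># M) g"
  by (induction M) auto

text \<open>All occurrences of \<open>g\<close> come from copies of \<open>P\<close>. Read as a
  lower bound for \<open>count N P\<close>, this shows that a pair of inverse elements occurs
  often.\<close>

lemma count_sum_mset_le:
  assumes "\<And>V. V \<in># N \<Longrightarrow> g \<in># V \<Longrightarrow> V = P"
  shows "count (\<Sum>\<^sub># N) g \<le> count P g * count N P"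
  using assms
proof (induction N)
  case (add V N)
  then have IH: "count (\<Sum>\<^sub># N) g \<le> count P g * count N P" by simp
  show ?case
  proof (cases "V = P")
    case False
    then have "count V g = 0" using add.prems by (meson count_eq_zero_iff union_single_eq_member)
    then show ?thesis using IH False by simp
  qed (use IH in simp)
qed simp

lemma sum_pairs: "(\<Sum>x\<in>#A. {#x, f x#}) = A + image_mset f A"
  by (induction A) auto

definition davenport :: "('a, 'b) monoid_scheme \<Rightarrow> nat \<Rightarrow> bool"
  where "davenport G D \<longleftrightarrow> (\<forall>A\<in>seq_atoms G. size A \<le> D) \<and> (\<exists>A\<in>seq_atoms G. size A = D)"

context group
begin

text \<open>Equal partial products would make the block between them product-one. Cutting the block
  out does not change the total product, so the atom would split.\<close>

lemma seq_atom_partial_products_inj: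
  assumes "mset xs \<in> seq_atoms G" "lprod xs = \<one>"
  shows "inj_on (\<lambda>i. lprod (take i xs)) {..<length xs}"
proof (rule linorder_inj_onI')
  fix i j assume ij: "i \<in> {..<length xs}" "j \<in> {..<length xs}" "i < j"
  have c: "set xs \<subseteq> carrier G" using seq_atoms_carrier[OF assms(1)] by auto
  define u v w where "u = take i xs" and "v = drop i (take j xs)" and "w = drop j xs"
  have tj: "take j xs = u @ v"
    using ij unfolding u_def v_def by (metis append_take_drop_id less_imp_le min.absorb1 take_take)
  then have xs: "xs = u @ v @ w"
    unfolding w_def by (metis append.assoc append_take_drop_id)
  have cs: "set u \<subseteq> carrier G" "set v \<subseteq> carrier G" "set w \<subseteq> carrier G"
    using c xs by auto
  have ne: "v \<noteq> []" "w \<noteq> []"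
    using ij by (auto simp: v_def w_def)
  show "lprod (take i xs) \<noteq> lprod (take j xs)"
  proof
    assume "lprod (take i xs) = lprod (take j xs)"
    then have "lprod u = lprod u \<otimes> lprod v"
      using foldr_mult_append[OF cs(1,2)] tj by (simp add: u_def)
    then have v: "lprod v = \<one>"
      using cs l_cancel_one' lprod_closed by blast
    have "lprod xs = lprod u \<otimes> (lprod v \<otimes> lprod w)"
      using foldr_mult_append[OF cs(1), of "v @ w"] foldr_mult_append[OF cs(2,3)] cs xs by simp
    then have "lprod (u @ w) = \<one>"
      using v cs assms(2) foldr_mult_append[OF cs(1,3)] by simp
    then have "mset (u @ w) \<in> seqs G" "mset v \<in> seqs G"
      using v cs by (auto intro!: seqsI simp del: foldr_append mset_append)
    moreover have "mset xs = mset v + mset (u @ w)"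
      by (simp add: xs)
    ultimately show False
      using assms(1) ne unfolding seq_atoms_iff by force
  qed
qed

text \<open>The partial products of an ordering are distinct and all lie in
  \<open>K\<close>.\<close>

lemma seq_atom_size_le_subgroup:
  assumes "A \<in> seq_atoms G" "subgroup K G" "finite K" "set_mset A \<subseteq> K"
  shows "size A \<le> card K"
proof -
  obtain xs where xs: "mset xs = A" "set xs \<subseteq> carrier G" "lprod xs = \<one>"
    using assms seq_atoms_seqs seqsE by metis
  have sub: "lprod ys \<in> K" if "set ys \<subseteq> K" for ys
    using that assms(2) by (induction ys) (auto simp: subgroup.one_closed subgroup.m_closed)
  have "card {..<length xs} \<le> card K"
  proof (rule card_inj_on_le[OF _ _ assms(3)])
    show "inj_on (\<lambda>i. lprod (take i xs)) {..<length xs}"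
      using seq_atom_partial_products_inj xs assms by blast
    show "(\<lambda>i. lprod (take i xs)) ` {..<length xs} \<subseteq> K"
      using assms(4) xs by (auto intro!: sub dest!: in_set_takeD)
  qed
  then show ?thesis using xs by auto
qed

lemma seq_atom_size_le:
  "finite (carrier G) \<Longrightarrow> A \<in> seq_atoms G \<Longrightarrow> size A \<le> card (carrier G)"
  using seq_atom_size_le_subgroup[OF _ subgroup_self] seq_atoms_carrier by blast

lemma finite_seq_atoms:
  assumes "finite (carrier G)"
  shows "finite (seq_atoms G)"
proof (rule finite_subset)
  show "seq_atoms G \<subseteq> mset ` {xs. set xs \<subseteq> carrier G \<and> length xs \<le> card (carrier G)}"
  proof
    fix A assume A: "A \<in> seq_atoms G"
    then obtain xs where "mset xs = A" "set xs \<subseteq> carrier G"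
      using seq_atoms_seqs seqsE by metis
    with seq_atom_size_le[OF assms A]
    show "A \<in> mset ` {xs. set xs \<subseteq> carrier G \<and> length xs \<le> card (carrier G)}"
      by auto
  qed
qed (use assms in \<open>simp add: finite_lists_length_le\<close>)

lemma weight_factorization_ge: "M \<in> factorizations G S \<Longrightarrow> 2 * size M \<le> weight S"
  unfolding factorizations_def
  by (auto simp: weight_sum intro!: sum_mset_ge_const weight_atom_ge)

text \<open>A factorization of length \<open>k\<close> forces weight at least \<open>2 k\<close>,
  whereas two atoms of size below \<open>k\<close> have total weight at most
  \<open>2 (k - 1)\<close>.\<close>

lemma long_atom_if_length_two:
  assumes "M \<in> factorizations G S" "N \<in> factorizations G S" "size M = 2" "size N = k" "k \<ge> 3"
  shows "\<exists>U\<in>seq_atoms G. k \<le> size U"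
proof (rule ccontr)
  assume *: "\<not> ?thesis"
  \<comment> \<open>The assumption \<open>k \<ge> 3\<close> covers the identity atom, whose weight 2
    exceeds its size.\<close>
  have "weight U \<le> k - 1" if "U \<in># M" for U
    using weight_atom[OF in_factorization_seqs[OF assms(1) that]] * assms(5) that
      in_factorization_seqs[OF assms(1) that] by force
  then have "weight S \<le> (k - 1) * size M"
    using assms(1) by (auto simp: factorizations_def weight_sum intro!: sum_mset_le_const)
  with weight_factorization_ge[OF assms(2)] assms show False by simp
qed

lemma lprod_inv: "set xs \<subseteq> carrier G \<Longrightarrow> lprod (rev (map (\<lambda>x. inv x) xs)) = inv (lprod xs)"
proof (induction xs)
  case (Cons x xs)
  have "lprod (rev (map (\<lambda>x. inv x) xs) @ [inv x]) = lprod (rev (map (\<lambda>x. inv x) xs)) \<otimes> lprod [inv x]"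
    by (rule foldr_mult_append) (use Cons.prems in auto)
  with Cons show ?case by (simp add: inv_mult_group del: foldr_append)
qed simp

lemma seqs_inverse:
  assumes "S \<in> seqs G"
  shows "image_mset (\<lambda>x. inv x) S \<in> seqs G"
proof -
  obtain xs where "mset xs = S" "set xs \<subseteq> carrier G" "lprod xs = \<one>"
    using assms by (rule seqsE)
  then show ?thesis
    using seqsI[of "rev (map (\<lambda>x. inv x) xs)"] lprod_inv[of xs] by auto
qed

lemma seq_atom_inverse:
  assumes "A \<in> seq_atoms G"
  shows "image_mset (\<lambda>x. inv x) A \<in> seq_atoms G"
proof -
  have "S = {#} \<or> T = {#}"
    if "S \<in> seqs G" "T \<in> seqs G" "image_mset (\<lambda>x. inv x) A = S + T" for S T
  proof -
    have "image_mset (\<lambda>x. inv x) (image_mset (\<lambda>x. inv x) A) = image_mset (\<lambda>x. x) A"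
      unfolding multiset.map_comp
      by (rule image_mset_cong) (use seq_atoms_carrier[OF assms] in auto)
    then have "A = image_mset (\<lambda>x. inv x) S + image_mset (\<lambda>x. inv x) T"
      using that(3) by simp
    then show ?thesis
      using assms that seqs_inverse unfolding seq_atoms_iff by (metis image_mset_is_empty_iff)
  qed
  then show ?thesis
    using assms by (auto simp: seq_atoms_iff seqs_inverse)
qed

lemma factorization_pairs:
  assumes "set_mset A \<subseteq> carrier G" "\<one> \<notin># A"
  shows "image_mset (\<lambda>x. {#x, inv x#}) A \<in> factorizations G (A + image_mset (\<lambda>x. inv x) A)"
  unfolding factorizations_def using assms by (auto simp: sum_pairs intro!: seq_atom_pair)

text \<open>The product of \<open>U\<close> with the atom of the inverses of its terms is also the
  product of the pairs consisting of a term of \<open>U\<close> and its inverse.\<close>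

lemma length_two_if_long_atom:
  assumes "U \<in> seq_atoms G" "size U \<ge> 2"
  shows "\<exists>L\<in>group_length_system G. 2 \<in> L \<and> size U \<in> L"
proof -
  let ?S = "U + image_mset (\<lambda>x. inv x) U"
  have M: "{#U, image_mset (\<lambda>x. inv x) U#} \<in> factorizations G ?S"
    using assms seq_atom_inverse by (simp add: factorizations_def)
  have "\<one> \<notin># U" using assms weight_atom[OF assms(1)] by auto
  then have N: "image_mset (\<lambda>x. {#x, inv x#}) U \<in> factorizations G ?S"
    using assms seq_atoms_carrier by (intro factorization_pairs) auto
  show ?thesis
    by (rule bexI[OF _ length_in_system[OF M]]) (use imageI[OF M, of size] imageI[OF N, of size] in \<open>simp add: numeral_2_eq_2\<close>)
qed

text \<open>The right-hand side mentions only the system of sets of lengths; through it the largest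
  size of an atom becomes an invariant of that system.\<close>

lemma long_atom_iff:
  assumes "k \<ge> 3"
  shows "(\<exists>U\<in>seq_atoms G. k \<le> size U) \<longleftrightarrow> (\<exists>L\<in>group_length_system G. 2 \<in> L \<and> (\<exists>l\<in>L. k \<le> l))"
proof
  assume "\<exists>U\<in>seq_atoms G. k \<le> size U"
  then obtain U where U: "U \<in> seq_atoms G" "k \<le> size U" by blast
  then show "\<exists>L\<in>group_length_system G. 2 \<in> L \<and> (\<exists>l\<in>L. k \<le> l)"
    using length_two_if_long_atom[of U] assms by fastforce
next
  assume "\<exists>L\<in>group_length_system G. 2 \<in> L \<and> (\<exists>l\<in>L. k \<le> l)"
  then obtain S M N where "M \<in> factorizations G S" "N \<in> factorizations G S" "size M = 2" "k \<le> size N"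
    unfolding group_length_system_eq by auto
  then show "\<exists>U\<in>seq_atoms G. k \<le> size U"
    using long_atom_if_length_two[of M S N "size N"] assms by (meson le_trans)
qed

lemma davenport_iff:
  assumes "D \<ge> 3"
  shows "davenport G D \<longleftrightarrow> (\<exists>U\<in>seq_atoms G. D \<le> size U) \<and> \<not> (\<exists>U\<in>seq_atoms G. D + 1 \<le> size U)"
proof -
  have "(\<forall>U\<in>seq_atoms G. size U \<le> D) \<longleftrightarrow> \<not> (\<exists>U\<in>seq_atoms G. D + 1 \<le> size U)"
    by (simp add: not_less_eq_eq)
  then show ?thesis
    unfolding davenport_def by (metis order.antisym order.refl)
qed

end

lemma davenport_transfer:
  assumes "group G" "group H" "group_length_system G = group_length_system H" "D \<ge> 3" "davenport G D"
  shows "davenport H D"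
proof -
  interpret G: group G by fact
  interpret H: group H by fact
  have "3 \<le> D + 1" using assms(4) by simp
  from assms(5) show ?thesis
    unfolding G.davenport_iff[OF assms(4)] H.davenport_iff[OF assms(4)]
      G.long_atom_iff[OF assms(4)] H.long_atom_iff[OF assms(4)]
      G.long_atom_iff[OF \<open>3 \<le> D + 1\<close>] H.long_atom_iff[OF \<open>3 \<le> D + 1\<close>] assms(3) .
qed

lemma davenport_unique: "davenport G D \<Longrightarrow> davenport G D' \<Longrightarrow> D = D'"
  unfolding davenport_def by (metis order.antisym)

section \<open>Constructions of long atoms\<close>

context group
begin

text \<open>In any splitting some factor contains an occurrence of the new term; the other factor
  then lies in \<open>T\<close>, which has no nonempty product-one subsequence.\<close>

lemma not_davenport_add_one:
  assumes "set_mset T \<subseteq> carrier G" "x \<in> carrier G" "add_mset x T \<in> seqs G"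
    and free: "\<And>B. B \<in> seqs G \<Longrightarrow> B \<subseteq># T \<Longrightarrow> B = {#}"
  shows "add_mset x T \<in> seq_atoms G"
proof -
  have "P = {#} \<or> Q = {#}" if PQ: "P \<in> seqs G" "Q \<in> seqs G" "add_mset x T = P + Q" for P Q
  proof -
    have *: "B = {#}" if AB: "x \<in># A" "A + B = add_mset x T" "B \<in> seqs G" for A B
    proof -
      obtain A' where "A = add_mset x A'" using AB(1) by (metis mset_add)
      then have "A' + B = T" using AB(2) by simp
      then show ?thesis using free[OF AB(3)] by auto
    qed
    have "x \<in># P \<or> x \<in># Q" using PQ(3) by (metis union_iff union_single_eq_member)
    then show ?thesis using * PQ by (metis add.commute)
  qed
  then show ?thesis using assms(3) by (auto simp: seq_atoms_iff)
qed

lemma lprod_power_form: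
  assumes "g \<in> carrier G" "set xs \<subseteq> {g}"
  shows "lprod xs = g [^] length xs"
  using assms by (induction xs) (auto simp: nat_pow_Suc2[symmetric] simp del: nat_pow_Suc)

text \<open>The atom consists of \<open>ord g - 1\<close> copies of \<open>g\<close>, of
  \<open>h\<close>, and of the inverse of their product. Before the last term is added nothing is
  product-one: a subsequence with \<open>h\<close> would make \<open>h\<close> a power of
  \<open>g\<close>, and one without \<open>h\<close> is too short.\<close>

lemma noncyclic_long_atom:
  assumes fin: "finite (carrier G)" and g: "g \<in> carrier G" and h: "h \<in> carrier G"
    and notin: "\<And>i::nat. h \<noteq> g [^] i"
  shows "\<exists>A\<in>seq_atoms G. size A = ord g + 1"
proof -
  have o: "ord g > 0" using ord_ge_1[OF fin g] by simp
  define p where "p = g [^] (ord g - 1) \<otimes> h"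
  define T where "T = add_mset h (replicate_mset (ord g - 1) g)"
  have p: "p \<in> carrier G" using g h by (simp add: p_def)
  have gh: "g \<noteq> h" using notin[of 1] g by auto
  \<comment> \<open>The hypothesis on \<open>h\<close> speaks of natural exponents only, so inverses
    of powers are rewritten as such powers.\<close>
  have pow_inv: "\<exists>j::nat. inv (g [^] (i::nat)) = g [^] j" for i
  proof (rule exI, rule inv_equality)
    show "g [^] ((ord g - 1) * i) \<otimes> g [^] i = \<one>"
      using g o by (simp add: nat_pow_mult pow_eq_id algebra_simps)
  qed (use g in auto)
  have "add_mset (inv p) T \<in> seq_atoms G"
  proof (rule not_davenport_add_one)
    have r: "set (replicate (ord g - 1) g) \<subseteq> carrier G" "set [h, inv p] \<subseteq> carrier G" using g h p by auto
    have "lprod (replicate (ord g - 1) g @ [h, inv p]) = g [^] (ord g - 1) \<otimes> (h \<otimes> inv p)"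
      using foldr_mult_append[OF r] g h p by (simp only: lprod_replicate) simp
    also have "\<dots> = p \<otimes> inv p" using g h p by (simp only: p_def m_assoc nat_pow_closed inv_closed m_closed)
    also have "\<dots> = \<one>" using p by simp
    finally have "lprod (replicate (ord g - 1) g @ [h, inv p]) = \<one>" .
    then have "mset (replicate (ord g - 1) g @ [h, inv p]) \<in> seqs G"
      using r by (intro seqsI) (simp_all only: set_append Un_subset_iff)
    then show "add_mset (inv p) T \<in> seqs G"
      by (simp add: T_def add_mset_commute)
  next
    fix B assume B: "B \<in> seqs G" "B \<subseteq># T"
    show "B = {#}"
    proof (cases "h \<in># B")
      case True
      then obtain xs where xs: "mset (h # xs) = B" "set (h # xs) \<subseteq> carrier G" "lprod (h # xs) = \<one>"
        using B seqs_ConsE by metis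
      have "mset xs \<subseteq># replicate_mset (ord g - 1) g"
        using xs(1) B(2) by (auto simp: T_def)
      then have "set xs \<subseteq> {g}"
        by (metis in_replicate_mset mset_subset_eqD set_mset_mset singletonI subsetI)
      then have "h \<otimes> g [^] length xs = \<one>"
        using xs g by (simp add: lprod_power_form)
      then have "h = inv (g [^] length xs)"
        using g h by (metis inv_equality nat_pow_closed)
      with pow_inv notin show ?thesis by metis
    next
      case False
      then have sub: "B \<subseteq># replicate_mset (ord g - 1) g"
        using B(2) unfolding T_def
        by (metis add_mset_remove_trivial mset_subset_eq_add_mset_cancel diff_single_trivial subset_eq_diff_conv add_mset_add_single)
      obtain xs where xs: "mset xs = B" "set xs \<subseteq> carrier G" "lprod xs = \<one>"
        using B seqsE by metis
      then have "set xs \<subseteq> {g}"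
        using sub by (metis in_replicate_mset mset_subset_eqD set_mset_mset singletonI subsetI)
      then have "g [^] length xs = \<one>" using xs g by (simp add: lprod_power_form)
      then have "ord g dvd length xs" using g pow_eq_id by blast
      moreover have "length xs \<le> ord g - 1"
        using size_mset_mono[OF sub] xs(1) by auto
      ultimately have "length xs = 0" using o by (auto dest: dvd_imp_le)
      then show ?thesis using xs by simp
    qed
  qed (use g h p in \<open>auto simp: T_def\<close>)
  then show ?thesis
    by (rule bexI[rotated]) (use o in \<open>simp add: T_def\<close>)
qed

lemma lprod_commute:
  assumes "set xs \<subseteq> carrier G" "h \<in> carrier G" "\<And>x. x \<in> set xs \<Longrightarrow> h \<otimes> x = x \<otimes> h"
  shows "h \<otimes> lprod xs = lprod xs \<otimes> h"
  using assms
proof (induction xs)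
  case (Cons x xs)
  then have c: "x \<in> carrier G" "lprod xs \<in> carrier G" and hx: "h \<otimes> x = x \<otimes> h"
    and IH: "h \<otimes> lprod xs = lprod xs \<otimes> h" by auto
  have "h \<otimes> lprod (x # xs) = (h \<otimes> x) \<otimes> lprod xs"
    using c assms(2) by (simp add: m_assoc)
  also have "\<dots> = x \<otimes> (h \<otimes> lprod xs)"
    using c assms(2) by (simp add: hx m_assoc)
  also have "\<dots> = lprod (x # xs) \<otimes> h"
    using c assms(2) by (simp add: IH m_assoc)
  finally show ?case .
qed simp

text \<open>
  Splitting one term \<open>g\<close> into \<open>g h\<close> and \<open>h\<^sup>-\<^sup>1\<close> lengthens the atom. In a factorization of the
  result both new terms lie in the same factor, because otherwise \<open>h\<close> would be a product of terms
  of \<open>U\<close>.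
\<close>

lemma central_long_atom:
  assumes U: "U \<in> seq_atoms G" and h: "h \<in> carrier G"
    and comm: "\<And>x. x \<in># U \<Longrightarrow> h \<otimes> x = x \<otimes> h"
    and notin: "\<And>xs. set xs \<subseteq> set_mset U \<Longrightarrow> lprod xs \<noteq> h"
  shows "\<exists>A\<in>seq_atoms G. size A = size U + 1"
proof -
  obtain g us where us: "mset (g # us) = U" "set (g # us) \<subseteq> carrier G" "lprod (g # us) = \<one>"
  proof -
    have "U \<noteq> {#}" using U by (simp add: seq_atoms_iff)
    then obtain g where "g \<in># U" by blast
    then show ?thesis using that seqs_ConsE seq_atoms_seqs[OF U] by metis
  qed
  have g: "g \<in> carrier G" and gU: "g \<in># U" using us by auto
  have cU: "set_mset U \<subseteq> carrier G" using seq_atoms_carrier[OF U] by blast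
  have hh: "x \<otimes> y = x \<otimes> h \<otimes> (inv h \<otimes> y)" if "x \<in> carrier G" "y \<in> carrier G" for x y
  proof -
    have "h \<otimes> (inv h \<otimes> y) = y" using that h by (simp add: m_assoc[symmetric])
    then show ?thesis using that h by (simp add: m_assoc)
  qed
  let ?A = "mset (g \<otimes> h # inv h # us)"
  have A: "?A \<in> seqs G"
    using us h hh[of g "lprod us"] by (intro seqsI) auto
  have key: "Q = {#}" if PQ: "P \<in> seqs G" "Q \<in> seqs G" "?A = P + Q" and P: "g \<otimes> h \<in># P" for P Q
  proof -
    obtain ps where ps: "mset (g \<otimes> h # ps) = P" "set (g \<otimes> h # ps) \<subseteq> carrier G" "lprod (g \<otimes> h # ps) = \<one>"
      using PQ(1) P by (rule seqs_ConsE)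
    have rest: "add_mset (inv h) (mset us) = mset ps + Q"
      using PQ(3) ps(1) by (metis add_mset_add_mset_same_iff mset.simps(2) union_mset_add_mset_left)
    have "inv h \<in># mset ps + Q" by (metis rest union_single_eq_member)
    then consider "inv h \<in> set ps" | "inv h \<in># Q" by auto
    then show ?thesis
    proof cases
      case 1
      then obtain as bs where ab: "ps = as @ inv h # bs" by (metis split_list)
      then have sub: "mset us = mset as + mset bs + Q" using rest by simp
      have asU: "set (as @ bs) \<subseteq> set_mset U" using us(1) sub by (auto simp: union_iff)
      have c: "set as \<subseteq> carrier G" "set bs \<subseteq> carrier G" using asU cU by auto
      \<comment> \<open>Moving \<open>h\<close> past \<open>as\<close> cancels it against
        \<open>inv h\<close>. Replacing the two new terms by \<open>g\<close> thus turns
        \<open>P\<close> into a product-one part of \<open>U\<close> with complement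
        \<open>Q\<close>.\<close>
      have "h \<otimes> lprod as = lprod as \<otimes> h"
        using asU c h by (intro lprod_commute) (auto intro: comm)
      note has = this
      have la: "lprod as \<in> carrier G" "lprod bs \<in> carrier G" using c by simp_all
      have "lprod ps = lprod as \<otimes> (inv h \<otimes> lprod bs)"
        using foldr_mult_append[OF c(1), of "inv h # bs"] c h by (simp add: ab)
      then have "lprod (g \<otimes> h # ps) = g \<otimes> (h \<otimes> lprod as) \<otimes> (inv h \<otimes> lprod bs)"
        using g h la by (simp add: m_assoc)
      also have "\<dots> = (g \<otimes> lprod as) \<otimes> h \<otimes> (inv h \<otimes> lprod bs)"
        using g h la by (simp add: has m_assoc)
      also have "\<dots> = g \<otimes> (lprod as \<otimes> lprod bs)"
        using hh[of "g \<otimes> lprod as" "lprod bs"] g la by (simp add: m_assoc)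
      also have "\<dots> = lprod (g # as @ bs)"
        using foldr_mult_append[OF c] by simp
      finally have "mset (g # as @ bs) \<in> seqs G"
        using g c ps(3) by (intro seqsI) (auto simp del: foldr_append)
      moreover have "U = mset (g # as @ bs) + Q" using sub us(1) by auto
      ultimately show ?thesis
        using U PQ(2) unfolding seq_atoms_iff
        by (metis list.distinct(1) mset_zero_iff)
    next
      case 2
      then obtain qs where qs: "mset (inv h # qs) = Q" "set (inv h # qs) \<subseteq> carrier G" "lprod (inv h # qs) = \<one>"
        using PQ(2) by (metis seqs_ConsE)
      then have "mset us = mset ps + mset qs" using rest by auto
      then have "set qs \<subseteq> set_mset U" using us(1) by (auto simp: union_iff)
      moreover have "lprod qs = h"
      proof -
        have q: "lprod qs \<in> carrier G" "inv h \<otimes> lprod qs = \<one>" using qs by auto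
        then have "lprod qs \<otimes> inv h = \<one>" using h inv_comm by auto
        then show ?thesis using q h inv_equality[of "lprod qs" "inv h"] by auto
      qed
      ultimately show ?thesis using notin by blast
    qed
  qed
  have "P = {#} \<or> Q = {#}" if PQ: "P \<in> seqs G" "Q \<in> seqs G" "?A = P + Q" for P Q
  proof -
    have "g \<otimes> h \<in># P + Q" unfolding PQ(3)[symmetric] by simp
    then show ?thesis using key[OF PQ] key[of Q P] PQ by (auto simp: add.commute)
  qed
  then have "?A \<in> seq_atoms G" using A by (auto simp: seq_atoms_iff)
  then show ?thesis using us(1) by (intro bexI[of _ ?A]) auto
qed

text \<open>Product-one subsequences have sizes divisible by \<open>ord g\<close>, so two nonempty
  ones cannot add up to \<open>ord g\<close>.\<close>

lemma power_atom:
  assumes "finite (carrier G)" "g \<in> carrier G"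
  shows "replicate_mset (ord g) g \<in> seq_atoms G"
proof -
  have o: "ord g > 0" using ord_ge_1 assms by fastforce
  have "S = {#} \<or> T = {#}" if ST: "S \<in> seqs G" "T \<in> seqs G" "replicate_mset (ord g) g = S + T" for S T
  proof -
    have *: "ord g dvd size P" if "P \<in> seqs G" "P \<subseteq># replicate_mset (ord g) g" for P
    proof -
      obtain xs where xs: "mset xs = P" "lprod xs = \<one>" using \<open>P \<in> seqs G\<close> seqsE by metis
      then have "set xs \<subseteq> {g}"
        using that by (metis in_replicate_mset mset_subset_eqD set_mset_mset singletonI subsetI)
      then show ?thesis using xs assms lprod_power_form pow_eq_id by (metis size_mset)
    qed
    have "ord g dvd size S" "ord g dvd size T" using * ST by auto
    moreover have "size S + size T = ord g" using ST(3) by (metis size_replicate_mset size_union)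
    ultimately have "size S = 0 \<or> size T = 0" using o
      by (metis add_diff_cancel_left' diff_is_0_eq dvd_imp_le le_add1 not_gr_zero order.antisym)
    then show ?thesis by simp
  qed
  then show ?thesis using assms o by (auto simp: seq_atoms_iff intro!: seqs_power)
qed

end

section \<open>Arithmetic progressions of lengths\<close>

text \<open>For \<open>d = D - 2\<close> the progression runs from \<open>2 k\<close> to
  \<open>k D\<close>. The ratio \<open>D / 2\<close> is the largest that is possible when atoms have
  size at most \<open>D\<close>.\<close>

definition progression :: "nat \<Rightarrow> nat \<Rightarrow> nat set"
  where "progression k d = {2 * k + i * d |i. i \<le> k}"

context group
begin

lemma factorization_exchange:
  assumes "N \<in> factorizations G S" "P \<subseteq># N" "P' \<in> factorizations G (\<Sum>\<^sub># P)"
  shows "N - P + P' \<in> factorizations G S"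
proof -
  have "N = N - P + P" using assms(2) by simp
  then have "\<Sum>\<^sub># N = \<Sum>\<^sub># (N - P) + \<Sum>\<^sub># P" by (metis sum_mset.union)
  moreover have "set_mset (N - P) \<subseteq> set_mset N" by (meson in_diffD subsetI)
  ultimately show ?thesis
    using assms(1,3) by (auto simp: factorizations_def)
qed

text \<open>
  A factorization of maximal length of an element whose set of lengths is an arithmetic
  progression with difference \<open>D - 2\<close> consists of atoms of weight \<open>2\<close>, one of minimal length
  of atoms of size \<open>D\<close>. If the progression is long, some atom \<open>U\<close> of size \<open>D\<close> occurs often, and
  every replacement of some of the atoms \<open>{#g, inv g#}\<close> with \<open>g \<in># U\<close> by another factorization
  changes the length by a multiple of \<open>D - 2\<close>.
\<close>

lemma progression_atom:
  assumes fin: "finite (carrier G)" and D: "davenport G D" "D \<ge> 4"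
    and fam: "\<And>k. k \<ge> 1 \<Longrightarrow> progression k (D - 2) \<in> group_length_system G"
  obtains U where "U \<in> seq_atoms G" "size U = D"
    "(\<exists>g\<in>#U. ord g = D) \<or>
     ((\<forall>g\<in>#U. g \<otimes> g = \<one>) \<and> (\<forall>A\<in>seq_atoms G. set_mset A \<subseteq> set_mset U \<longrightarrow> size A = 2 \<or> size A = D))"
proof -
  \<comment> \<open>With this choice \<open>M\<close> has so many factors that one of the finitely
    many atoms must occur more than \<open>2 * D\<close> times.\<close>
  define k where "k = 2 * D * card (seq_atoms G) + 1"
  have "progression k (D - 2) \<in> group_length_system G" by (rule fam) (simp add: k_def)
  then obtain S where S: "size ` factorizations G S = progression k (D - 2)"
    unfolding group_length_system_eq by auto
  have "2 * k \<in> progression k (D - 2)" unfolding progression_def by (auto intro!: exI[of _ 0])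
  then obtain M where M: "M \<in> factorizations G S" "size M = 2 * k"
    unfolding S[symmetric] by auto
  have "2 * k + k * (D - 2) \<in> progression k (D - 2)" unfolding progression_def by auto
  then obtain N where N: "N \<in> factorizations G S" "size N = 2 * k + k * (D - 2)"
    unfolding S[symmetric] by force
  have szN: "size N = k * D" using N(2) D(2) by (simp add: diff_mult_distrib2)
  have wM: "weight A \<le> D" if "A \<in># M" for A
  proof -
    have "size A \<le> D" using D(1) in_factorization_seqs[OF M(1) that] by (simp add: davenport_def)
    then show ?thesis using weight_atom[OF in_factorization_seqs[OF M(1) that]] D(2) by auto
  qed
  have sumM: "(\<Sum>A\<in>#M. weight A) = weight S" and sumN: "(\<Sum>A\<in>#N. weight A) = weight S"
    using M(1) N(1) weight_sum[of M] weight_sum[of N] by (auto simp: factorizations_def)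
  \<comment> \<open>The upper bound from \<open>M\<close> and the lower bound from \<open>N\<close>
    coincide, so every atom involved has the extreme weight.\<close>
  have "weight S \<le> D * (2 * k)" using sum_mset_le_const[of M weight D] wM sumM M(2) by simp
  moreover have "2 * (k * D) \<le> weight S" using weight_factorization_ge[OF N(1)] szN by simp
  ultimately have wS: "weight S = 2 * (k * D)" by (simp add: algebra_simps)
  have wM': "weight A = D" if "A \<in># M" for A
    by (rule sum_mset_eq_const_le[of M weight D A]) (use wM sumM wS M(2) that in auto)
  have wN: "weight A = 2" if "A \<in># N" for A
  proof (rule sum_mset_eq_const_ge[of N 2 weight A])
    show "2 \<le> weight B" if "B \<in># N" for B
      using weight_atom_ge in_factorization_seqs[OF N(1) that] by blast
  qed (use sumN wS szN that in auto)
  have "2 * D * card (seq_atoms G) < size M" using M(2) by (simp add: k_def)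
  then obtain U where U: "U \<in># M" "2 * D < count M U"
    using mset_pigeonhole[OF finite_seq_atoms[OF fin], of M] M(1) by (auto simp: factorizations_def)
  have Uat: "U \<in> seq_atoms G" using in_factorization_seqs[OF M(1) U(1)] .
  have Usz: "size U = D" and U1: "\<one> \<notin># U"
    using weight_atom[OF Uat] wM'[OF U(1)] D(2) by auto
  have pairs: "D \<le> count N {#g, inv g#}" if g: "g \<in># U" for g
  proof -
    have gc: "g \<in> carrier G" using seq_atoms_carrier[OF Uat g] .
    have g1: "g \<noteq> \<one>" using g U1 by auto
    have "count S g = count (\<Sum>\<^sub># M) g" using M(1) by (simp add: factorizations_def)
    moreover have "count M U * 1 \<le> count M U * count U g" using g by (intro mult_le_mono2) (simp add: Suc_le_eq)
    ultimately have "2 * D \<le> count S g" using count_sum_mset_ge[of M U g] U(2) by linarith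
    also have "count S g = count (\<Sum>\<^sub># N) g" using N(1) by (simp add: factorizations_def)
    also have "\<dots> \<le> count {#g, inv g#} g * count N {#g, inv g#}"
    proof (rule count_sum_mset_le)
      fix V assume V: "V \<in># N" "g \<in># V"
      then have at: "V \<in> seq_atoms G" using in_factorization_seqs[OF N(1)] by blast
      have "size V = 2" using weight_atom[OF at] wN[OF V(1)] V(2) g1 by auto
      then show "V = {#g, inv g#}" using size_two_atom[OF at _ V(2)] by blast
    qed
    \<comment> \<open>A pair contains \<open>g\<close> twice if \<open>g\<close> is an involution;
      hence \<open>2 * D\<close> occurrences of \<open>g\<close> guarantee only \<open>D\<close>
      pairs.\<close>
    also have "\<dots> \<le> 2 * count N {#g, inv g#}" by (intro mult_right_mono) auto
    finally show ?thesis by simp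
  qed
  have exch: "\<exists>j. size P = size P' + j * (D - 2)"
    if P: "P \<subseteq># N" "P' \<in> factorizations G (\<Sum>\<^sub># P)" for P P'
  proof -
    have "size (N - P + P') \<in> progression k (D - 2)"
      using factorization_exchange[OF N(1) P] unfolding S[symmetric] by blast
    then obtain i where i: "i \<le> k" "size (N - P + P') = 2 * k + i * (D - 2)"
      by (auto simp: progression_def)
    have "size (N - P) + size P = size N"
      using P(1) by (metis size_union subset_mset.diff_add)
    then have "2 * k + i * (D - 2) + size P = 2 * k + k * (D - 2) + size P'"
      using i(2) N(2) by simp
    moreover have "k * (D - 2) = i * (D - 2) + (k - i) * (D - 2)"
      using i(1) by (simp flip: add_mult_distrib)
    ultimately have "size P = size P' + (k - i) * (D - 2)" by linarith
    then show ?thesis ..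
  qed
  have two_D: "s = 2 \<or> s = D" if "s = 2 + j * (D - 2)" "s \<le> D" for s j :: nat
  proof (cases "j \<ge> 2")
    case True
    then have "2 * (D - 2) \<le> j * (D - 2)" by (rule mult_le_mono1)
    then show ?thesis using that D(2) by linarith
  next
    case False
    then have "j = 0 \<or> j = 1" by auto
    then show ?thesis using that D(2) by auto
  qed
  have ord2: "ord g = 2 \<or> ord g = D" if g: "g \<in># U" for g
  proof -
    have gc: "g \<in> carrier G" using seq_atoms_carrier[OF Uat g] .
    let ?o = "ord g"
    have oD: "?o \<le> D" using power_atom[OF fin gc] D(1) unfolding davenport_def by force
    \<comment> \<open>The exchange replaces \<open>ord g\<close> pairs by the two power atoms of
      \<open>g\<close> and of its inverse, so \<open>ord g - 2\<close> is a multiple of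
      \<open>D - 2\<close>.\<close>
    have "replicate_mset ?o {#g, inv g#} \<subseteq># N"
      using pairs[OF g] oD by (simp add: count_le_replicate_mset_subset_eq[symmetric])
    moreover have "{#replicate_mset ?o g, replicate_mset ?o (inv g)#} \<in>
        factorizations G (\<Sum>\<^sub># (replicate_mset ?o {#g, inv g#}))"
    proof -
      have "\<Sum>\<^sub># (replicate_mset m {#g, inv g#}) = replicate_mset m g + replicate_mset m (inv g)" for m
        by (induction m) auto
      then show ?thesis
        using power_atom[OF fin gc] power_atom[OF fin, of "inv g"] gc by (simp add: factorizations_def)
    qed
    ultimately obtain j where "?o = 2 + j * (D - 2)" using exch by fastforce
    then show ?thesis using two_D oD by blast
  qed
  show thesis
  proof (rule that[OF Uat Usz])
    show "(\<exists>g\<in>#U. ord g = D) \<or>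
     ((\<forall>g\<in>#U. g \<otimes> g = \<one>) \<and> (\<forall>A\<in>seq_atoms G. set_mset A \<subseteq> set_mset U \<longrightarrow> size A = 2 \<or> size A = D))"
    proof (cases "\<exists>g\<in>#U. ord g = D")
      case False
      have inv2: "g \<otimes> g = \<one>" if g: "g \<in># U" for g
      proof -
        have gc: "g \<in> carrier G" using seq_atoms_carrier[OF Uat g] .
        have "ord g = 2" using ord2 g False by blast
        then show ?thesis using pow_ord_eq_1[OF gc] gc by (simp add: numeral_2_eq_2)
      qed
      have "size A = 2 \<or> size A = D" if A: "A \<in> seq_atoms G" "set_mset A \<subseteq> set_mset U" for A
      proof -
        have inveq: "inv x = x" if "x \<in># A" for x
          using inv2 seq_atoms_carrier[OF A(1) that] that A(2) by (metis inv_equality subsetD)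
        have AD: "size A \<le> D" using A(1) D(1) by (simp add: davenport_def)
        \<comment> \<open>The terms of \<open>A\<close> are involutions, and their squares multiply
          to \<open>A + A\<close>; the exchange replaces \<open>size A\<close> atoms by two.\<close>
        define P where "P = image_mset (\<lambda>x. {#x, x#}) A"
        have "P \<subseteq># N"
        proof (rule mset_subset_eqI)
          fix V
          show "count P V \<le> count N V"
          proof (cases "V \<in># P")
            case True
            then obtain x where x: "x \<in># A" "V = {#x, x#}" by (auto simp: P_def)
            have "count P V \<le> size P" by (rule count_le_size)
            also have "\<dots> \<le> D" using AD by (simp add: P_def)
            also have "\<dots> \<le> count N V" using pairs[of x] x A(2) inveq[of x] by auto
            finally show ?thesis .
          qed (simp add: not_in_iff)
        qed
        moreover have "\<Sum>\<^sub># P = A + A" using sum_pairs[of "\<lambda>x. x" A] by (simp add: P_def)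
        then have "{#A, A#} \<in> factorizations G (\<Sum>\<^sub># P)" using A(1) by (simp add: factorizations_def)
        ultimately obtain j where "size P = size {#A, A#} + j * (D - 2)" using exch by blast
        then show ?thesis using two_D AD by (simp add: P_def)
      qed
      then show ?thesis using inv2 by blast
    qed blast
  qed
qed

lemma even_counts_in_seqs:
  assumes "set_mset Q \<subseteq> carrier G" "\<And>x. x \<in># Q \<Longrightarrow> x \<otimes> x = \<one>" "\<And>x. even (count Q x)"
  shows "Q \<in> seqs G"
proof (rule seqs_powers)
  fix x assume x: "x \<in># Q"
  obtain m where "count Q x = 2 * m" using assms(3)[of x] by (auto elim: evenE)
  moreover have "x [^] (2::nat) = \<one>" using x assms by (auto simp: numeral_2_eq_2)
  ultimately show "x \<in> carrier G \<and> x [^] count Q x = \<one>"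
    using x assms(1) nat_pow_pow[of x 2 m] by auto
qed

text \<open>If all multiplicities were even, the square of one term would split off with a
  product-one complement, and the atom would be that square.\<close>

lemma involutive_atom_odd_count:
  assumes W: "W \<in> seq_atoms G" "size W \<noteq> 2" and inv: "\<And>x. x \<in># W \<Longrightarrow> x \<otimes> x = \<one>"
  shows "\<exists>x. odd (count W x)"
proof (rule ccontr)
  assume "\<not> ?thesis"
  then have even: "even (count W x)" for x by simp
  have "W \<noteq> {#}" using W(1) by (simp add: seq_atoms_iff)
  then obtain x where x: "x \<in># W" by blast
  then have xc: "x \<in> carrier G" using seq_atoms_carrier[OF W(1)] by blast
  have "count W x \<noteq> 0" "even (count W x)" using x even by auto
  then have c2: "2 \<le> count W x" by presburger
  have sub: "{#x, x#} \<subseteq># W"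
    using c2 by (auto intro!: mset_subset_eqI)
  have "{#x, x#} \<in> seqs G" using xc inv[OF x] seqs_pair[OF xc xc] inv_equality by metis
  moreover have "W - {#x, x#} \<in> seqs G"
    using even inv seq_atoms_carrier[OF W(1)] by (intro even_counts_in_seqs) (auto dest: in_diffD)
  ultimately have "{#x, x#} = W"
    using seq_atom_subset[OF W(1) _ _ sub] by simp
  then show False using W(2) by auto
qed

text \<open>The element with this set of lengths is the product of \<open>2 k\<close> copies of
  \<open>W\<close>. Its factorizations consist of copies of \<open>W\<close> and of squares, and two
  copies of \<open>W\<close> can be traded for \<open>size W\<close> squares.\<close>

lemma progression_in_length_system:
  assumes W: "W \<in> seq_atoms G" "size W \<ge> 3" and inv: "\<And>x. x \<in># W \<Longrightarrow> x \<otimes> x = \<one>"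
    and atoms: "\<And>A. A \<in> seq_atoms G \<Longrightarrow> set_mset A \<subseteq> set_mset W \<Longrightarrow> A = W \<or> (\<exists>x. A = {#x, x#})"
  shows "progression k (size W - 2) \<in> group_length_system G"
proof -
  define l where "l = size W"
  define S where "S = repeat_mset (2 * k) W"
  have l: "l \<ge> 3" using W l_def by simp
  have Wc: "x \<in> carrier G" if "x \<in># W" for x using that seq_atoms_carrier[OF W(1)] by blast
  have W1: "\<one> \<notin># W" using weight_atom[OF W(1)] W(2) by auto
  have sumrep: "\<Sum>\<^sub># (replicate_mset m W) = repeat_mset m W" for m
    by (induction m) auto
  have rep_in: "x \<in># W" if "x \<in># repeat_mset m W" for x m
    using that by (metis count_repeat_mset mult_is_0 not_in_iff)
  obtain x where x: "odd (count W x)" using involutive_atom_odd_count[OF W(1)] W(2) inv by auto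
  have "size M \<in> progression k (l - 2)" if M: "M \<in> factorizations G S" for M
  proof -
    define j where "j = count M W"
    define M2 where "M2 = filter_mset (\<lambda>A. A \<noteq> W) M"
    have M_eq: "M = replicate_mset j W + M2"
      unfolding j_def M2_def by (subst multiset_partition[of M "\<lambda>A. A = W"]) (simp add: filter_eq_replicate_mset)
    have sq: "\<exists>y. A = {#y, y#}" if "A \<in># M2" for A
    proof -
      have A: "A \<in># M" "A \<noteq> W" using that by (auto simp: M2_def)
      have "A \<subseteq># S" using in_factorization_le[OF M A(1)] .
      have "x \<in># W" if "x \<in># A" for x
        using mset_subset_eqD[OF \<open>A \<subseteq># S\<close> that] rep_in unfolding S_def by blast
      then have "set_mset A \<subseteq> set_mset W" by blast
      then show ?thesis using atoms in_factorization_seqs[OF M A(1)] A(2) by blast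
    qed
    have S_eq: "S = repeat_mset j W + \<Sum>\<^sub># M2"
      using M by (simp add: factorizations_def M_eq sumrep)
    have szM2: "size (\<Sum>\<^sub># M2) = 2 * size M2" and evM2: "even (count (\<Sum>\<^sub># M2) x)"
      using sq by (induction M2) force+
    have sz: "2 * k * l = j * l + 2 * size M2"
      using arg_cong[OF S_eq, of size] szM2 by (simp add: S_def l_def)
    have "2 * k * count W x = j * count W x + count (\<Sum>\<^sub># M2) x"
      using arg_cong[OF S_eq, of "\<lambda>S. count S x"] by (simp add: S_def)
    \<comment> \<open>Squares and \<open>S\<close> contain \<open>x\<close> an even number of times;
      since \<open>count W x\<close> is odd, the number \<open>j\<close> of copies of
      \<open>W\<close> is even.\<close>
    then have "even (j * count W x)" using evM2
      by (metis dvd_triv_left even_add mult.assoc)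
    then obtain i where i: "j = 2 * i" using x by (metis even_mult_iff evenE)
    have eq: "k * l = i * l + size M2" using sz i by simp
    have ik: "i \<le> k"
    proof -
      have "i * l \<le> k * l" using eq by simp
      then show ?thesis using l by simp
    qed
    have "size M = 2 * i + size M2" by (simp add: M_eq i)
    also have "size M2 = (k - i) * l" using eq by (simp add: diff_mult_distrib)
    also have "2 * i + (k - i) * l = 2 * k + (k - i) * (l - 2)"
      using ik l by (auto simp: le_iff_add algebra_simps)
    finally show ?thesis unfolding progression_def by (auto intro!: exI[of _ "k - i"])
  qed
  moreover have "\<exists>M\<in>factorizations G S. size M = 2 * k + i * (l - 2)" if i: "i \<le> k" for i
  proof -
    define M where "M = replicate_mset (2 * (k - i)) W + image_mset (\<lambda>x. {#x, x#}) (repeat_mset i W)"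
    have "\<Sum>\<^sub># M = repeat_mset (2 * (k - i)) W + (repeat_mset i W + repeat_mset i W)"
      using sum_pairs[of "\<lambda>x. x" "repeat_mset i W"] by (simp add: M_def sumrep)
    also have "\<dots> = S"
      unfolding S_def using i by (intro multiset_eqI) (auto simp: le_iff_add algebra_simps)
    finally have "\<Sum>\<^sub># M = S" .
    moreover have "{#x, x#} \<in> seq_atoms G" if "x \<in># W" for x
      using seq_atom_pair[of x] Wc[OF that] W1 that inv inv_equality[of x x] by metis
    then have "set_mset M \<subseteq> seq_atoms G" using W(1) rep_in by (auto simp: M_def split: if_splits)
    ultimately have "M \<in> factorizations G S" by (simp add: factorizations_def)
    moreover have "size M = 2 * k + i * (l - 2)"
    proof -
      have "size M = 2 * (k - i) + i * l" by (simp add: M_def l_def)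
      also have "\<dots> = 2 * k + i * (l - 2)" using i l by (auto simp: le_iff_add algebra_simps)
      finally show ?thesis .
    qed
    ultimately show ?thesis by blast
  qed
  ultimately have "size ` factorizations G S = progression k (l - 2)"
    unfolding progression_def by (auto simp: image_iff) (metis)+
  moreover have "S \<in> seqs G"
  proof -
    have "\<Sum>\<^sub># (replicate_mset (2 * k) W) \<in> seqs G"
      by (rule seqs_sum) (use seq_atoms_seqs[OF W(1)] in \<open>auto split: if_splits\<close>)
    then show ?thesis by (simp add: sumrep S_def)
  qed
  ultimately show ?thesis unfolding group_length_system_eq l_def by blast
qed

end

section \<open>Strongly primary monoids\<close>

lemma set_power_foldr:
  assumes "set as \<subseteq> A"
  shows "foldr (\<otimes>\<^bsub>H\<^esub>) as \<one>\<^bsub>H\<^esub> \<in> set_power H A (length as)"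
  using assms by (induction as) (auto simp: set_mult_def)

text \<open>
  Any element of \<open>H\<close> with two factorization lengths divides every sufficiently long product of
  non-units, so that long products have at least two lengths as well.
\<close>

lemma strongly_primary_no_long_singleton:
  assumes H: "strongly_primary H" and ne: "\<And>L. L \<in> length_system H \<Longrightarrow> L \<noteq> {}"
    and L: "L \<in> length_system H" "l1 \<in> L" "l2 \<in> L" "l1 \<noteq> l2"
  shows "\<exists>K. \<forall>k\<ge>K. {k} \<notin> length_system H"
proof -
  interpret comm_monoid_cancel H using H by (simp add: strongly_primary_def)
  obtain a where a: "a \<in> carrier H" "L = length_set H a" using L(1) by (auto simp: length_system_def)
  have an: "a \<in> nonunits H" using a L by (auto simp: length_set_def split: if_splits)
  then obtain K where K: "set_power H (nonunits H) K \<subseteq> a <#\<^bsub>H\<^esub> carrier H"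
    using H unfolding strongly_primary_def by blast
  have atc: "set as \<subseteq> carrier H" if "set as \<subseteq> atoms H" for as using that by (auto simp: atoms_def)
  have fc: "foldr (\<otimes>\<^bsub>H\<^esub>) as \<one>\<^bsub>H\<^esub> \<in> carrier H" if "set as \<subseteq> carrier H" for as
    using that by (induction as) auto
  have "False" if k: "K + 1 \<le> k" "{k} \<in> length_system H" for k
  proof -
    obtain b where b: "b \<in> carrier H" "length_set H b = {k}" using k(2) by (auto simp: length_system_def)
    then have bU: "b \<notin> Units H" using k(1) by (auto simp: length_set_def)
    have "k \<in> length_set H b" using b by simp
    then obtain u as where u: "u \<in> Units H" "set as \<subseteq> atoms H" "length as = k"
      "b = u \<otimes>\<^bsub>H\<^esub> foldr (\<otimes>\<^bsub>H\<^esub>) as \<one>\<^bsub>H\<^esub>"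
      using bU by (auto simp: length_set_def)
    \<comment> \<open>The product of the first \<open>K\<close> atoms is already divisible by
      \<open>a\<close>; the remaining atoms and the unit go into the cofactor
      \<open>c\<close>.\<close>
    define ps qs where "ps = take K as" and "qs = drop K as"
    have pq: "as = ps @ qs" "length ps = K" using u(3) k(1) by (auto simp: ps_def qs_def)
    have "set ps \<subseteq> nonunits H" "set qs \<subseteq> carrier H"
      using u(2) pq(1) by (auto simp: atoms_def)
    then have "foldr (\<otimes>\<^bsub>H\<^esub>) ps \<one>\<^bsub>H\<^esub> \<in> a <#\<^bsub>H\<^esub> carrier H"
      using set_power_foldr[of ps "nonunits H" H] pq(2) K by blast
    then obtain d where d: "d \<in> carrier H" "foldr (\<otimes>\<^bsub>H\<^esub>) ps \<one>\<^bsub>H\<^esub> = a \<otimes>\<^bsub>H\<^esub> d"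
      by (auto simp: l_coset_def)
    define q where "q = foldr (\<otimes>\<^bsub>H\<^esub>) qs \<one>\<^bsub>H\<^esub>"
    have qc: "q \<in> carrier H" using fc \<open>set qs \<subseteq> carrier H\<close> by (simp add: q_def)
    have uc: "u \<in> carrier H" using u(1) by blast
    have "foldr (\<otimes>\<^bsub>H\<^esub>) as \<one>\<^bsub>H\<^esub> = a \<otimes>\<^bsub>H\<^esub> d \<otimes>\<^bsub>H\<^esub> q"
      using pq(1) d(2) \<open>set ps \<subseteq> nonunits H\<close> \<open>set qs \<subseteq> carrier H\<close> foldr_mult_append[of ps qs]
      by (auto simp: q_def)
    then have b_eq: "b = a \<otimes>\<^bsub>H\<^esub> (u \<otimes>\<^bsub>H\<^esub> d \<otimes>\<^bsub>H\<^esub> q)"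
      using u(4) a(1) d(1) qc uc by (simp add: m_ac)
    define c where "c = u \<otimes>\<^bsub>H\<^esub> d \<otimes>\<^bsub>H\<^esub> q"
    have cc: "c \<in> carrier H" using uc d qc by (simp add: c_def)
    \<comment> \<open>The special value of \<open>length_set\<close> at units is absorbed here: a
      unit is itself times the empty product of atoms.\<close>
    have gen: "\<exists>v\<in>Units H. \<exists>bs. set bs \<subseteq> atoms H \<and> length bs = m \<and> x = v \<otimes>\<^bsub>H\<^esub> foldr (\<otimes>\<^bsub>H\<^esub>) bs \<one>\<^bsub>H\<^esub>"
      if "m \<in> length_set H x" "x \<in> carrier H" for m x
    proof (cases "x \<in> Units H")
      case True
      with that show ?thesis
        by (intro bexI[of _ x]) (auto simp: length_set_def)
    qed (use that in \<open>auto simp: length_set_def\<close>)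
    obtain m where m: "m \<in> length_set H c"
      using ne[of "length_set H c"] cc by (auto simp: length_system_def)
    have "l + m \<in> length_set H b" if l: "l \<in> L" for l
    proof -
      obtain v vs where v: "v \<in> Units H" "set vs \<subseteq> atoms H" "length vs = l"
        "a = v \<otimes>\<^bsub>H\<^esub> foldr (\<otimes>\<^bsub>H\<^esub>) vs \<one>\<^bsub>H\<^esub>" using gen[of l a] a l by blast
      obtain w ws where w: "w \<in> Units H" "set ws \<subseteq> atoms H" "length ws = m"
        "c = w \<otimes>\<^bsub>H\<^esub> foldr (\<otimes>\<^bsub>H\<^esub>) ws \<one>\<^bsub>H\<^esub>" using gen[OF m cc] by blast
      have "b = (v \<otimes>\<^bsub>H\<^esub> w) \<otimes>\<^bsub>H\<^esub> foldr (\<otimes>\<^bsub>H\<^esub>) (vs @ ws) \<one>\<^bsub>H\<^esub>"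
        using b_eq v(1,4) w(1,4) fc[OF atc[OF v(2)]] fc[OF atc[OF w(2)]]
          foldr_mult_append[OF atc[OF v(2)] atc[OF w(2)]]
        unfolding c_def[symmetric] by (simp add: m_ac Units_closed)
      then show ?thesis
        unfolding length_set_def using bU v w
        by (auto intro!: bexI[of _ "v \<otimes>\<^bsub>H\<^esub> w"] exI[of _ "vs @ ws"])
    qed
    from this[OF L(2)] this[OF L(3)] show False using L(4) b(2) by simp
  qed
  then show ?thesis by blast
qed

text \<open>The identity forms an atom by itself, and a sequence of \<open>k\<close> identities has
  no other atoms below it, hence a single factorization.\<close>

lemma (in group) singleton_in_length_system: "{k} \<in> group_length_system G"
proof -
  have "M = replicate_mset k {#\<one>#}" if "M \<in> factorizations G (replicate_mset k \<one>)" for M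
  proof -
    have all: "A = {#\<one>#}" if "A \<in># M" for A
    proof -
      have A: "A \<in> seq_atoms G" using in_factorization_seqs \<open>M \<in> _\<close> that by blast
      have "A \<subseteq># replicate_mset k \<one>" using in_factorization_le \<open>M \<in> _\<close> that by blast
      then have "set_mset A \<subseteq> {\<one>}" by (metis in_replicate_mset mset_subset_eqD singletonI subsetI)
      moreover have "A \<noteq> {#}" using A by (simp add: seq_atoms_iff)
      ultimately have "\<one> \<in># A" by (metis multiset_nonemptyE singletonD subsetD)
      then show ?thesis using one_in_seq_atom[OF A] by blast
    qed
    then have M: "M = replicate_mset (size M) {#\<one>#}" by (metis set_mset_subset_singletonD singletonI subsetI)
    have "\<Sum>\<^sub># (replicate_mset m {#\<one>#}) = replicate_mset m \<one>" for m by (induction m) auto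
    then have "replicate_mset k \<one> = replicate_mset (size M) \<one>"
      using \<open>M \<in> _\<close> M unfolding factorizations_def by (metis (mono_tags, lifting) mem_Collect_eq)
    then have "k = size M" by (metis size_replicate_mset)
    with M show ?thesis by simp
  qed
  moreover obtain M where "M \<in> factorizations G (replicate_mset k \<one>)"
    using factorization_exists seqs_power[of \<one> k] by auto
  ultimately have "size ` factorizations G (replicate_mset k \<one>) = {k}" by force
  then show ?thesis using length_in_system \<open>M \<in> _\<close> by metis
qed

lemma (in group) strongly_primary_length_system:
  assumes "strongly_primary H" and U: "U \<in> seq_atoms G" "size U \<ge> 3"
  shows "group_length_system G \<noteq> length_system H"
proof
  assume eq: "group_length_system G = length_system H"
  have ne: "L \<noteq> {}" if "L \<in> length_system H" for L
    using that factorization_exists unfolding eq[symmetric] group_length_system_eq by blast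
  obtain L where "L \<in> group_length_system G" "2 \<in> L" "size U \<in> L"
    using length_two_if_long_atom[OF U(1)] U(2) by auto
  then have "\<exists>K. \<forall>k\<ge>K. {k} \<notin> length_system H"
    using strongly_primary_no_long_singleton[OF assms(1) ne, of L 2 "size U"] U(2) eq by auto
  then show False using singleton_in_length_system eq by auto
qed

section \<open>Product-one sequences over dihedral groups\<close>

text \<open>A reflection negates the exponent of everything to its right. The exponent is not
  reduced modulo \<open>n\<close>, so that the coefficients with which the terms enter it can be
  bounded.\<close>

fun dihedral_exponent :: "(int \<times> bool) list \<Rightarrow> int"
  where
    "dihedral_exponent [] = 0"
  | "dihedral_exponent ((a, s) # xs) = (if s then a - dihedral_exponent xs else a + dihedral_exponent xs)"

lemma dihedral_simps:
  "x \<in> carrier (dihedral n) \<longleftrightarrow> 0 \<le> fst x \<and> fst x < int n"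
  "(a, s) \<otimes>\<^bsub>dihedral n\<^esub> (b, t) = ((if s then a - b else a + b) mod int n, s \<noteq> t)"
  "\<one>\<^bsub>dihedral n\<^esub> = (0, False)"
  by (auto simp: dihedral_def mem_Times_iff)

lemma lprod_dihedral:
  "foldr (\<otimes>\<^bsub>dihedral n\<^esub>) xs \<one>\<^bsub>dihedral n\<^esub> = (dihedral_exponent xs mod int n, odd (length (filter snd xs)))"
proof (induction xs)
  case (Cons x xs)
  obtain a s where "x = (a, s)" by fastforce
  with Cons show ?case by (auto simp: dihedral_simps mod_simps)
qed (simp add: dihedral_simps)

lemma seqs_dihedral_iff:
  assumes "n > 0"
  shows "S \<in> seqs (dihedral n) \<longleftrightarrow>
    (\<forall>x\<in>#S. 0 \<le> fst x \<and> fst x < int n) \<and> even (size (filter_mset snd S)) \<and>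
    (\<exists>xs. mset xs = S \<and> int n dvd dihedral_exponent xs)"
proof -
  interpret group "dihedral n" using group_dihedral assms .
  have sz: "length (filter snd xs) = size (filter_mset snd S)" if "mset xs = S" for xs
    using that by (metis mset_filter size_mset)
  have "lprod xs = \<one>\<^bsub>dihedral n\<^esub> \<longleftrightarrow> even (size (filter_mset snd S)) \<and> int n dvd dihedral_exponent xs"
    if "mset xs = S" for xs
    unfolding lprod_dihedral unfolding dihedral_simps(3) using sz[OF that] by (simp add: dvd_eq_mod_eq_0 conj_commute)
  then have "(\<exists>xs. mset xs = S \<and> lprod xs = \<one>\<^bsub>dihedral n\<^esub>) \<longleftrightarrow>
      even (size (filter_mset snd S)) \<and> (\<exists>xs. mset xs = S \<and> int n dvd dihedral_exponent xs)"
    by blast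
  moreover have "set_mset S \<subseteq> carrier (dihedral n) \<longleftrightarrow> (\<forall>x\<in>#S. 0 \<le> fst x \<and> fst x < int n)"
    by (simp only: subset_iff dihedral_simps(1) Ball_def)
  ultimately show ?thesis
    unfolding seqs_iff by blast
qed

text \<open>Exponents of consecutive reflections enter a product with alternating signs: the entries
  of the first list positively, those of the second negatively. The lists are meant to have equal
  length; otherwise the surplus is dropped.\<close>

fun alternate :: "int list \<Rightarrow> int list \<Rightarrow> (int \<times> bool) list"
  where
    "alternate (p # ps) (q # qs) = (p, True) # (q, True) # alternate ps qs"
  | "alternate _ _ = []"

lemma alternate:
  assumes "length ps = length qs"
  shows "mset (alternate ps qs) = image_mset (\<lambda>a. (a, True)) (mset ps + mset qs)"
    "dihedral_exponent (alternate ps qs) = sum_list ps - sum_list qs"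
  using assms by (induction ps qs rule: list_induct2) auto

definition reflections :: "int multiset \<Rightarrow> (int \<times> bool) multiset"
  where "reflections P = image_mset (\<lambda>a. (a, True)) P"

lemma reflections_simps [simp]:
  "reflections (P + Q) = reflections P + reflections Q"
  "reflections (replicate_mset k a) = replicate_mset k (a, True)"
  "size (reflections P) = size P"
  by (auto simp: reflections_def)

lemma filter_reflections [simp]: "filter_mset snd (reflections P) = reflections P"
  by (auto simp: reflections_def filter_mset_image_mset)

lemma exponent_reflections:
  assumes "size P = size Q"
  shows "\<exists>xs. mset xs = reflections (P + Q) \<and> dihedral_exponent xs = \<Sum>\<^sub># P - \<Sum>\<^sub># Q"
proof -
  obtain ps qs where pq: "mset ps = P" "mset qs = Q" using ex_mset by metis
  then have "length ps = length qs" using assms by auto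
  from alternate[OF this] show ?thesis
    using pq by (auto simp: reflections_def sum_mset_sum_list intro!: exI[of _ "alternate ps qs"])
qed

text \<open>The multiset depends on \<bar>k\<bar> only; the sign of \<open>k\<close> records the
  sign with which \<open>a\<close> is to enter the exponent of a suitable ordering.\<close>

definition signed_reflections :: "int \<Rightarrow> int \<Rightarrow> (int \<times> bool) multiset"
  where "signed_reflections k a = replicate_mset (nat \<bar>k\<bar>) (a, True)"

text \<open>Vanishing of the sum of the coefficients means that there are as many positive as
  negative positions, as an alternating word requires.\<close>

lemma exponent_signed_reflections:
  assumes "\<alpha> + \<beta> + \<gamma> = 0"
  shows "\<exists>xs. mset xs = signed_reflections \<alpha> x + signed_reflections \<beta> y + signed_reflections \<gamma> p \<and>
    dihedral_exponent xs = \<alpha> * x + \<beta> * y + \<gamma> * p"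
proof -
  define pos where "pos = (\<lambda>k (a::int). replicate_mset (nat k) a)"
  have pos_sum: "\<Sum>\<^sub># (pos k a) = int (nat k) * a" and pos_size: "size (pos k a) = nat k" for k a
    by (simp_all add: pos_def)
  have abs: "pos k a + pos (- k) a = replicate_mset (nat \<bar>k\<bar>) a" for k a
    by (auto simp: pos_def abs_if)
  define P where "P = pos \<alpha> x + pos \<beta> y + pos \<gamma> p"
  define Q where "Q = pos (- \<alpha>) x + pos (- \<beta>) y + pos (- \<gamma>) p"
  have "size P = size Q" using assms by (simp add: P_def Q_def pos_size)
  moreover have "P + Q = replicate_mset (nat \<bar>\<alpha>\<bar>) x + replicate_mset (nat \<bar>\<beta>\<bar>) y + replicate_mset (nat \<bar>\<gamma>\<bar>) p"
    unfolding abs[symmetric] by (simp add: P_def Q_def)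
  moreover have "int (nat k) * a - int (nat (- k)) * a = k * a" for k a :: int
    by (cases "k \<ge> 0") auto
  then have "\<Sum>\<^sub># P - \<Sum>\<^sub># Q = \<alpha> * x + \<beta> * y + \<gamma> * p"
    by (simp add: P_def Q_def pos_sum algebra_simps)
  ultimately show ?thesis
    using exponent_reflections[of P Q] by (simp add: signed_reflections_def)
qed

lemma filter_signed_reflections [simp]: "filter_mset snd (signed_reflections k a) = signed_reflections k a"
  using filter_reflections[of "replicate_mset (nat \<bar>k\<bar>) a"] by (simp add: signed_reflections_def)

lemma size_signed_reflections [simp]: "size (signed_reflections k a) = nat \<bar>k\<bar>"
  by (simp add: signed_reflections_def)

lemma even_size_signed_reflections:
  assumes "\<alpha> + \<beta> + \<gamma> = 0"
  shows "even (nat \<bar>\<alpha>\<bar> + nat \<bar>\<beta>\<bar> + nat \<bar>\<gamma>\<bar>)"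
proof -
  have "even (int (nat \<bar>\<alpha>\<bar> + nat \<bar>\<beta>\<bar> + nat \<bar>\<gamma>\<bar>))"
    using assms by simp presburger
  then show ?thesis by presburger
qed

lemma signed_reflections_in_seqs:
  assumes "n > 0" "\<alpha> + \<beta> + \<gamma> = 0" "int n dvd \<alpha> * x + \<beta> * y + \<gamma> * p"
    and "\<And>a. a \<in> {x, y, p} \<Longrightarrow> 0 \<le> a \<and> a < int n"
  shows "signed_reflections \<alpha> x + signed_reflections \<beta> y + signed_reflections \<gamma> p \<in> seqs (dihedral n)"
proof -
  let ?S = "signed_reflections \<alpha> x + signed_reflections \<beta> y + signed_reflections \<gamma> p"
  obtain xs where "mset xs = ?S" "dihedral_exponent xs = \<alpha> * x + \<beta> * y + \<gamma> * p"
    using exponent_signed_reflections[OF assms(2), of x y p] by blast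
  then have "\<exists>xs. mset xs = ?S \<and> int n dvd dihedral_exponent xs" using assms(3) by metis
  moreover have "even (size (filter_mset snd ?S))" using even_size_signed_reflections[OF assms(2)] by simp
  moreover have "\<forall>v\<in>#?S. 0 \<le> fst v \<and> fst v < int n"
    using assms(4) by (auto simp: signed_reflections_def split: if_splits)
  ultimately show ?thesis unfolding seqs_dihedral_iff[OF assms(1)] by blast
qed

text \<open>A rotation at the front adds its exponent to that of the alternating word behind
  it.\<close>

lemma rotation_signed_reflections_in_seqs:
  assumes "n > 0" "int n dvd c + k * (y - x)"
    and "\<And>a. a \<in> {x, y, c} \<Longrightarrow> 0 \<le> a \<and> a < int n"
  shows "add_mset (c, False) (signed_reflections k x + signed_reflections k y) \<in> seqs (dihedral n)"
proof -
  have sym: "signed_reflections (- k) x = signed_reflections k x" by (simp add: signed_reflections_def)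
  have zero: "signed_reflections 0 x = {#}" by (simp add: signed_reflections_def)
  obtain xs where xs: "mset xs = signed_reflections k x + signed_reflections k y"
    "dihedral_exponent xs = k * (y - x)"
    using exponent_signed_reflections[of "- k" k 0 x y x] by (auto simp: sym zero algebra_simps)
  let ?S = "add_mset (c, False) (signed_reflections k x + signed_reflections k y)"
  have "mset ((c, False) # xs) = ?S" "dihedral_exponent ((c, False) # xs) = c + k * (y - x)"
    using xs by simp_all
  then have "\<exists>xs. mset xs = ?S \<and> int n dvd dihedral_exponent xs" using assms(2) by metis
  moreover have "even (size (filter_mset snd ?S))" using even_size_signed_reflections[of "- k" k 0] by simp
  moreover have "\<forall>v\<in>#?S. 0 \<le> fst v \<and> fst v < int n"
    using assms(3) by (auto simp: signed_reflections_def split: if_splits)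
  ultimately show ?thesis unfolding seqs_dihedral_iff[OF assms(1)] by blast
qed

text \<open>Every term enters with sign plus or minus one, which gives the parities and the bounds.
  A reflection put in front negates all coefficients and adds one to its own, so
  \<open>p + q\<close> becomes \<open>1 - (p + q)\<close> and alternates between 0 and 1.\<close>

lemma dihedral_exponent_form:
  assumes "set xs \<subseteq> {(a, True), (b, True), (z, False)}" "a \<noteq> b"
  shows "\<exists>p q t. dihedral_exponent xs = p * a + q * b + t * z \<and>
    p + q = (if odd (length (filter snd xs)) then 1 else 0) \<and>
    even (p - int (count (mset xs) (a, True))) \<and> even (q - int (count (mset xs) (b, True))) \<and>
    even (t - int (count (mset xs) (z, False))) \<and>
    \<bar>p\<bar> \<le> int (count (mset xs) (a, True)) \<and> \<bar>q\<bar> \<le> int (count (mset xs) (b, True))"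
  using assms(1)
proof (induction xs)
  case Nil
  show ?case by (intro exI[of _ 0]) simp
next
  case (Cons x xs)
  then obtain p q t where IH: "dihedral_exponent xs = p * a + q * b + t * z"
    "p + q = (if odd (length (filter snd xs)) then 1 else 0)"
    "even (p - int (count (mset xs) (a, True)))" "even (q - int (count (mset xs) (b, True)))"
    "even (t - int (count (mset xs) (z, False)))"
    "\<bar>p\<bar> \<le> int (count (mset xs) (a, True))" "\<bar>q\<bar> \<le> int (count (mset xs) (b, True))"
    by auto
  from Cons.prems consider "x = (a, True)" | "x = (b, True)" | "x = (z, False)" by auto
  then show ?case
  proof cases
    case 1
    show ?thesis
      by (rule exI[of _ "1 - p"], rule exI[of _ "- q"], rule exI[of _ "- t"])
        (use IH assms(2) in \<open>auto simp: 1 algebra_simps\<close>)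
  next
    case 2
    show ?thesis
      by (rule exI[of _ "- p"], rule exI[of _ "1 - q"], rule exI[of _ "- t"])
        (use IH assms(2) in \<open>auto simp: 2 algebra_simps\<close>)
  next
    case 3
    show ?thesis
      by (rule exI[of _ p], rule exI[of _ q], rule exI[of _ "t + 1"])
        (use IH in \<open>auto simp: 3 algebra_simps\<close>)
  qed
qed

lemma seqs_dihedral_form:
  assumes "n > 0" "S \<in> seqs (dihedral n)" "a \<noteq> b"
    and "set_mset S \<subseteq> {(a, True), (b, True), (z, False)}"
  obtains q t where "int n dvd q * (b - a) + t * z"
    "even (q - int (count S (a, True)))" "even (q - int (count S (b, True)))"
    "even (t - int (count S (z, False)))"
    "\<bar>q\<bar> \<le> int (count S (a, True))" "\<bar>q\<bar> \<le> int (count S (b, True))"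
proof -
  obtain xs where xs: "mset xs = S" "int n dvd dihedral_exponent xs" "even (size (filter_mset snd S))"
    using assms(2) seqs_dihedral_iff[OF assms(1)] by auto
  have "even (length (filter snd xs))"
    using xs(1,3) by (metis mset_filter size_mset)
  then obtain p q t where *: "dihedral_exponent xs = p * a + q * b + t * z" "p + q = 0"
    "even (p - int (count S (a, True)))" "even (q - int (count S (b, True)))"
    "even (t - int (count S (z, False)))"
    "\<bar>p\<bar> \<le> int (count S (a, True))" "\<bar>q\<bar> \<le> int (count S (b, True))"
    using dihedral_exponent_form[of xs a b z] assms(3,4) xs(1) by auto
  then have p: "p = - q" by simp
  have "p * a + q * b + t * z = q * (b - a) + t * z" by (simp add: p algebra_simps)
  then show thesis
    using that[of q t] xs(2) * p by auto
qed

text \<open>By coprimality the coefficient \<open>q\<close> of \<open>b - a\<close> is divisible by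
  \<open>n\<close>. If it vanishes, both multiplicities are even; otherwise \<bar>q\<bar> is at
  least \<open>n\<close> and both multiplicities are at least that large.\<close>

lemma two_reflections_counts:
  assumes "n > 0" "odd n" "coprime (b - a) (int n)" "S \<in> seqs (dihedral n)"
    and "set_mset S \<subseteq> {(a, True), (b, True)}" "a \<noteq> b"
  shows "even (count S (a, True)) \<and> even (count S (b, True)) \<or>
    odd (count S (a, True)) \<and> odd (count S (b, True)) \<and> n \<le> count S (a, True) \<and> n \<le> count S (b, True)"
proof -
  obtain q t where q: "int n dvd q * (b - a) + t * 0"
    "even (q - int (count S (a, True)))" "even (q - int (count S (b, True)))"
    "\<bar>q\<bar> \<le> int (count S (a, True))" "\<bar>q\<bar> \<le> int (count S (b, True))"
    by (rule seqs_dihedral_form[of n S a b 0]) (use assms in auto)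
  have "int n dvd q" using q(1) assms(3) by (simp add: coprime_commute coprime_dvd_mult_left_iff)
  then have "q = 0 \<or> int n \<le> \<bar>q\<bar>" by (metis dvd_imp_le_int abs_of_nat)
  then show ?thesis
  proof
    assume "q = 0"
    then show ?thesis using q by auto
  next
    assume "int n \<le> \<bar>q\<bar>"
    then have "n \<le> count S (a, True)" "n \<le> count S (b, True)" using q(4,5) by linarith+
    moreover have "even (count S (a, True)) \<longleftrightarrow> even (count S (b, True))"
      using q(2,3) by simp
    ultimately show ?thesis by blast
  qed
qed

text \<open>As \<open>n\<close> is odd, exactly one factor of a splitting of \<open>W\<close> has
  odd multiplicities, and it exhausts \<open>W\<close>. Over the same support, even multiplicities
  let a square split off, while odd ones let \<open>W\<close> split off with an even
  complement.\<close>

lemma two_reflections_atom: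
  assumes "n \<ge> 3" "odd n" "0 \<le> a" "a < int n" "0 \<le> b" "b < int n" "coprime (b - a) (int n)"
  defines "W \<equiv> replicate_mset n (a, True) + replicate_mset n (b, True)"
  shows "W \<in> seq_atoms (dihedral n)"
    and "\<And>A. A \<in> seq_atoms (dihedral n) \<Longrightarrow> set_mset A \<subseteq> set_mset W \<Longrightarrow> A = W \<or> (\<exists>x. A = {#x, x#})"
proof -
  have n: "n > 0" using assms(1) by simp
  interpret group "dihedral n" using group_dihedral[OF n] .
  have ab: "a \<noteq> b" using assms(1,7) by auto
  have setW: "set_mset W = {(a, True), (b, True)}" using n by (auto simp: W_def)
  have sq: "x \<in> carrier (dihedral n) \<and> x \<otimes>\<^bsub>dihedral n\<^esub> x = \<one>\<^bsub>dihedral n\<^esub>" if "x \<in># W" for x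
  proof -
    have "x = (a, True) \<or> x = (b, True)" using that setW by blast
    then show ?thesis using assms(3-6) by (elim disjE) (simp_all add: dihedral_simps)
  qed
  have Wseq: "W \<in> seqs (dihedral n)"
  proof -
    have "signed_reflections (- int n) a + signed_reflections (int n) b + signed_reflections 0 a \<in> seqs (dihedral n)"
      by (rule signed_reflections_in_seqs[OF n]) (use assms(3-6) in auto)
    then show ?thesis by (simp add: signed_reflections_def W_def)
  qed
  show "W \<in> seq_atoms (dihedral n)"
    unfolding seq_atoms_iff
  proof (intro conjI ballI impI)
    fix S T assume ST: "S \<in> seqs (dihedral n)" "T \<in> seqs (dihedral n)" "W = S + T"
    have sub: "set_mset S \<subseteq> {(a, True), (b, True)}" "set_mset T \<subseteq> {(a, True), (b, True)}"
      using setW unfolding ST(3) set_mset_union by blast+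
    have ca: "count S (a, True) + count T (a, True) = n"
      using arg_cong[OF ST(3), of "\<lambda>M. count M (a, True)"] ab by (simp add: W_def)
    have cb: "count S (b, True) + count T (b, True) = n"
      using arg_cong[OF ST(3), of "\<lambda>M. count M (b, True)"] ab by (simp add: W_def)
    have zero: "M = {#}" if "set_mset M \<subseteq> {(a, True), (b, True)}" "count M (a, True) = 0" "count M (b, True) = 0" for M
      using that by (metis count_eq_zero_iff empty_iff insert_iff multiset_nonemptyE subsetD)
    have "i = 0 \<and> j = 0 \<or> i' = 0 \<and> j' = 0"
      if "even i \<and> even j \<or> odd i \<and> odd j \<and> n \<le> i \<and> n \<le> j"
        "even i' \<and> even j' \<or> odd i' \<and> odd j' \<and> n \<le> i' \<and> n \<le> j'"
        "i + i' = n" "j + j' = n" for i j i' j'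
      using that assms(2) by presburger
    from this[OF two_reflections_counts[OF n assms(2,7) ST(1) sub(1) ab]
        two_reflections_counts[OF n assms(2,7) ST(2) sub(2) ab] ca cb]
    show "S = {#} \<or> T = {#}" using zero sub by blast
  qed (use Wseq n in \<open>auto simp: W_def\<close>)
  show "A = W \<or> (\<exists>x. A = {#x, x#})" if A: "A \<in> seq_atoms (dihedral n)" "set_mset A \<subseteq> set_mset W" for A
  proof -
    have Aseq: "A \<in> seqs (dihedral n)" using A(1) seq_atoms_seqs by blast
    have evenseq: "R \<in> seqs (dihedral n)"
      if "set_mset R \<subseteq> set_mset W" "even (count R (a, True))" "even (count R (b, True))" for R
    proof (rule even_counts_in_seqs)
      show "even (count R x)" for x
        using that by (cases "x \<in># R") (auto simp: setW not_in_iff)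
    qed (use that sq in blast)+
    have sqA: "A = {#x, x#}" if x: "x \<in># A" "even (count A (a, True))" "even (count A (b, True))" for x
    proof -
      have "x \<in># W" using x(1) A(2) by blast
      then have xab: "x = (a, True) \<or> x = (b, True)" using setW by blast
      have "count A x \<noteq> 0" "even (count A x)" using x xab by auto
      then have "2 \<le> count A x" by presburger
      then have sub: "{#x, x#} \<subseteq># A" by (auto intro!: mset_subset_eqI)
      have "{#x, x#} \<in> seqs (dihedral n)"
        by (rule evenseq) (use \<open>x \<in># W\<close> in auto)
      moreover have "A - {#x, x#} \<in> seqs (dihedral n)"
        by (rule evenseq) (use x A(2) in \<open>auto dest: in_diffD\<close>)
      ultimately show ?thesis using seq_atom_subset[OF A(1) _ _ sub] by simp
    qed
    from two_reflections_counts[OF n assms(2,7) Aseq] A(2) setW ab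
    consider "even (count A (a, True))" "even (count A (b, True))"
      | "odd (count A (a, True))" "odd (count A (b, True))" "n \<le> count A (a, True)" "n \<le> count A (b, True)"
      by auto
    then show ?thesis
    proof cases
      case 1
      have "A \<noteq> {#}" using A(1) by (simp add: seq_atoms_iff)
      then obtain x where "x \<in># A" by blast
      with sqA 1 show ?thesis by blast
    next
      case 2
      have sub: "W \<subseteq># A"
        using 2 ab by (auto simp: W_def intro!: mset_subset_eqI)
      have "A - W \<in> seqs (dihedral n)"
        by (rule evenseq) (use 2 A(2) ab assms(2) in \<open>auto simp: W_def dest: in_diffD\<close>)
      then have "W = A" using seq_atom_subset[OF A(1) Wseq _ sub] n by (auto simp: W_def)
      then show ?thesis by simp
    qed
  qed
qed

text \<open>The bound by the group order is attained by the reflections with exponents 0 and 1,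
  whose difference is a unit modulo \<open>n\<close>.\<close>

lemma davenport_dihedral_odd:
  assumes "n \<ge> 3" "odd n"
  shows "davenport (dihedral n) (2 * n)"
proof -
  interpret group "dihedral n" using group_dihedral assms(1) by simp
  have "finite (carrier (dihedral n))" "card (carrier (dihedral n)) = 2 * n"
    using order_dihedral[of n] by (auto simp: dihedral_def order_def card_cartesian_product)
  then have "\<forall>A\<in>seq_atoms (dihedral n). size A \<le> 2 * n"
    using seq_atom_size_le by metis
  moreover have "replicate_mset n (0, True) + replicate_mset n (1, True) \<in> seq_atoms (dihedral n)"
    by (rule two_reflections_atom) (use assms in auto)
  ultimately show ?thesis
    unfolding davenport_def by (force simp: mult_2)
qed

lemma progression_dihedral_odd:
  assumes "n \<ge> 3" "odd n"
  shows "progression k (2 * n - 2) \<in> group_length_system (dihedral n)"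
proof -
  interpret group "dihedral n" using group_dihedral assms(1) by simp
  define W where "W = replicate_mset n (0::int, True) + replicate_mset n (1, True)"
  have W: "W \<in> seq_atoms (dihedral n)" unfolding W_def
    by (rule two_reflections_atom) (use assms in auto)
  have "progression k (size W - 2) \<in> group_length_system (dihedral n)"
  proof (rule progression_in_length_system[OF W])
    show "A = W \<or> (\<exists>x. A = {#x, x#})" if "A \<in> seq_atoms (dihedral n)" "set_mset A \<subseteq> set_mset W" for A
      using two_reflections_atom(2)[of n 0 1 A] assms that unfolding W_def by simp
    show "x \<otimes>\<^bsub>dihedral n\<^esub> x = \<one>\<^bsub>dihedral n\<^esub>" if "x \<in># W" for x
      using that assms(1) by (auto simp: W_def dihedral_simps split: if_splits)
  qed (use assms(1) in \<open>simp add: W_def\<close>)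
  then show ?thesis by (simp add: W_def mult_2)
qed

text \<open>
  The exponents \<open>0, 1, 2\<close> differ pairwise by units modulo \<open>n\<close>; the product of the three atoms
  supported on two of the corresponding reflections is a product of \<open>3 n\<close> squares.
\<close>

lemma length_three_dihedral_odd:
  assumes "n \<ge> 3" "odd n"
  shows "\<exists>L\<in>group_length_system (dihedral n). 3 \<in> L \<and> 3 * n \<in> L"
proof -
  interpret group "dihedral n" using group_dihedral assms(1) by simp
  define R where "R = (\<lambda>a::int. replicate_mset n (a, True))"
  have at: "R 0 + R 1 \<in> seq_atoms (dihedral n)" "R 1 + R 2 \<in> seq_atoms (dihedral n)"
    "R 0 + R 2 \<in> seq_atoms (dihedral n)"
    unfolding R_def by (rule two_reflections_atom; use assms in simp)+
  define S where "S = (R 0 + R 1) + (R 1 + R 2) + (R 0 + R 2)"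
  have M: "{#R 0 + R 1, R 1 + R 2, R 0 + R 2#} \<in> factorizations (dihedral n) S"
    using at by (auto simp: factorizations_def S_def)
  define T where "T = R 0 + R 1 + R 2"
  have N: "image_mset (\<lambda>x. {#x, x#}) T \<in> factorizations (dihedral n) S"
  proof -
    have "{#x, x#} \<in> seq_atoms (dihedral n)" if "x \<in># T" for x
    proof -
      have x: "x \<in> carrier (dihedral n)" "x \<otimes>\<^bsub>dihedral n\<^esub> x = \<one>\<^bsub>dihedral n\<^esub>" "x \<noteq> \<one>\<^bsub>dihedral n\<^esub>"
        using that assms(1) by (auto simp: T_def R_def dihedral_simps split: if_splits)
      then show ?thesis using seq_atom_pair[of x] inv_equality[of x x] by simp
    qed
    then show ?thesis
      using sum_pairs[of "\<lambda>x. x" T] by (auto simp: factorizations_def S_def T_def)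
  qed
  have "size (image_mset (\<lambda>x. {#x, x#}) T) = 3 * n" by (simp add: T_def R_def)
  then have "3 * n \<in> size ` factorizations (dihedral n) S" using imageI[OF N, of size] by simp
  moreover have "3 \<in> size ` factorizations (dihedral n) S"
    using imageI[OF M, of size] by (simp add: numeral_3_eq_3)
  ultimately show ?thesis using length_in_system[OF M] by blast
qed

section \<open>Dihedral groups of order 2 m with m even\<close>

text \<open>Put \<open>q = gcd c M\<close>, which is odd, \<open>c = q * c1\<close> and
  \<open>M = q * N\<close>. Then \<beta> is \<open>q\<close>, and \<alpha> is the residue of c'
  divided by \<open>c1\<close> modulo \<open>N\<close> that lies between \<open>- N / 2\<close> and
  \<open>N / 2\<close>. It is odd because \<open>N\<close> is even while \<open>c1\<close> and c'
  are odd.\<close>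

lemma odd_combination_even_modulus:
  fixes c c' M :: int
  assumes "M > 0" "even M" "odd c" "odd c'"
  shows "\<exists>\<alpha> \<beta>. odd \<alpha> \<and> odd \<beta> \<and> M dvd \<alpha> * c - \<beta> * c' \<and> \<bar>\<alpha>\<bar> + \<bar>\<beta>\<bar> + \<bar>\<alpha> + \<beta>\<bar> \<le> M"
proof -
  define q where "q = gcd c M"
  obtain c1 where c1: "c = q * c1" by (metis dvdE gcd_dvd1 q_def)
  obtain N where N: "M = q * N" by (metis dvdE gcd_dvd2 q_def)
  have q: "q > 0" using assms(1) by (simp add: q_def)
  have oq: "odd q" "odd c1" using assms(3) c1 by auto
  have N0: "N > 0" using N q assms(1) by (simp add: zero_less_mult_iff)
  have eN: "even N" using assms(2) N oq by simp
  then have N2: "N \<ge> 2" using N0 by presburger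
  have "coprime c1 N"
  proof -
    have "gcd (q * c1) (q * N) = q" unfolding c1[symmetric] N[symmetric] by (simp add: q_def)
    then have "q * gcd c1 N = q" using q gcd_mult_distrib_int[of q c1 N] by simp
    then show ?thesis using q by (simp add: coprime_iff_gcd_eq_1)
  qed
  then obtain r s where "r * c1 + s * N = 1"
    using bezout_int[of c1 N] by (auto simp: coprime_iff_gcd_eq_1)
  then have "c1 * r - 1 = N * (- s)" by (simp add: algebra_simps)
  then have r: "N dvd c1 * r - 1" by simp
  define h where "h = N div 2"
  have h: "N = 2 * h" using eN by (simp add: h_def)
  define \<alpha> where "\<alpha> = (r * c' + h) mod N - h"
  have ar: "N dvd \<alpha> - r * c'"
  proof -
    have "\<alpha> - r * c' = (r * c' + h) mod N - (r * c' + h)" by (simp add: \<alpha>_def)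
    moreover have "N dvd (r * c' + h) - (r * c' + h) mod N" by (rule dvd_minus_mod)
    ultimately show ?thesis by (metis dvd_minus_iff minus_diff_eq)
  qed
  have rng: "- h \<le> \<alpha>" "\<alpha> < h"
    using pos_mod_bound[OF N0, of "r * c' + h"] pos_mod_sign[OF N0, of "r * c' + h"] h by (auto simp: \<alpha>_def)
  have dv: "N dvd \<alpha> * c1 - c'"
  proof -
    have "\<alpha> * c1 - c' = (\<alpha> - r * c') * c1 + (c1 * r - 1) * c'" by (simp add: algebra_simps)
    then show ?thesis using ar r by simp
  qed
  have oa: "odd \<alpha>"
  proof
    assume "even \<alpha>"
    then have "odd (\<alpha> * c1 - c')" using assms(4) by simp
    moreover have "2 dvd \<alpha> * c1 - c'" using dv eN by (rule dvd_trans[rotated])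
    ultimately show False by blast
  qed
  have "M dvd \<alpha> * c - q * c'"
  proof -
    have "\<alpha> * c - q * c' = q * (\<alpha> * c1 - c')" by (simp add: c1 algebra_simps)
    then show ?thesis using dv N by simp
  qed
  moreover have "\<bar>\<alpha>\<bar> + \<bar>q\<bar> + \<bar>\<alpha> + q\<bar> \<le> M"
  proof -
    \<comment> \<open>Expanded, this bounds the sum for \<alpha> \<ge> 0; for negative \<alpha> the
      sum is at most \<open>N\<close> or \<open>2 * q\<close>, according to the sign of \<alpha> +
      \<open>q\<close>.\<close>
    have "0 \<le> (N - 2) * (q - 1)" using N2 q by simp
    then have 1: "N + 2 * q - 2 \<le> M" by (simp add: N algebra_simps)
    have 2: "N \<le> M" "2 * q \<le> M"
      using mult_right_mono[of 1 q N] mult_right_mono[of 2 N q] q N2 by (auto simp: N mult.commute)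
    show ?thesis using 1 2 rng h q by linarith
  qed
  ultimately show ?thesis using oa oq by blast
qed

text \<open>
  Among the three differences of \<open>x, y, p\<close> the two of smallest \<open>2\<close>-adic valuation have the same
  valuation; dividing by that power of two reduces the claim to odd differences.
\<close>

lemma short_even_combination:
  fixes x y p m :: int
  assumes m: "m > 0" "even m"
    and xy: "\<And>q. odd q \<Longrightarrow> \<not> m dvd q * (y - x)" and xp: "\<And>q. odd q \<Longrightarrow> \<not> m dvd q * (p - x)"
    and yp: "\<And>q. odd q \<Longrightarrow> \<not> m dvd q * (p - y)"
  obtains \<alpha> \<beta> \<gamma> where "\<alpha> + \<beta> + \<gamma> = 0" "m dvd \<alpha> * x + \<beta> * y + \<gamma> * p"
    "\<bar>\<alpha>\<bar> + \<bar>\<beta>\<bar> + \<bar>\<gamma>\<bar> \<le> m" "odd \<alpha> \<or> odd \<beta> \<or> odd \<gamma>"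
proof -
  have two: "\<exists>v t. odd t \<and> k = 2 ^ v * t" if k: "k \<noteq> 0" for k :: int
  proof -
    obtain t where "k = 2 ^ multiplicity 2 k * t" "\<not> 2 dvd t"
      by (rule multiplicity_decompose'[of k 2]) (use k in auto)
    then show ?thesis by blast
  qed
  have core: "\<exists>\<alpha> \<beta> \<gamma>. \<alpha> + \<beta> + \<gamma> = 0 \<and> m dvd \<alpha> * x + \<beta> * y + \<gamma> * p \<and>
      \<bar>\<alpha>\<bar> + \<bar>\<beta>\<bar> + \<bar>\<gamma>\<bar> \<le> m \<and> (odd \<alpha> \<or> odd \<beta> \<or> odd \<gamma>)"
    if eq: "p - x = 2 ^ v * c" "y - p = 2 ^ v * c'" and odds: "odd c" "odd c'"
      and xp: "\<And>q. odd q \<Longrightarrow> \<not> m dvd q * (p - x)" for x y p c c' :: int and v :: nat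
  proof -
    obtain s t where st: "odd t" "m = 2 ^ s * t" using two[of m] m by auto
    \<comment> \<open>Otherwise the odd part \<open>t\<close> of \<open>m\<close> times
      \<open>p - x\<close> would be divisible by \<open>m\<close>. Hence an even modulus
      \<open>M\<close> remains after division by \<open>2 ^ v\<close>.\<close>
    have "v < s"
    proof (rule ccontr)
      assume "\<not> v < s"
      then have "(2::int) ^ s dvd 2 ^ v" by (simp add: le_imp_power_dvd)
      then have "m dvd t * (p - x)" unfolding st(2) eq(1) by (simp add: mult.commute mult_dvd_mono)
      with xp st(1) show False by blast
    qed
    define M where "M = 2 ^ (s - v) * t"
    have mM: "m = 2 ^ v * M" using \<open>v < s\<close> st(2) by (simp add: M_def mult.assoc[symmetric] power_add[symmetric])
    have "M > 0" using m(1) mM by (simp add: zero_less_mult_iff)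
    moreover have "even M" using \<open>v < s\<close> by (simp add: M_def)
    ultimately obtain \<alpha> \<beta> where ab: "odd \<alpha>" "odd \<beta>" "M dvd \<alpha> * c - \<beta> * c'"
      "\<bar>\<alpha>\<bar> + \<bar>\<beta>\<bar> + \<bar>\<alpha> + \<beta>\<bar> \<le> M"
      using odd_combination_even_modulus odds by blast
    have "\<alpha> * x + \<beta> * y + (- (\<alpha> + \<beta>)) * p = \<beta> * (y - p) - \<alpha> * (p - x)" by (simp add: algebra_simps)
    also have "\<dots> = - (2 ^ v * (\<alpha> * c - \<beta> * c'))" unfolding eq by (simp add: algebra_simps)
    finally have "m dvd \<alpha> * x + \<beta> * y + (- (\<alpha> + \<beta>)) * p" using ab(3) mM by simp
    moreover have "M \<le> m" using mM \<open>M > 0\<close> mult_right_mono[of 1 "2 ^ v" M] by simp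
    then have "\<bar>\<alpha>\<bar> + \<bar>\<beta>\<bar> + \<bar>- (\<alpha> + \<beta>)\<bar> \<le> m" using ab(4) by linarith
    ultimately show ?thesis using ab(1) by (intro exI[of _ \<alpha>] exI[of _ \<beta>] exI[of _ "- (\<alpha> + \<beta>)"]) simp
  qed
  define g where "g = gcd (p - x) (y - p)"
  have "p - x \<noteq> 0" using xp[of 1] by auto
  then have "g \<noteq> 0" by (simp add: g_def)
  then obtain v g' where g': "odd g'" "g = 2 ^ v * g'" using two by blast
  obtain u where u: "p - x = g * u" by (metis dvdE gcd_dvd1 g_def)
  obtain w where w: "y - p = g * w" by (metis dvdE gcd_dvd2 g_def)
  have uw: "\<not> (even u \<and> even w)"
  proof
    assume "even u \<and> even w"
    then have "g * 2 dvd p - x" "g * 2 dvd y - p" using u w by (simp_all add: mult_dvd_mono)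
    then have "g * 2 dvd g" unfolding g_def by (rule gcd_greatest)
    then show False using \<open>g \<noteq> 0\<close> by simp
  qed
  have px: "p - x = 2 ^ v * (g' * u)" and yp': "y - p = 2 ^ v * (g' * w)"
    using u w g'(2) by simp_all
  have neg: "\<not> m dvd q * (b - a)" if "\<And>q. odd q \<Longrightarrow> \<not> m dvd q * (a - b)" "odd q" for a b q :: int
  proof -
    have "q * (b - a) = - (q * (a - b))" by (simp add: algebra_simps)
    then show ?thesis using that by (metis dvd_minus_iff)
  qed
  \<comment> \<open>If exactly one of the cofactors is even, then \<open>y - x\<close> has valuation
    \<open>v\<close> too, and \<open>core\<close> applies with the three points permuted.\<close>
  consider "odd u" "odd w" | "odd u" "even w" | "even u" "odd w" using uw by blast
  then show thesis
  proof cases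
    case 1
    then show thesis using core[OF px yp' _ _ xp] g'(1) that by auto
  next
    case 2
    have "x - p = 2 ^ v * (- (g' * u))" "y - x = 2 ^ v * (g' * u + g' * w)"
      using px yp' by (simp_all add: algebra_simps)
    from core[OF this _ _ neg[OF xp]] 2 g'(1) obtain \<alpha> \<beta> \<gamma> where
      "\<alpha> + \<beta> + \<gamma> = 0" "m dvd \<alpha> * p + \<beta> * y + \<gamma> * x" "\<bar>\<alpha>\<bar> + \<bar>\<beta>\<bar> + \<bar>\<gamma>\<bar> \<le> m" "odd \<alpha> \<or> odd \<beta> \<or> odd \<gamma>"
      by auto
    then show thesis using that[of \<gamma> \<beta> \<alpha>] by (simp add: algebra_simps) blast
  next
    case 3
    have "y - x = 2 ^ v * (g' * u + g' * w)" "p - y = 2 ^ v * (- (g' * w))"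
      using px yp' by (simp_all add: algebra_simps)
    from core[OF this _ _ xy] 3 g'(1) obtain \<alpha> \<beta> \<gamma> where
      "\<alpha> + \<beta> + \<gamma> = 0" "m dvd \<alpha> * x + \<beta> * p + \<gamma> * y" "\<bar>\<alpha>\<bar> + \<bar>\<beta>\<bar> + \<bar>\<gamma>\<bar> \<le> m" "odd \<alpha> \<or> odd \<beta> \<or> odd \<gamma>"
      by auto
    then show thesis using that[of \<alpha> \<gamma> \<beta>] by (simp add: algebra_simps) blast
  qed
qed

text \<open>Shifting by half the modulus before reduction gives a residue of least absolute value.
  The last clause lets a nonzero residue witness a nonzero \<open>q\<close>.\<close>

lemma symmetric_residue:
  fixes q m :: int
  assumes "m > 0" "even m"
  obtains r where "m dvd q - r" "2 * \<bar>r\<bar> \<le> m" "q = 0 \<Longrightarrow> r = 0"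
proof -
  define h where "h = m div 2"
  have h: "m = 2 * h" using assms by (simp add: h_def)
  define r where "r = (q + h) mod m - h"
  have "q - r = (q + h) - (q + h) mod m" by (simp add: r_def)
  then have "m dvd q - r" by (metis dvd_minus_mod)
  moreover have "2 * \<bar>r\<bar> \<le> m"
    using pos_mod_bound[OF assms(1), of "q + h"] pos_mod_sign[OF assms(1), of "q + h"] h by (auto simp: r_def)
  moreover have "r = 0" if "q = 0" using that h assms(1) by (simp add: r_def)
  ultimately show thesis using that by blast
qed

lemma dihedral_pow_rotation: "(1, False) [^]\<^bsub>dihedral m\<^esub> (k::nat) = (int k mod int m, False)"
  if "m > 0"
proof -
  interpret group "dihedral m" using group_dihedral that .
  show ?thesis
    by (induction k) (simp_all add: dihedral_simps mod_simps algebra_simps)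
qed

text \<open>Reflections lie outside the subgroup generated by a rotation of order \<open>m\<close>,
  so \<open>noncyclic_long_atom\<close> applies.\<close>

lemma long_atom_dihedral:
  assumes "m \<ge> 2"
  shows "\<exists>A\<in>seq_atoms (dihedral m). size A = m + 1"
proof -
  interpret group "dihedral m" using group_dihedral assms by simp
  have g: "(1, False) \<in> carrier (dihedral m)" using assms by (simp add: dihedral_simps)
  have m: "m > 0" using assms by simp
  have "ord (1, False) = m"
  proof (rule ord_unique[THEN iffD2, OF g], rule allI)
    fix d
    show "(1, False) [^]\<^bsub>dihedral m\<^esub> d = \<one>\<^bsub>dihedral m\<^esub> \<longleftrightarrow> m dvd d"
      unfolding dihedral_pow_rotation[OF m] dihedral_simps(3)
      by (simp add: dvd_eq_mod_eq_0 flip: of_nat_mod)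
  qed
  moreover have "\<exists>A\<in>seq_atoms (dihedral m). size A = ord (1, False) + 1"
  proof (rule noncyclic_long_atom[OF _ g])
    show "finite (carrier (dihedral m))" by (simp add: dihedral_def)
    show "(0, True) \<in> carrier (dihedral m)" using m by (simp add: dihedral_simps)
    show "(0, True) \<noteq> (1, False) [^]\<^bsub>dihedral m\<^esub> i" for i :: nat
      unfolding dihedral_pow_rotation[OF m] by simp
  qed
  ultimately show ?thesis by simp
qed

lemma dihedral_pow_eq_one:
  assumes "m > 0" "x \<in> carrier (dihedral m)"
  shows "snd x \<Longrightarrow> x [^]\<^bsub>dihedral m\<^esub> (2::nat) = \<one>\<^bsub>dihedral m\<^esub>"
    "\<not> snd x \<Longrightarrow> x [^]\<^bsub>dihedral m\<^esub> m = \<one>\<^bsub>dihedral m\<^esub>"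
proof -
  interpret group "dihedral m" using group_dihedral assms(1) .
  obtain a s where x: "x = (a, s)" by fastforce
  show "x [^]\<^bsub>dihedral m\<^esub> (2::nat) = \<one>\<^bsub>dihedral m\<^esub>" if "snd x"
    using that assms x by (simp add: numeral_2_eq_2) (simp add: dihedral_simps)
  show "x [^]\<^bsub>dihedral m\<^esub> m = \<one>\<^bsub>dihedral m\<^esub>" if "\<not> snd x"
  proof -
    have "(a, False) [^]\<^bsub>dihedral m\<^esub> (k::nat) = (int k * a mod int m, False)" for k
      by (induction k) (simp_all add: dihedral_simps mod_simps algebra_simps)
    then show ?thesis using that x by (simp add: dihedral_simps)
  qed
qed

text \<open>The atom \<open>U\<close> from \<open>progression_atom\<close> consists of involutions,
  and product-one sequences shorter than \<open>D\<close> over its support are products of squares.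
  This limits \<open>U\<close> to two reflections and the central rotation; reducing the
  coefficients modulo \<open>m\<close> then yields short sequences showing that all multiplicities
  in \<open>U\<close> are even.\<close>

lemma no_progression_dihedral_even:
  assumes "m \<ge> 3" "even m" "even D" "davenport (dihedral m) D"
  shows "\<exists>k\<ge>1. progression k (D - 2) \<notin> group_length_system (dihedral m)"
proof (rule ccontr)
  assume fam: "\<not> ?thesis"
  have m: "m > 0" using assms(1) by simp
  interpret group "dihedral m" using group_dihedral[OF m] .
  have fin: "finite (carrier (dihedral m))" by (simp add: dihedral_def)
  have "m + 1 \<le> D" using long_atom_dihedral[of m] assms(1,4) by (force simp: davenport_def)
  \<comment> \<open>Both numbers are even. The gap of two leaves room for sequences of size
    \<open>m + 1\<close> below \<open>D\<close>, and it exceeds every element order.\<close>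
  then have D: "m + 2 \<le> D" using assms(2,3) by presburger
  obtain U where U: "U \<in> seq_atoms (dihedral m)" "size U = D"
    "(\<exists>g\<in>#U. ord g = D) \<or>
     ((\<forall>g\<in>#U. g \<otimes>\<^bsub>dihedral m\<^esub> g = \<one>\<^bsub>dihedral m\<^esub>) \<and>
      (\<forall>A\<in>seq_atoms (dihedral m). set_mset A \<subseteq> set_mset U \<longrightarrow> size A = 2 \<or> size A = D))"
    by (rule progression_atom[OF fin assms(4)]) (use fam D assms(1) in auto)
  have Uc: "x \<in> carrier (dihedral m)" if "x \<in># U" for x using seq_atoms_carrier[OF U(1) that] .
  have ordle: "ord x \<le> m" if "x \<in># U" for x
  proof (cases "snd x")
    case True
    then have "ord x dvd 2" using dihedral_pow_eq_one(1)[OF m Uc[OF that]] pow_eq_id[OF Uc[OF that]] by blast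
    then have "ord x \<le> 2" by (rule dvd_imp_le) simp
    then show ?thesis using assms(1) by simp
  next
    case False
    then have "ord x dvd m" using dihedral_pow_eq_one(2)[OF m Uc[OF that]] pow_eq_id[OF Uc[OF that]] by blast
    then show ?thesis using m by (rule dvd_imp_le)
  qed
  then have inv: "x \<otimes>\<^bsub>dihedral m\<^esub> x = \<one>\<^bsub>dihedral m\<^esub>" if "x \<in># U" for x
    using U(3) D that by force
  have atoms: "size A = 2 \<or> size A = D" if "A \<in> seq_atoms (dihedral m)" "set_mset A \<subseteq> set_mset U" for A
    using U(3) that ordle D by force
  \<comment> \<open>Atoms of such a sequence have size below \<open>D\<close>, hence size 2, and
    over involutions they are squares.\<close>
  have even: "even (count Q x)"
    if Q: "Q \<in> seqs (dihedral m)" "set_mset Q \<subseteq> set_mset U" "size Q < D" for Q x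
  proof -
    obtain F where F: "F \<in> factorizations (dihedral m) Q" using factorization_exists Q(1) by blast
    have "even (count A x)" if A: "A \<in># F" for A
    proof -
      have at: "A \<in> seq_atoms (dihedral m)" and le: "A \<subseteq># Q"
        using in_factorization_seqs[OF F A] in_factorization_le[OF F A] by auto
      have "set_mset A \<subseteq> set_mset U" "size A < D"
        using set_mset_mono[OF le] size_mset_mono[OF le] Q(2,3) by auto
      then have "size A = 2" using atoms[OF at] by auto
      moreover have "A \<noteq> {#}" using at by (simp add: seq_atoms_iff)
      then obtain g where g: "g \<in># A" by blast
      ultimately have "A = {#g, inv\<^bsub>dihedral m\<^esub> g#}" using size_two_atom[OF at] by blast
      moreover have "g \<in># U" using g le Q(2) by (meson mset_subset_eqD subsetD)
      then have "inv\<^bsub>dihedral m\<^esub> g = g" using inv Uc inv_equality by blast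
      ultimately show ?thesis by simp
    qed
    then have "even (count (\<Sum>\<^sub># F) x)" by (induction F) auto
    then show ?thesis using F by (simp add: factorizations_def)
  qed
  define R where "R = {a. (a, True) \<in># U}"
  have Rr: "0 \<le> a \<and> a < int m" if "a \<in> R" for a using Uc[of "(a, True)"] that by (simp add: R_def dihedral_simps)
  have evm: "even (int m)" and posm: "int m > 0" using assms(2) m by auto
  have cnt: "count (signed_reflections k a) (a, True) = nat \<bar>k\<bar>"
    "b \<noteq> a \<Longrightarrow> count (signed_reflections k a) (b, True) = 0" "count (signed_reflections k a) (b, False) = 0" for k a b
    by (auto simp: signed_reflections_def)
  have signed_sub: "set_mset (signed_reflections k a) \<subseteq> set_mset U" if "k \<noteq> 0 \<Longrightarrow> a \<in> R" for k a
    using that by (auto simp: signed_reflections_def R_def)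
  have neg: "signed_reflections (- k) a = signed_reflections k a" for k a by (simp add: signed_reflections_def)
  have zero: "signed_reflections 0 a = {#}" for a by (simp add: signed_reflections_def)
  \<comment> \<open>Replacing \<open>q\<close> by its least residue \<open>r\<close>, which is odd
    too, gives a sequence of size at most \<open>m\<close> in which each of the two reflections
    occurs \<bar>r\<bar> times.\<close>
  have no_odd: "\<not> int m dvd q * (b - a)" if ab: "a \<in> R" "b \<in> R" "a \<noteq> b" and q: "odd q" for a b q
  proof
    assume dv: "int m dvd q * (b - a)"
    obtain r where r: "int m dvd q - r" "2 * \<bar>r\<bar> \<le> int m" using symmetric_residue[OF posm evm] by metis
    have "even (q - r)" using dvd_trans[OF evm r(1)] .
    then have "odd r" using q by simp
    have "int m dvd q * (b - a) - (q - r) * (b - a)" using dv r(1) by (intro dvd_diff) auto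
    then have "int m dvd (- r) * a + r * b + 0 * a" by (simp add: algebra_simps)
    then have Q: "signed_reflections (- r) a + signed_reflections r b + signed_reflections 0 a \<in> seqs (dihedral m)"
      by (intro signed_reflections_in_seqs[OF m]) (use Rr ab in auto)
    have "even (count (signed_reflections r a + signed_reflections r b) (a, True))"
      by (rule even) (use Q ab r(2) D signed_sub in \<open>auto simp: neg zero\<close>)
    then show False using \<open>odd r\<close> ab(3) by (simp add: cnt even_nat_iff)
  qed
  have three: False if R3: "a \<in> R" "b \<in> R" "c \<in> R" "a \<noteq> b" "a \<noteq> c" "b \<noteq> c" for a b c
  proof -
    obtain \<alpha> \<beta> \<gamma> where abc: "\<alpha> + \<beta> + \<gamma> = 0" "int m dvd \<alpha> * a + \<beta> * b + \<gamma> * c"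
      "\<bar>\<alpha>\<bar> + \<bar>\<beta>\<bar> + \<bar>\<gamma>\<bar> \<le> int m" "odd \<alpha> \<or> odd \<beta> \<or> odd \<gamma>"
      using short_even_combination[OF posm evm no_odd[OF R3(1,2,4)] no_odd[OF R3(1,3,5)] no_odd[OF R3(2,3,6)]]
      by blast
    define Q where "Q = signed_reflections \<alpha> a + signed_reflections \<beta> b + signed_reflections \<gamma> c"
    have "Q \<in> seqs (dihedral m)" unfolding Q_def
      by (rule signed_reflections_in_seqs[OF m abc(1,2)]) (use Rr R3 in auto)
    then have "even (count Q x)" for x
      by (rule even) (use abc(3) D signed_sub R3 in \<open>auto simp: Q_def\<close>)
    from this[of "(a, True)"] this[of "(b, True)"] this[of "(c, True)"] show False
      using abc(4) R3(4-6) by (auto simp: Q_def cnt even_nat_iff)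
  qed
  \<comment> \<open>If fewer than two reflections occur in \<open>U\<close>, dummy exponents fill up
    the pair, since \<open>seqs_dihedral_form\<close> expects two distinct ones.\<close>
  obtain a b where ab: "a \<noteq> b" "R \<subseteq> {a, b}" "0 \<le> a" "a < int m" "0 \<le> b" "b < int m"
  proof -
    consider "R = {}" | a where "R = {a}" | a b where "a \<in> R" "b \<in> R" "a \<noteq> b" by blast
    then show thesis
    proof cases
      case 1
      then show thesis using that[of 0 1] assms(1) by auto
    next
      case (2 a)
      then show thesis
        using that[of a "if a = 0 then 1 else 0"] Rr[of a] assms(1) by (auto split: if_splits)
    next
      case (3 a b)
      then show thesis using that[of a b] Rr three by blast
    qed
  qed
  define z where "z = int m div 2"
  have z: "int m = 2 * z" using evm by (simp add: z_def)
  have supp: "set_mset U \<subseteq> {(a, True), (b, True), (z, False)}"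
  proof
    fix x assume x: "x \<in># U"
    obtain c s where cs: "x = (c, s)" by fastforce
    show "x \<in> {(a, True), (b, True), (z, False)}"
    proof (cases s)
      case True
      then show ?thesis using ab(2) x cs by (auto simp: R_def)
    next
      case False
      have c: "0 \<le> c" "c < int m" using Uc[OF x] cs by (auto simp: dihedral_simps)
      have "int m dvd c + c" using inv[OF x] cs False by (simp add: dihedral_simps dvd_eq_mod_eq_0)
      then obtain e where e: "c + c = int m * e" by blast
      moreover have "x \<noteq> \<one>\<^bsub>dihedral m\<^esub>"
        using weight_atom[OF U(1)] x U(2) D by auto
      then have "c \<noteq> 0" using cs False by (simp add: dihedral_simps)
      ultimately have "0 < int m * e" "int m * e < int m * 2" using c by linarith+
      then have "e = 1" using posm by (simp add: zero_less_mult_iff)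
      then have "c = z" using e z by simp
      then show ?thesis using cs False by simp
    qed
  qed
  obtain q t where qt: "int m dvd q * (b - a) + t * z"
    "even (q - int (count U (a, True)))" "even (q - int (count U (b, True)))"
    "even (t - int (count U (z, False)))"
    "\<bar>q\<bar> \<le> int (count U (a, True))" "\<bar>q\<bar> \<le> int (count U (b, True))"
    using seqs_dihedral_form[OF m seq_atoms_seqs[OF U(1)] ab(1) supp] by blast
  obtain r where r: "int m dvd q - r" "2 * \<bar>r\<bar> \<le> int m" "q = 0 \<Longrightarrow> r = 0"
    using symmetric_residue[OF posm evm] by metis
  have rR: "a \<in> R \<and> b \<in> R" if "r \<noteq> 0"
  proof -
    have "q \<noteq> 0" using r(3) that by blast
    then have "count U (a, True) \<noteq> 0" "count U (b, True) \<noteq> 0" using qt(5,6) by linarith+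
    then show ?thesis by (simp add: R_def)
  qed
  have rt: "int m dvd r * (b - a) + t * z"
  proof -
    have "int m dvd (q * (b - a) + t * z) - (q - r) * (b - a)" using qt(1) r(1) by (intro dvd_diff) auto
    then show ?thesis by (simp add: algebra_simps)
  qed
  \<comment> \<open>For odd \<open>t\<close> the term \<open>t * z\<close> is congruent to
    \<open>z\<close> modulo \<open>m\<close>. One central rotation and \<bar>r\<bar> copies of each
    reflection then form a product-one sequence of size at most \<open>m + 1\<close>, in which the
    rotation occurs once.\<close>
  have "even t"
  proof (rule ccontr)
    assume "odd t"
    then obtain t' where t': "t = 2 * t' + 1" by (elim oddE)
    have "t * z = int m * t' + z" by (simp add: t' z algebra_simps)
    then have "int m dvd z + r * (b - a)" using rt
      by (metis add.assoc add.commute dvd_add_left_iff dvd_triv_left)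
    then have Q: "add_mset (z, False) (signed_reflections r a + signed_reflections r b) \<in> seqs (dihedral m)"
      by (rule rotation_signed_reflections_in_seqs[OF m]) (use ab z posm in auto)
    have "count U (z, False) \<noteq> 0" using qt(4) \<open>odd t\<close> by (intro notI) simp
    then have "(z, False) \<in># U" by simp
    then have "even (count (add_mset (z, False) (signed_reflections r a + signed_reflections r b)) (z, False))"
      by (intro even[OF Q]) (use rR r(2) D signed_sub in \<open>auto\<close>)
    then show False by (simp add: cnt)
  qed
  \<comment> \<open>Now \<open>t * z\<close> vanishes modulo \<open>m\<close>, and an odd
    \<open>q\<close> would be a relation excluded by \<open>no_odd\<close>.\<close>
  moreover have "even q"
  proof (rule ccontr)
    assume oq: "odd q"
    have "even (q - r)" using dvd_trans[OF evm r(1)] .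
    then have "r \<noteq> 0" using oq by auto
    obtain t' where "t = 2 * t'" using \<open>even t\<close> by (elim evenE)
    then have "t * z = int m * t'" by (simp add: z)
    then have "int m dvd q * (b - a)" using qt(1) by (simp add: dvd_add_left_iff)
    then show False using no_odd rR[OF \<open>r \<noteq> 0\<close>] ab(1) oq by blast
  qed
  ultimately have "even (count U (a, True))" "even (count U (b, True))" "even (count U (z, False))"
    using qt(2-4) by simp_all
  then have "even (count U x)" for x
    using supp by (cases "x \<in># U") (auto simp: not_in_iff)
  moreover have "\<exists>x. odd (count U x)"
    by (rule involutive_atom_odd_count[OF U(1)]) (use U(2) D assms(1) inv in auto)
  ultimately show False by blast
qed

section \<open>Exclusion of difference 2 n - 3 for odd n\<close>

text \<open>Such progressions would give an atom \<open>U\<close> with more than \<open>n\<close>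
  terms such that all factorization lengths of its power with exponent \<open>2 n\<close> agree
  modulo the odd number \<open>d = 2 n - 3\<close>. Subsequences of this power with two lengths
  whose difference is even, nonzero and less than \<open>2 d\<close> contradict this, provided that
  their complements are product-one.\<close>

lemma no_progression_dihedral_odd:
  assumes n: "n \<ge> 3" "odd n"
  shows "\<exists>k\<ge>1. progression k (2 * n - 3) \<notin> group_length_system (dihedral n)"
proof (rule ccontr)
  assume fam: "\<not> ?thesis"
  have n0: "n > 0" using n(1) by simp
  interpret group "dihedral n" using group_dihedral[OF n0] .
  let ?G = "dihedral n"
  define d where "d = 2 * n - 3"
  have d: "odd d" "n \<le> d" using n by (auto simp: d_def)
  have fin: "finite (carrier ?G)" by (simp add: dihedral_def)
  define k where "k = 2 * n * card (seq_atoms ?G) + 1"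
  have "progression k d \<in> group_length_system ?G" using fam by (auto simp: k_def d_def)
  then obtain S where S: "size ` factorizations ?G S = progression k d"
    unfolding group_length_system_eq by auto
  have "2 * k \<in> progression k d" unfolding progression_def by (auto intro!: exI[of _ 0])
  then obtain M where M: "M \<in> factorizations ?G S" "size M = 2 * k"
    unfolding S[symmetric] by auto
  have "2 * k + k * d \<in> progression k d" unfolding progression_def by auto
  then obtain N where N: "N \<in> factorizations ?G S" "size N = 2 * k + k * d"
    unfolding S[symmetric] by force
  have wle: "weight A \<le> 2 * n" if "A \<in># M" for A
  proof -
    have "size A \<le> 2 * n"
      using davenport_dihedral_odd[OF n] in_factorization_seqs[OF M(1) that] by (simp add: davenport_def)
    then show ?thesis using weight_atom[OF in_factorization_seqs[OF M(1) that]] n by auto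
  qed
  define M' where "M' = filter_mset (\<lambda>A. n < weight A) M"
  \<comment> \<open>The average weight in \<open>M\<close> is at least \<open>2 n - 1\<close> and
    the maximum is \<open>2 n\<close>, so at least half of the \<open>2 k\<close> atoms weigh more
    than \<open>n\<close>.\<close>
  have "k \<le> size M'"
  proof -
    let ?M'' = "filter_mset (\<lambda>A. \<not> n < weight A) M"
    have part: "M = M' + ?M''" unfolding M'_def by (rule multiset_partition)
    have "(\<Sum>A\<in>#M. weight A) = weight S"
      using M(1) weight_sum[of M] by (simp add: factorizations_def)
    then have "weight S = (\<Sum>A\<in>#M'. weight A) + (\<Sum>A\<in>#?M''. weight A)"
      by (metis part image_mset_union sum_mset.union)
    moreover have "(\<Sum>A\<in>#M'. weight A) \<le> 2 * n * size M'"
      by (rule sum_mset_le_const) (simp add: M'_def wle)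
    moreover have "(\<Sum>A\<in>#?M''. weight A) \<le> n * size ?M''"
      by (rule sum_mset_le_const) simp
    moreover have "2 * (2 * k + k * d) \<le> weight S" using weight_factorization_ge[OF N(1)] N(2) by simp
    ultimately have *: "2 * (2 * k + k * d) \<le> 2 * n * size M' + n * size ?M''"
      by linarith
    have "2 * k = size M' + size ?M''" using M(2) part by (metis size_union)
    then have "2 * n * size M' + n * size ?M'' = n * size M' + 2 * k * n"
      by (simp add: algebra_simps)
    moreover have "2 * (2 * k + k * d) = 2 * k * n + 2 * k * (n - 1)"
      using n by (auto simp: le_iff_add d_def algebra_simps)
    ultimately have "2 * k * (n - 1) \<le> n * size M'" using * by linarith
    moreover have "n * k \<le> 2 * k * (n - 1)" using n by (auto simp: le_iff_add algebra_simps)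
    ultimately have "n * k \<le> n * size M'" by linarith
    then show ?thesis using n0 by simp
  qed
  then have "2 * n * card (seq_atoms ?G) < size M'" by (simp add: k_def)
  then obtain U where U': "U \<in># M'" "2 * n < count M' U"
    using mset_pigeonhole[OF finite_seq_atoms[OF fin], of M'] M(1) by (auto simp: factorizations_def M'_def)
  then have U: "U \<in># M" "2 * n \<le> count M U" "n < weight U" by (auto simp: M'_def split: if_splits)
  have Uat: "U \<in> seq_atoms ?G" using in_factorization_seqs[OF M(1) U(1)] .
  have Usz: "n < size U" and U1: "\<one>\<^bsub>?G\<^esub> \<notin># U" using weight_atom[OF Uat] U(3) n by auto
  have Uc: "x \<in> carrier ?G" if "x \<in># U" for x using seq_atoms_carrier[OF Uat that] .
  define P where "P = replicate_mset (2 * n) U"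
  define V where "V = repeat_mset (2 * n) U"
  have PV: "\<Sum>\<^sub># P = V"
  proof -
    have "\<Sum>\<^sub># (replicate_mset j U) = repeat_mset j U" for j by (induction j) auto
    then show ?thesis by (simp add: P_def V_def)
  qed
  have PM: "P \<subseteq># M" using U(2) by (simp add: P_def count_le_replicate_mset_subset_eq[symmetric])
  have V_len: "int d dvd int (size F) - int (size P)" if "F \<in> factorizations ?G V" for F
  proof -
    have "size (M - P + F) \<in> progression k d"
      using factorization_exchange[OF M(1) PM] that unfolding S[symmetric] PV by blast
    then obtain i where i: "size (M - P + F) = 2 * k + i * d" by (auto simp: progression_def)
    have "size (M - P) + size P = size M" using PM by (metis size_union subset_mset.diff_add)
    then have "int (size F) - int (size P) = int d * int i" using i M(2) by (simp add: algebra_simps flip: of_nat_mult of_nat_add)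
    then show ?thesis by simp
  qed
  have V_count: "count V x = 2 * n * count U x" for x by (simp add: V_def)
  \<comment> \<open>The exponent of the group divides \<open>2 n\<close>; removing terms in
    multiples of \<open>2 n\<close> from \<open>V\<close> therefore keeps it product-one.\<close>
  have pow: "x [^]\<^bsub>?G\<^esub> (2 * n * j) = \<one>\<^bsub>?G\<^esub>" if "x \<in># U" for x j
  proof (cases "snd x")
    case True
    have "x [^]\<^bsub>?G\<^esub> (2 * (n * j)) = (x [^]\<^bsub>?G\<^esub> (2::nat)) [^]\<^bsub>?G\<^esub> (n * j)"
      using Uc[OF that] by (simp add: nat_pow_pow)
    then show ?thesis using dihedral_pow_eq_one(1)[OF n0 Uc[OF that] True] by (simp add: mult.assoc)
  next
    case False
    have "x [^]\<^bsub>?G\<^esub> (n * (2 * j)) = (x [^]\<^bsub>?G\<^esub> n) [^]\<^bsub>?G\<^esub> (2 * j)"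
      using Uc[OF that] by (simp add: nat_pow_pow)
    then show ?thesis using dihedral_pow_eq_one(2)[OF n0 Uc[OF that] False] by (simp add: mult_ac)
  qed
  \<comment> \<open>Two factorizations of \<open>Q\<close> are completed by the same factorization
    of the complement, so their lengths inherit the congruence.\<close>
  have Q_len: "int d dvd int (size F) - int (size F')"
    if Q: "Q \<subseteq># V" "V - Q \<in> seqs ?G" and F: "F \<in> factorizations ?G Q" "F' \<in> factorizations ?G Q" for Q F F'
  proof -
    obtain R where R: "R \<in> factorizations ?G (V - Q)" using factorization_exists[OF Q(2)] by blast
    have eq: "Q + (V - Q) = V" using Q(1) by simp
    have FR: "F + R \<in> factorizations ?G V" "F' + R \<in> factorizations ?G V"
      using factorizations_add[OF F(1) R] factorizations_add[OF F(2) R] unfolding eq by auto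
    have "int d dvd (int (size (F + R)) - int (size P)) - (int (size (F' + R)) - int (size P))"
      by (rule dvd_diff[OF V_len[OF FR(1)] V_len[OF FR(2)]])
    then show ?thesis by simp
  qed
  have small: "j = 0" if "int d dvd int (2 * j)" "2 * j < 2 * d" for j
  proof (rule ccontr)
    assume "j \<noteq> 0"
    have "d dvd 2 * j" using that(1) by (simp only: int_dvd_int_iff)
    then obtain e where e: "2 * j = d * e" by blast
    then have "e < 2" using that(2) by simp
    moreover have "e \<noteq> 0" using e \<open>j \<noteq> 0\<close> by (cases e) auto
    ultimately have "e = 1" by simp
    then show False using e d(1) by presburger
  qed
  \<comment> \<open>The rotations form a subgroup of order \<open>n\<close>, too small for an atom
    with more than \<open>n\<close> terms.\<close>
  have refl: "\<exists>x\<in>#U. snd x"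
  proof (rule ccontr)
    assume "\<not> ?thesis"
    then have sub: "set_mset U \<subseteq> {0..<int n} \<times> {False}" using Uc by (fastforce simp: dihedral_simps)
    have "subgroup ({0..<int n} \<times> {False}) ?G"
    proof (rule subgroupI)
      fix a assume a: "a \<in> {0..<int n} \<times> {False}"
      then obtain c where c: "a = (c, False)" "0 \<le> c" "c < int n" by auto
      have "((- c) mod int n, False) \<otimes>\<^bsub>?G\<^esub> a = \<one>\<^bsub>?G\<^esub>"
        using c by (simp add: dihedral_simps mod_simps)
      then have "inv\<^bsub>?G\<^esub> a = ((- c) mod int n, False)"
        using c n0 by (intro inv_equality) (auto simp: dihedral_simps)
      then show "inv\<^bsub>?G\<^esub> a \<in> {0..<int n} \<times> {False}" using n0 by simp
    qed (use n0 in \<open>auto simp: dihedral_def\<close>)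
    from seq_atom_size_le_subgroup[OF Uat this _ sub] show False using Usz by simp
  qed
  then obtain x where x: "x \<in># U" "snd x" by blast
  have sq: "y \<otimes>\<^bsub>?G\<^esub> y = \<one>\<^bsub>?G\<^esub>" "y \<noteq> \<one>\<^bsub>?G\<^esub>" "{#y, y#} \<in> seq_atoms ?G" if "y \<in># U" "snd y" for y
  proof -
    show y: "y \<otimes>\<^bsub>?G\<^esub> y = \<one>\<^bsub>?G\<^esub>"
      using dihedral_pow_eq_one(1)[OF n0 Uc[OF that(1)] that(2)] Uc[OF that(1)] by (simp add: numeral_2_eq_2)
    show y1: "y \<noteq> \<one>\<^bsub>?G\<^esub>" using that(2) by (auto simp: dihedral_simps)
    show "{#y, y#} \<in> seq_atoms ?G"
      using seq_atom_pair[OF Uc[OF that(1)] y1] inv_equality[OF y] Uc[OF that(1)] by simp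
  qed
  show False
  proof (cases "\<exists>g\<in>#U. \<not> snd g")
    case True
    then obtain g where g: "g \<in># U" "\<not> snd g" by blast
    have g1: "g \<noteq> \<one>\<^bsub>?G\<^esub>" using U1 g(1) by auto
    have gn: "g [^]\<^bsub>?G\<^esub> n = \<one>\<^bsub>?G\<^esub>" using dihedral_pow_eq_one(2)[OF n0 Uc[OF g(1)] g(2)] .
    have g2: "g \<otimes>\<^bsub>?G\<^esub> g \<noteq> \<one>\<^bsub>?G\<^esub>"
    proof
      assume "g \<otimes>\<^bsub>?G\<^esub> g = \<one>\<^bsub>?G\<^esub>"
      then have "g [^]\<^bsub>?G\<^esub> (2::nat) = \<one>\<^bsub>?G\<^esub>" using Uc[OF g(1)] by (simp add: numeral_2_eq_2)
      then have "ord g dvd 2" "ord g dvd n" using gn pow_eq_id[OF Uc[OF g(1)]] by blast+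
      then have "ord g = 1" using n(2) by (metis dvd_trans prime_nat_iff two_is_prime_nat)
      then show False using ord_eq_1[OF Uc[OF g(1)]] g1 by simp
    qed
    have xg: "x \<noteq> g" using x(2) g(2) by blast
    \<comment> \<open>A product-one subsequence of \<open>B\<close> contains \<open>x\<close> an
      even number of times, so in a splitting one factor consists of copies of \<open>g\<close>. It
      is empty because \<open>g\<close> is nontrivial of odd order.\<close>
    define B where "B = {#x, x, g, g#}"
    have Bat: "B \<in> seq_atoms ?G"
    proof -
      obtain a c where ac: "x = (a, True)" "g = (c, False)" using x(2) g(2) by (metis prod.collapse)
      have "mset [x, g, x, g] \<in> seqs ?G"
      proof (rule seqsI)
        show "lprod [x, g, x, g] = \<one>\<^bsub>?G\<^esub>" unfolding lprod_dihedral by (simp add: ac dihedral_simps)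
      qed (use Uc x(1) g(1) in auto)
      then have Bseq: "B \<in> seqs ?G" by (simp add: B_def add_mset_commute)
      have evx: "even (count T x)" if T: "T \<in> seqs ?G" "T \<subseteq># B" for T
      proof -
        \<comment> \<open>The exponent \<open>a + 1\<close> is a dummy: its reflection does not
          occur, and comparing parities makes the number of copies of \<open>x\<close> even.\<close>
        have sub: "set_mset T \<subseteq> {(a, True), (a + 1, True), (c, False)}"
          using set_mset_mono[OF T(2)] by (auto simp: B_def ac)
        obtain q where q: "even (q - int (count T (a, True)))" "even (q - int (count T (a + 1, True)))"
          by (rule seqs_dihedral_form[OF n0 T(1) _ sub]) auto
        have "count T (a + 1, True) \<le> count B (a + 1, True)" using T(2) by (rule mset_subset_eq_count)
        then have "count T (a + 1, True) = 0" by (simp add: B_def ac)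
        then show ?thesis using q ac by simp
      qed
      have subset_pair: "T = {#} \<or> T = {#g#} \<or> T = {#g, g#}" if "T \<subseteq># {#g, g#}" for T
      proof -
        have "set_mset T \<subseteq> {g}" using set_mset_mono[OF that] by auto
        then have T: "T = replicate_mset (size T) g" by (rule set_mset_subset_singletonD)
        have "size T \<le> 2" using size_mset_mono[OF that] by simp
        then have "size T = 0 \<or> size T = 1 \<or> size T = 2" by linarith
        then show ?thesis
          using T by (elim disjE) (metis replicate_mset_0, metis One_nat_def replicate_mset_Suc replicate_mset_0,
              metis numeral_2_eq_2 replicate_mset_Suc replicate_mset_0)
      qed
      have gonly: "T = {#}" if T: "T \<in> seqs ?G" "T \<subseteq># {#g, g#}" for T
      proof (rule ccontr)
        assume "T \<noteq> {#}"
        then have "T = {#g#} \<or> T = {#g, g#}"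
          using \<open>T \<noteq> {#}\<close> subset_pair T(2) by blast
        then show False
        proof
          assume "T = {#g#}"
          then show False using T(1) g1 Uc[OF g(1)] by (auto simp: seqs_iff)
        next
          assume "T = {#g, g#}"
          then have "g = inv\<^bsub>?G\<^esub> g" using T(1) Uc[OF g(1)] seqs_pair[of g g] by simp
          then show False using g2 r_inv[OF Uc[OF g(1)]] by simp
        qed
      qed
      have "T = {#} \<or> W = {#}" if TW: "T \<in> seqs ?G" "W \<in> seqs ?G" "B = T + W" for T W
      proof -
        have "count T x + count W x = 2" using arg_cong[OF TW(3), of "\<lambda>M. count M x"] xg by (simp add: B_def)
        moreover have "even (count T x)" "even (count W x)" using evx TW by auto
        ultimately have "count T x = 0 \<or> count W x = 0" by presburger
        moreover have "Z \<subseteq># {#g, g#}" if "Z \<subseteq># B" "count Z x = 0" for Z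
        proof (rule mset_subset_eqI)
          fix y show "count Z y \<le> count {#g, g#} y"
            using mset_subset_eq_count[OF that(1), of y] that(2) by (cases "y = x") (auto simp: B_def)
        qed
        ultimately show ?thesis using gonly TW by (metis mset_subset_eq_add_left mset_subset_eq_add_right)
      qed
      then show ?thesis using Bseq by (auto simp: seq_atoms_iff B_def)
    qed
    \<comment> \<open>This is a product of \<open>n\<close> copies of \<open>B\<close>, and also of
      \<open>n\<close> squares of \<open>x\<close> and twice a factorization \<open>Fg\<close> of
      \<open>n\<close> copies of \<open>g\<close>. The lengths differ by \<open>2 * size Fg\<close>,
      which is positive and at most \<open>n\<close>.\<close>
    define Q where "Q = repeat_mset n B"
    have F1: "replicate_mset n B \<in> factorizations ?G Q"
    proof -
      have "\<Sum>\<^sub># (replicate_mset j B) = repeat_mset j B" for j by (induction j) auto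
      then show ?thesis using Bat n0 by (auto simp: factorizations_def Q_def split: if_splits)
    qed
    obtain Fg where Fg: "Fg \<in> factorizations ?G (replicate_mset n g)"
      using factorization_exists seqs_power[OF Uc[OF g(1)] gn] by blast
    have F2: "replicate_mset n {#x, x#} + (Fg + Fg) \<in> factorizations ?G Q"
    proof -
      have "\<Sum>\<^sub># (replicate_mset j {#x, x#}) = replicate_mset (2 * j) x" for j by (induction j) auto
      then have "replicate_mset n {#x, x#} \<in> factorizations ?G (replicate_mset (2 * n) x)"
        using sq(3)[OF x] by (auto simp: factorizations_def split: if_splits)
      from factorizations_add[OF this factorizations_add[OF Fg Fg]]
      have "replicate_mset n {#x, x#} + (Fg + Fg) \<in>
          factorizations ?G (replicate_mset (2 * n) x + (replicate_mset n g + replicate_mset n g))" .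
      moreover have "replicate_mset (2 * n) x + (replicate_mset n g + replicate_mset n g) = Q"
        by (rule multiset_eqI) (auto simp: Q_def B_def)
      ultimately show ?thesis by simp
    qed
    have countQ: "count Q y = (if y = x \<or> y = g then 2 * n else 0)" for y
      using xg by (auto simp: Q_def B_def)
    have cUx: "1 \<le> count U x" "1 \<le> count U g" using x(1) g(1) by (auto simp: Suc_le_eq)
    have QV: "Q \<subseteq># V"
      by (rule mset_subset_eqI) (use cUx in \<open>auto simp: countQ V_count\<close>)
    have "V - Q \<in> seqs ?G"
    proof (rule seqs_powers)
      fix y assume "y \<in># V - Q"
      then have "y \<in># V" by (rule in_diffD)
      then have y: "y \<in># U" using V_count by (metis count_eq_zero_iff mult_0_right)
      have "count (V - Q) y = 2 * n * (count U y - (if y = x \<or> y = g then 1 else 0))"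
        by (simp add: V_count countQ diff_mult_distrib2)
      then show "y \<in> carrier ?G \<and> y [^]\<^bsub>?G\<^esub> count (V - Q) y = \<one>\<^bsub>?G\<^esub>"
        using pow[OF y] Uc[OF y] by simp
    qed
    from Q_len[OF QV this F2 F1] have "int d dvd int (2 * size Fg)" by simp
    moreover have "2 * size Fg \<le> n"
    proof -
      have "count (replicate_mset n g) \<one>\<^bsub>?G\<^esub> = 0" using g1 by simp
      then show ?thesis using weight_factorization_ge[OF Fg] by (simp add: weight_def del: count_replicate_mset)
    qed
    moreover from this have "2 * size Fg < 2 * d" using d(2) n0 by linarith
    ultimately have "size Fg = 0" using small by blast
    then have "replicate_mset n g = {#}" using Fg by (simp add: factorizations_def)
    then show False using n0 by simp
  next
    case False
    then have all: "snd y" if "y \<in># U" for y using that by blast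
    have inv: "y \<otimes>\<^bsub>?G\<^esub> y = \<one>\<^bsub>?G\<^esub>" if "y \<in># U" for y using sq(1) all that by blast
    obtain a where a: "x = (a, True)" using x(2) by (metis prod.collapse)
    have "\<exists>y\<in>#U. y \<noteq> x"
    proof (rule ccontr)
      assume only: "\<not> ?thesis"
      have sub: "set_mset U \<subseteq> {(a, True), (a + 1, True), (0, False)}" using a only by (auto simp: Bex_def)
      obtain q where q: "even (q - int (count U (a, True)))" "\<bar>q\<bar> \<le> int (count U (a + 1, True))"
        by (rule seqs_dihedral_form[OF n0 seq_atoms_seqs[OF Uat] _ sub]) auto
      have "(a + 1, True) \<notin># U" using only a by auto
      then have "q = 0" using q(2) by (simp add: not_in_iff)
      then have "even (count U y)" for y
        using q(1) only a by (cases "y = x") (auto simp: not_in_iff)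
      then show False using involutive_atom_odd_count[OF Uat] inv Usz n by auto
    qed
    then obtain y where y: "y \<in># U" "y \<noteq> x" by blast
    obtain b where b: "y = (b, True)" using all[OF y(1)] by (metis prod.collapse)
    \<comment> \<open>As \<open>n\<close> is odd, some atom \<open>A\<close> below \<open>Q\<close>
      contains \<open>x\<close> an odd number of times. Since \<open>A + A\<close> is a product of
      squares, \<open>size A - 2\<close> is a multiple of \<open>d\<close>; hence \<open>A\<close>
      is a square, contrary to the parity.\<close>
    define Q where "Q = replicate_mset n x + replicate_mset n y"
    have "signed_reflections (- int n) a + signed_reflections (int n) b + signed_reflections 0 a \<in> seqs ?G"
      by (rule signed_reflections_in_seqs[OF n0]) (use Uc[OF x(1)] Uc[OF y(1)] a b in \<open>auto simp: dihedral_simps\<close>)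
    then have "Q \<in> seqs ?G" by (simp add: Q_def signed_reflections_def a b)
    then obtain F where F: "F \<in> factorizations ?G Q" using factorization_exists by blast
    have "count (\<Sum>\<^sub># F) x = n" using F y(2) by (simp add: factorizations_def Q_def)
    then have "odd (count (\<Sum>\<^sub># F) x)" using n(2) by simp
    then have "\<exists>A\<in>#F. odd (count A x)" by (induction F) auto
    then obtain A where A: "A \<in># F" "odd (count A x)" by blast
    have Aat: "A \<in> seq_atoms ?G" and AQ: "A \<subseteq># Q"
      using in_factorization_seqs[OF F A(1)] in_factorization_le[OF F A(1)] by auto
    have Aset: "set_mset A \<subseteq> {x, y}" using set_mset_mono[OF AQ] by (auto simp: Q_def split: if_splits)
    have AU: "z \<in># U" if "z \<in># A" for z using Aset x(1) y(1) that by auto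
    have F1: "{#A, A#} \<in> factorizations ?G (A + A)" using Aat by (simp add: factorizations_def)
    have F2: "image_mset (\<lambda>z. {#z, z#}) A \<in> factorizations ?G (A + A)"
      using sum_pairs[of "\<lambda>z. z" A] sq(3) AU all by (auto simp: factorizations_def)
    have cA: "count A z \<le> n * count U z" for z
    proof -
      have "count A z \<le> count Q z" using AQ by (rule mset_subset_eq_count)
      also have "\<dots> \<le> n * count U z"
        using x(1) y by (auto simp: Q_def Suc_le_eq)
      finally show ?thesis .
    qed
    have AV: "A + A \<subseteq># V"
      by (rule mset_subset_eqI) (use cA in \<open>simp add: V_count mult_2 flip: mult_2\<close>)
    have "V - (A + A) \<in> seqs ?G"
    proof (rule even_counts_in_seqs)
      have VU: "z \<in># U" if "z \<in># V - (A + A)" for z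
        using in_diffD[OF that] V_count by (metis count_eq_zero_iff mult_0_right)
      then show "set_mset (V - (A + A)) \<subseteq> carrier ?G" using Uc by blast
      show "z \<otimes>\<^bsub>?G\<^esub> z = \<one>\<^bsub>?G\<^esub>" if "z \<in># V - (A + A)" for z using VU[OF that] inv by blast
      show "even (count (V - (A + A)) z)" for z
      proof -
        have "count (V - (A + A)) z = 2 * (n * count U z - count A z)" by (simp add: V_count)
        then show ?thesis by simp
      qed
    qed
    from Q_len[OF AV this F2 F1] have dv: "int d dvd int (size A) - 2" by simp
    have "even (size A)"
    proof -
      have "filter_mset snd A = A" using all AU by (auto simp: filter_mset_eq_conv)
      then show ?thesis using seqs_dihedral_iff[OF n0] seq_atoms_seqs[OF Aat] by metis
    qed
    then obtain j where j: "size A = 2 * j" by (elim evenE)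
    have "size A \<noteq> 0" using Aat by (simp add: seq_atoms_iff)
    then have j1: "j \<ge> 1" using j by simp
    have "size A \<le> size Q" using AQ by (rule size_mset_mono)
    then have "2 * j \<le> 2 * n" using j by (simp add: Q_def)
    then have "2 * (j - 1) < 2 * d" using d(2) n0 by simp
    moreover have "int d dvd int (2 * (j - 1))" using dv j j1 by (simp add: of_nat_diff algebra_simps)
    ultimately have "j - 1 = 0" using small by blast
    then have "size A = 2" using j j1 by simp
    moreover have "x \<in># A" using A(2) by (metis count_eq_zero_iff even_zero)
    ultimately have "A = {#x, inv\<^bsub>?G\<^esub> x#}" using size_two_atom[OF Aat] by blast
    moreover have "inv\<^bsub>?G\<^esub> x = x" using inv_equality[OF inv[OF x(1)]] Uc[OF x(1)] by blast
    ultimately show False using A(2) by simp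
  qed
qed

section \<open>Nilpotent groups and involutions\<close>

context group
begin

abbreviation commutator :: "'a \<Rightarrow> 'a \<Rightarrow> 'a"
  where "commutator x y \<equiv> x \<otimes> y \<otimes> inv x \<otimes> inv y"

lemma cancel_left [simp]:
  assumes "x \<in> carrier G" "y \<in> carrier G"
  shows "inv x \<otimes> (x \<otimes> y) = y" "x \<otimes> (inv x \<otimes> y) = y"
  using assms by (simp_all add: m_assoc[symmetric])

lemma inv_commutator:
  "x \<in> carrier G \<Longrightarrow> y \<in> carrier G \<Longrightarrow> inv (commutator x y) = commutator y x"
  by (simp add: inv_mult_group m_assoc)

text \<open>If \<open>a\<close> lies in a term of the central series and its square in the next one,
  both factors on the right lie one step deeper than \<open>commutator a b\<close> is known to
  lie.\<close>

lemma commutator_square_left: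
  assumes "a \<in> carrier G" "b \<in> carrier G"
  shows "commutator a b \<otimes> commutator a b =
    commutator (commutator a b) a \<otimes> commutator (a \<otimes> a) b"
  using assms by (simp add: inv_mult_group m_assoc)

lemma commutator_mult_right:
  assumes "x \<in> carrier G" "y \<in> carrier G" "z \<in> carrier G"
  shows "commutator x (y \<otimes> z) = commutator x y \<otimes> (y \<otimes> commutator x z \<otimes> inv y)"
  using assms by (simp add: inv_mult_group m_assoc)

definition commutators :: "'a set \<Rightarrow> 'a set \<Rightarrow> 'a set"
  where "commutators A K = {commutator x y |x y. x \<in> A \<and> y \<in> K}"

lemma commutators_mono: "A \<subseteq> B \<Longrightarrow> K \<subseteq> L \<Longrightarrow> commutators A K \<subseteq> commutators B L"
  by (auto simp: commutators_def)

lemma commutators_carrier: "A \<subseteq> carrier G \<Longrightarrow> K \<subseteq> carrier G \<Longrightarrow> commutators A K \<subseteq> carrier G"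
  by (auto simp: commutators_def subset_iff)

text \<open>This is the lower central series of \<open>K\<close>, formed inside \<open>G\<close> so
  that no group structure on \<open>K\<close> has to be introduced.\<close>

primrec relative_central :: "'a set \<Rightarrow> nat \<Rightarrow> 'a set"
  where
    "relative_central K 0 = K"
  | "relative_central K (Suc i) = generate G (commutators (relative_central K i) K)"

lemma relative_central_carrier: "relative_central (carrier G) i = lower_central G i"
  by (induction i) (auto simp: commutators_def)

lemma relative_central_mono:
  assumes "K \<subseteq> L"
  shows "relative_central K i \<subseteq> relative_central L i"
proof (induction i)
  case (Suc i)
  have "commutators (relative_central K i) K \<subseteq> commutators (relative_central L i) L"
    using Suc assms by (rule commutators_mono)
  then show ?case by (simp add: mono_generate)
qed (use assms in simp)

lemma relative_central_subgroup:
  assumes "subgroup K G"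
  shows "subgroup (relative_central K i) G"
proof (induction i)
  case (Suc i)
  have "commutators (relative_central K i) K \<subseteq> carrier G"
    using Suc assms by (intro commutators_carrier subgroup.subset)
  then show ?case using generate_is_subgroup by simp
qed (use assms in simp)

lemma relative_central_decreasing:
  assumes "subgroup K G"
  shows "relative_central K (Suc i) \<subseteq> relative_central K i"
proof (induction i)
  case 0
  have "commutators K K \<subseteq> K"
    using assms by (auto simp: commutators_def intro!: subgroup.m_closed subgroup.m_inv_closed)
  then show ?case using generate_subgroup_incl[OF _ assms] by simp
next
  case (Suc i)
  then have "generate G (commutators (relative_central K (Suc i)) K) \<subseteq> generate G (commutators (relative_central K i) K)"
    by (intro mono_generate commutators_mono) auto
  then show ?case by simp
qed

lemma relative_central_subset:
  assumes "subgroup K G"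
  shows "relative_central K i \<subseteq> K"
  using relative_central_decreasing[OF assms] by (induction i) auto

lemma commutator_in_relative_central:
  "a \<in> relative_central K i \<Longrightarrow> b \<in> K \<Longrightarrow> commutator a b \<in> relative_central K (Suc i)"
  by (auto simp: commutators_def intro!: generate.incl)

text \<open>The square of \<open>u v\<close> is the product of the square of \<open>u\<close>, the
  commutator of the inverse of \<open>u\<close> with \<open>v\<close>, and the square of
  \<open>v\<close>; so squares stay in \<open>N\<close> under multiplication.\<close>

lemma square_in_generate:
  assumes Y: "Y \<subseteq> carrier G" and N: "subgroup N G" and sq: "\<And>y. y \<in> Y \<Longrightarrow> y \<otimes> y \<in> N"
    and comm: "\<And>u v. u \<in> generate G Y \<Longrightarrow> v \<in> generate G Y \<Longrightarrow> commutator u v \<in> N"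
    and w: "w \<in> generate G Y"
  shows "w \<otimes> w \<in> N"
  using w
proof (induction rule: generate.induct)
  case one
  show ?case using subgroup.one_closed[OF N] by simp
next
  case (incl y)
  then show ?case by (rule sq)
next
  case (inv y)
  then have "inv y \<otimes> inv y = inv (y \<otimes> y)" using Y by (auto simp: inv_mult_group)
  then show ?case using subgroup.m_inv_closed[OF N sq[OF inv]] by simp
next
  case (eng u v)
  have c: "u \<in> carrier G" "v \<in> carrier G" using eng.hyps generate_in_carrier[OF Y] by auto
  have "u \<otimes> v \<otimes> (u \<otimes> v) = (u \<otimes> u) \<otimes> commutator (inv u) v \<otimes> (v \<otimes> v)"
    using c by (simp add: m_assoc)
  moreover have "commutator (inv u) v \<in> N"
    using comm generate_m_inv_closed[OF Y eng.hyps(1)] eng.hyps(2) by blast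
  ultimately show ?case using eng.IH subgroup.m_closed[OF N] by simp
qed

text \<open>
  The successive quotients of the lower central series of a group generated by involutions have
  exponent two.
\<close>

lemma square_in_relative_central:
  assumes X: "X \<subseteq> carrier G" "\<And>x. x \<in> X \<Longrightarrow> x \<otimes> x = \<one>"
    and w: "w \<in> relative_central (generate G X) i"
  shows "w \<otimes> w \<in> relative_central (generate G X) (Suc i)"
  using w
proof (induction i arbitrary: w)
  let ?K = "generate G X"
  let ?C = "relative_central ?K"
  have K: "subgroup ?K G" using X(1) by (rule generate_is_subgroup)
  case 0
  have "w \<in> ?K" using 0 by simp
  show ?case
  proof (rule square_in_generate[OF X(1) relative_central_subgroup[OF K] _ _ \<open>w \<in> ?K\<close>])
    show "y \<otimes> y \<in> ?C (Suc 0)" if "y \<in> X" for y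
      unfolding X(2)[OF that] by (rule subgroup.one_closed[OF relative_central_subgroup[OF K]])
    show "commutator u v \<in> ?C (Suc 0)" if "u \<in> ?K" "v \<in> ?K" for u v
      by (rule commutator_in_relative_central) (use that in simp_all)
  qed
next
  let ?K = "generate G X"
  let ?C = "relative_central ?K"
  have K: "subgroup ?K G" using X(1) by (rule generate_is_subgroup)
  have Cc: "?C j \<subseteq> carrier G" for j using subgroup.subset[OF relative_central_subgroup[OF K]] .
  have CK: "?C j \<subseteq> ?K" for j using relative_central_subset[OF K] .
  case (Suc i)
  have Y: "commutators (?C i) ?K \<subseteq> carrier G"
    using Cc subgroup.subset[OF K] by (rule commutators_carrier)
  have w: "w \<in> generate G (commutators (?C i) ?K)" using Suc.prems by simp
  show ?case
  proof (rule square_in_generate[OF Y relative_central_subgroup[OF K] _ _ w])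
    fix y assume "y \<in> commutators (?C i) ?K"
    then obtain a b where ab: "a \<in> ?C i" "b \<in> ?K" "y = commutator a b"
      by (auto simp: commutators_def)
    have c: "a \<in> carrier G" "b \<in> carrier G" using ab Cc subgroup.subset[OF K] by auto
    have "commutator y a \<in> ?C (Suc (Suc i))"
      unfolding ab(3) by (intro commutator_in_relative_central ab(1,2)) (use ab(1) CK in auto)
    moreover have "commutator (a \<otimes> a) b \<in> ?C (Suc (Suc i))"
      using Suc.IH[OF ab(1)] ab(2) by (rule commutator_in_relative_central)
    ultimately have "commutator y a \<otimes> commutator (a \<otimes> a) b \<in> ?C (Suc (Suc i))"
      by (rule subgroup.m_closed[OF relative_central_subgroup[OF K]])
    then show "y \<otimes> y \<in> ?C (Suc (Suc i))"
      unfolding ab(3) commutator_square_left[OF c] .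
  next
    fix u v assume "u \<in> generate G (commutators (?C i) ?K)" "v \<in> generate G (commutators (?C i) ?K)"
    then have u: "u \<in> ?C (Suc i)" and "v \<in> ?C (Suc i)" by simp_all
    then have "v \<in> ?K" using CK by blast
    with u show "commutator u v \<in> ?C (Suc (Suc i))"
      by (rule commutator_in_relative_central)
  qed
qed

text \<open>Each squaring moves an element one step down the central series of the generated
  subgroup, which is contained in that of \<open>G\<close>.\<close>

lemma involutions_generate_two_group:
  assumes nil: "lower_central G c = {\<one>}"
    and X: "X \<subseteq> carrier G" "\<And>x. x \<in> X \<Longrightarrow> x \<otimes> x = \<one>" and w: "w \<in> generate G X"
  shows "w [^] (2 ^ c :: nat) = \<one>"
proof -
  have wc: "w \<in> carrier G" using generate_in_carrier[OF X(1) w] .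
  have "w [^] (2 ^ i :: nat) \<in> relative_central (generate G X) i" for i
  proof (induction i)
    case (Suc i)
    have "w [^] (2 ^ Suc i :: nat) = w [^] (2 ^ i :: nat) \<otimes> w [^] (2 ^ i :: nat)"
      using wc by (simp add: nat_pow_mult mult_2)
    then show ?case using square_in_relative_central[OF X Suc] by simp
  qed (use w wc in simp)
  then have "w [^] (2 ^ c :: nat) \<in> lower_central G c"
    using relative_central_mono[of "generate G X" "carrier G" c] generate_incl[OF X(1)]
    by (auto simp: relative_central_carrier)
  then show ?thesis using nil by simp
qed

text \<open>The commutator \<open>c\<close> of \<open>x\<close> and \<open>y\<close> descends
  through the whole series. If it lies in one term, it is central modulo the next; there its square
  vanishes because \<open>x\<close> is an involution, and its power with odd exponent
  \<open>r\<close> vanishes because that of \<open>y\<close> does.\<close>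

lemma involution_commutes_odd_order:
  assumes nil: "lower_central G l = {\<one>}"
    and x: "x \<in> carrier G" "x \<otimes> x = \<one>" and y: "y \<in> carrier G" "y [^] (r::nat) = \<one>" "odd r"
  shows "x \<otimes> y = y \<otimes> x"
proof -
  let ?C = "relative_central (carrier G)"
  have sub: "subgroup (?C i) G" for i by (rule relative_central_subgroup[OF subgroup_self])
  have Cc: "?C i \<subseteq> carrier G" for i using subgroup.subset[OF sub] .
  have normal: "g \<otimes> w \<otimes> inv g \<in> ?C i" if "w \<in> ?C i" "g \<in> carrier G" for g w i
  proof -
    have wc: "w \<in> carrier G" using that Cc by blast
    have "commutator w g \<in> ?C i"
      using commutator_in_relative_central[OF that] relative_central_decreasing[OF subgroup_self] by blast
    then have "inv (commutator w g) \<otimes> w \<in> ?C i"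
      using that(1) subgroup.m_closed[OF sub] subgroup.m_inv_closed[OF sub] by blast
    moreover have "inv (commutator w g) \<otimes> w = g \<otimes> w \<otimes> inv g"
      using wc that(2) by (simp add: inv_mult_group m_assoc)
    ultimately show ?thesis by simp
  qed
  define c where "c = commutator x y"
  have cc: "c \<in> carrier G" using x y by (simp add: c_def)
  have "c \<in> ?C i" for i
  proof (induction i)
    case 0
    show ?case using cc by simp
  next
    case (Suc i)
    let ?N = "?C (Suc i)"
    have cx: "commutator c z \<in> ?N" if "z \<in> carrier G" for z
      using Suc that by (rule commutator_in_relative_central)
    have "c \<otimes> c = commutator c x"
      using commutator_square_left[OF x(1) y(1)] x y by (simp add: c_def)
    then have c2: "c \<otimes> c \<in> ?N" using cx[OF x(1)] by simp
    \<comment> \<open>Modulo the next term, commuting with \<open>x\<close> turns powers of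
      \<open>y\<close> into powers of \<open>c\<close>.\<close>
    have e: "commutator x (y [^] k) \<otimes> inv (c [^] k) \<in> ?N" for k :: nat
    proof (induction k)
      case 0
      have "commutator x (y [^] (0::nat)) \<otimes> inv (c [^] (0::nat)) = \<one>" using x by simp
      then show ?case using subgroup.one_closed[OF sub] by (simp only:)
    next
      case (Suc k)
      define u where "u = y [^] k"
      define v where "v = c [^] k"
      have uv: "u \<in> carrier G" "v \<in> carrier G" using y cc by (simp_all add: u_def v_def)
      have IH: "commutator x u \<otimes> inv v \<in> ?N" using Suc by (simp add: u_def v_def)
      have "commutator x (u \<otimes> y) \<otimes> inv (v \<otimes> c) =
          (commutator x u \<otimes> (u \<otimes> c \<otimes> inv u)) \<otimes> inv (v \<otimes> c)"
        using commutator_mult_right[OF x(1) uv(1) y(1)] by (simp add: c_def)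
      also have "\<dots> = (commutator x u \<otimes> inv v) \<otimes> (v \<otimes> commutator u c \<otimes> inv v)"
        using x y uv cc by (simp add: inv_mult_group m_assoc)
      also have "\<dots> \<in> ?N"
      proof (rule subgroup.m_closed[OF sub IH normal[OF _ uv(2)]])
        show "commutator u c \<in> ?N"
          using subgroup.m_inv_closed[OF sub cx[OF uv(1)]] inv_commutator[OF cc uv(1)] by simp
      qed
      finally show ?case by (simp add: u_def v_def)
    qed
    have "inv (c [^] r) \<in> ?N" using e[of r] x y cc by simp
    then have cr: "c [^] r \<in> ?N" using subgroup.m_inv_closed[OF sub] cc by fastforce
    obtain s where s: "r = 2 * s + 1" using y(3) by (elim oddE)
    have "(c \<otimes> c) [^] s \<in> ?N"
    proof (induction s)
      case 0
      show ?case unfolding nat_pow_0 by (rule subgroup.one_closed[OF sub])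
    next
      case (Suc s)
      show ?case unfolding nat_pow_Suc by (rule subgroup.m_closed[OF sub Suc c2])
    qed
    then have "inv ((c \<otimes> c) [^] s) \<otimes> c [^] r \<in> ?N"
      by (intro subgroup.m_closed[OF sub] subgroup.m_inv_closed[OF sub] cr)
    moreover have "c [^] r = (c \<otimes> c) [^] s \<otimes> c"
    proof -
      have "(c [^] (2::nat)) [^] s = c [^] (2 * s)" using cc by (rule nat_pow_pow)
      moreover have "c [^] (2::nat) = c \<otimes> c" using cc by (simp add: numeral_2_eq_2)
      ultimately show ?thesis by (simp add: s)
    qed
    ultimately show ?case using cc by simp
  qed
  then have "c \<in> lower_central G l" by (metis relative_central_carrier)
  then have "commutator x y = \<one>" using nil by (simp add: c_def)
  then have "x \<otimes> y \<otimes> (inv x \<otimes> inv y) = \<one>" using x y by (simp add: m_assoc)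
  then have "x \<otimes> y = inv (inv x \<otimes> inv y)" using x y by (metis inv_closed inv_equality m_closed)
  then show ?thesis using x y by (simp add: inv_mult_group)
qed

lemma lprod_in_generate: "set xs \<subseteq> X \<Longrightarrow> lprod xs \<in> generate G X"
  by (induction xs) (auto intro: generate.one generate.eng generate.incl)

text \<open>Undoing the merge inside the factor that contains the product of \<open>g\<close> and
  \<open>h\<close> turns a splitting of the merged sequence into one of the original atom.\<close>

lemma merge_atom:
  assumes "mset (g # h # us) \<in> seq_atoms G" "lprod (g # h # us) = \<one>"
  shows "mset ((g \<otimes> h) # us) \<in> seq_atoms G"
proof -
  let ?W = "mset ((g \<otimes> h) # us)"
  have c: "set (g # h # us) \<subseteq> carrier G" using seq_atoms_carrier[OF assms(1)] by auto
  have W: "?W \<in> seqs G"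
    by (rule seqsI) (use c assms(2) in \<open>auto simp: m_assoc\<close>)
  have key: "Q = {#}" if PQ: "P \<in> seqs G" "Q \<in> seqs G" "?W = P + Q" and P: "g \<otimes> h \<in># P" for P Q
  proof -
    obtain ps where ps: "mset (g \<otimes> h # ps) = P" "set (g \<otimes> h # ps) \<subseteq> carrier G" "lprod (g \<otimes> h # ps) = \<one>"
      using PQ(1) P by (rule seqs_ConsE)
    have "mset (g # h # ps) \<in> seqs G"
      by (rule seqsI) (use c ps in \<open>auto simp: m_assoc\<close>)
    moreover have "mset us = mset ps + Q" using PQ(3) ps(1) by auto
    then have "mset (g # h # us) = mset (g # h # ps) + Q" by simp
    moreover have "mset (g # h # ps) \<noteq> {#}" by simp
    ultimately show ?thesis using assms(1) PQ(2) unfolding seq_atoms_iff by blast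
  qed
  have "P = {#} \<or> Q = {#}" if PQ: "P \<in> seqs G" "Q \<in> seqs G" "?W = P + Q" for P Q
  proof -
    have "g \<otimes> h \<in># P + Q" unfolding PQ(3)[symmetric] by simp
    then show ?thesis using key[OF PQ] key[of Q P] PQ by (auto simp: add.commute)
  qed
  then show ?thesis using W by (auto simp: seq_atoms_iff)
qed

end

section \<open>Abelian groups\<close>

context comm_group
begin

lemma lprod_mset_cong:
  assumes "mset xs = mset ys" "set xs \<subseteq> carrier G"
  shows "lprod xs = lprod ys"
  using assms
proof (induction xs arbitrary: ys)
  case (Cons x xs)
  then obtain us vs where ys: "ys = us @ x # vs"
    by (metis list.set_intros(1) set_mset_mset split_list)
  have eq: "mset xs = mset (us @ vs)" using Cons.prems(1) ys by simp
  have "set ys \<subseteq> carrier G" using Cons.prems by (metis set_mset_mset)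
  then have c: "set us \<subseteq> carrier G" "set (x # vs) \<subseteq> carrier G" "set vs \<subseteq> carrier G" "x \<in> carrier G"
    using ys by auto
  have l: "lprod us \<in> carrier G" "lprod vs \<in> carrier G" using c by simp_all
  have "lprod ys = lprod us \<otimes> (x \<otimes> lprod vs)"
    using foldr_mult_append[OF c(1,2)] ys by simp
  also have "\<dots> = x \<otimes> (lprod us \<otimes> lprod vs)"
    using c(4) l by (simp add: m_lcomm)
  also have "\<dots> = x \<otimes> lprod (us @ vs)"
    using foldr_mult_append[OF c(1,3)] by simp
  also have "lprod (us @ vs) = lprod xs"
    using Cons.IH[OF eq] Cons.prems(2) by simp
  finally show ?case by simp
qed simp

lemma seqs_lprod:
  assumes "mset xs \<in> seqs G"
  shows "lprod xs = \<one>"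
proof -
  obtain ys where ys: "mset ys = mset xs" "set ys \<subseteq> carrier G" "lprod ys = \<one>"
    using assms by (rule seqsE)
  show ?thesis using lprod_mset_cong[OF ys(1,2)] ys(3) by simp
qed

lemma seqs_diff:
  assumes "S \<in> seqs G" "T \<in> seqs G" "S \<subseteq># T"
  shows "T - S \<in> seqs G"
proof -
  obtain xs where xs: "mset xs = S" "set xs \<subseteq> carrier G" "lprod xs = \<one>" using assms(1) by (rule seqsE)
  obtain ys where ys: "mset ys = T - S" using ex_mset by blast
  have T: "mset (xs @ ys) = T" using xs(1) ys assms(3) by simp
  have c: "set ys \<subseteq> carrier G"
    using seqs_carrier[OF assms(2)] ys by (metis in_diffD set_mset_mset subsetI)
  have "lprod (xs @ ys) = \<one>" by (rule seqs_lprod) (simp only: T assms(2))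
  then have "lprod ys = \<one>" using foldr_mult_append[OF xs(2) c] xs(3) c by simp
  then show ?thesis using seqsI[OF c] ys by simp
qed

text \<open>Merging two terms of \<open>U\<close> gives an atom \<open>W\<close> with one term less.
  An atom over its support either repeats a term, and is then a square, or is contained in
  \<open>W\<close>, and is then \<open>W\<close>.\<close>

lemma elementary_progression:
  assumes sq: "\<And>x. x \<in> carrier G \<Longrightarrow> x \<otimes> x = \<one>" and U: "U \<in> seq_atoms G" "size U \<ge> 4"
  shows "progression k (size U - 3) \<in> group_length_system G"
proof -
  obtain xs where xs: "mset xs = U" "lprod xs = \<one>" using seq_atoms_seqs[OF U(1)] seqsE by metis
  have "length xs \<ge> 4" using xs(1) U(2) by auto
  then obtain g ys where ys: "xs = g # ys" by (cases xs) auto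
  with \<open>length xs \<ge> 4\<close> obtain h us where "ys = h # us" by (cases ys) auto
  with ys have gh: "xs = g # h # us" by simp
  define W where "W = mset ((g \<otimes> h) # us)"
  have W: "W \<in> seq_atoms G" unfolding W_def by (rule merge_atom) (use xs gh U in auto)
  have szW: "size W = size U - 1" using xs(1) gh by (auto simp: W_def)
  have Wc: "x \<in> carrier G" if "x \<in># W" for x using seq_atoms_carrier[OF W that] .
  have "progression k (size W - 2) \<in> group_length_system G"
  proof (rule progression_in_length_system[OF W])
    show "x \<otimes> x = \<one>" if "x \<in># W" for x using sq Wc that by blast
    fix A assume A: "A \<in> seq_atoms G" "set_mset A \<subseteq> set_mset W"
    show "A = W \<or> (\<exists>x. A = {#x, x#})"
    proof (cases "\<exists>x. 2 \<le> count A x")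
      case True
      then obtain x where x: "2 \<le> count A x" by blast
      have sub: "{#x, x#} \<subseteq># A" using x by (auto intro!: mset_subset_eqI)
      have "x \<in># A" using x by (metis count_eq_zero_iff not_numeral_le_zero)
      then have xc: "x \<in> carrier G" using seq_atoms_carrier[OF A(1)] by blast
      have "{#x, x#} \<in> seqs G" using seqs_pair[OF xc xc] inv_equality[OF sq[OF xc] xc xc] by simp
      then have "{#x, x#} = A"
        using seq_atom_subset[OF A(1) _ seqs_diff[OF _ seq_atoms_seqs[OF A(1)] sub] sub] by simp
      then show ?thesis by blast
    next
      case False
      have sub: "A \<subseteq># W"
      proof (rule mset_subset_eqI)
        fix x show "count A x \<le> count W x"
        proof (cases "x \<in># A")
          case True
          then have "x \<in># W" using A(2) by blast
          then have "1 \<le> count W x" by (simp add: Suc_le_eq)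
          moreover have "count A x < 2" using False by (meson not_le)
          ultimately show ?thesis by linarith
        qed (simp add: not_in_iff)
      qed
      have "A = W"
        using seq_atom_subset[OF W seq_atoms_seqs[OF A(1)] seqs_diff[OF seq_atoms_seqs[OF A(1)] seq_atoms_seqs[OF W] sub] sub]
          A(1) by (simp add: seq_atoms_iff)
      then show ?thesis ..
    qed
  qed (use szW U(2) in simp)
  moreover have "size W - 2 = size U - 3" using szW U(2) by simp
  ultimately show ?thesis by (simp only:)
qed

text \<open>
  The partial products of an ordering of \<open>U\<close> exhaust the group, and exchanging the first two terms
  changes only one of them.
\<close>

lemma atom_of_maximal_size:
  assumes fin: "finite (carrier G)" and U: "U \<in> seq_atoms G" "size U = card (carrier G)"
    and g: "g \<in># U"
  shows "U = replicate_mset (size U) g"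
proof -
  have "h = g" if h: "h \<in># U" for h
  proof (rule ccontr)
    assume hg: "h \<noteq> g"
    obtain V where V: "U = add_mset g V" using g by (metis mset_add)
    then have "h \<in># V" using h hg by simp
    then obtain V' where V': "V = add_mset h V'" by (metis mset_add)
    obtain us where us: "mset us = V'" using ex_mset by blast
    define xs where "xs = g # h # us"
    define ys where "ys = h # g # us"
    have mx: "mset xs = U" and my: "mset ys = U" using V V' us by (simp_all add: xs_def ys_def)
    have cx: "set xs \<subseteq> carrier G" using seq_atoms_carrier[OF U(1)] mx by (metis set_mset_mset subsetI)
    have px: "lprod xs = \<one>" and py: "lprod ys = \<one>"
      by (rule seqs_lprod, simp only: mx my seq_atoms_seqs[OF U(1)])+
    let ?f = "\<lambda>i. lprod (take i xs)" and ?h = "\<lambda>i. lprod (take i ys)"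
    have injx: "inj_on ?f {..<length xs}" and injy: "inj_on ?h {..<length ys}"
      using seq_atom_partial_products_inj[of xs] seq_atom_partial_products_inj[of ys] px py mx my U(1) by auto
    have len: "length xs = card (carrier G)" using mx U(2) by (metis size_mset)
    have "?f ` {..<length xs} = carrier G"
    proof (rule card_subset_eq[OF fin])
      show "?f ` {..<length xs} \<subseteq> carrier G"
        using cx by (auto intro!: lprod_closed dest!: in_set_takeD)
      show "card (?f ` {..<length xs}) = card (carrier G)" using card_image[OF injx] len by simp
    qed
    moreover have hc: "h \<in> carrier G" "g \<in> carrier G" using cx by (auto simp: xs_def)
    ultimately obtain i where i: "i < length xs" "h = ?f i" by blast
    \<comment> \<open>The element \<open>h\<close> is the partial product of length 1 of
      \<open>ys\<close>, and one of length \<open>i\<close> of \<open>xs\<close>. For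
      \<open>i\<close> other than 1 the two orderings have the same partial product, so it would
      occur twice along \<open>ys\<close>.\<close>
    have h1: "h = ?h 1" using hc by (simp add: ys_def)
    have "i \<noteq> 1" using i(2) hc hg by (auto simp: xs_def)
    moreover have "?f i = ?h i" if i1: "i \<noteq> 1"
    proof (cases "i = 0")
      case False
      then obtain j where j: "i = Suc (Suc j)" using i1 by (metis One_nat_def not0_implies_Suc)
      have "lprod (take j us) \<in> carrier G"
        using cx by (intro lprod_closed) (auto simp: xs_def dest!: in_set_takeD)
      then show ?thesis using hc by (simp add: j xs_def ys_def m_lcomm)
    qed simp
    ultimately have "?h i = ?h 1" using h1 i(2) by simp
    moreover have "i \<in> {..<length ys}" "1 \<in> {..<length ys}" using i(1) by (auto simp: xs_def ys_def)
    ultimately have "i = 1" using injy by (meson inj_onD)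
    with \<open>i \<noteq> 1\<close> show False ..
  qed
  then have "set_mset U \<subseteq> {g}" by blast
  then show ?thesis by (rule set_mset_subset_singletonD)
qed

text \<open>Lengths 3 and \<open>3 n\<close> force three atoms of maximal size, each a power of a
  single element that is not its own inverse. The other factorization consists of pairs of inverse
  elements, so the three bases would be permuted by inversion without fixed points, although their
  number is odd.\<close>

lemma not_three_maximal_atoms:
  assumes fin: "finite (carrier G)" and card: "card (carrier G) = 2 * n" and n: "n \<ge> 3"
    and L: "L \<in> group_length_system G" "3 \<in> L" "3 * n \<in> L"
  shows False
proof -
  obtain S where S: "L = size ` factorizations G S" using L(1) unfolding group_length_system_eq by blast
  obtain M where M: "M \<in> factorizations G S" "size M = 3" using L(2) unfolding S by auto
  obtain N where N: "N \<in> factorizations G S" "size N = 3 * n" using L(3) unfolding S by auto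
  have wM: "weight A \<le> 2 * n" if "A \<in># M" for A
  proof -
    have "size A \<le> 2 * n" using seq_atom_size_le[OF fin in_factorization_seqs[OF M(1) that]] card by simp
    then show ?thesis using weight_atom[OF in_factorization_seqs[OF M(1) that]] n by auto
  qed
  have sumM: "(\<Sum>A\<in>#M. weight A) = weight S" and sumN: "(\<Sum>A\<in>#N. weight A) = weight S"
    using M(1) N(1) weight_sum[of M] weight_sum[of N] by (auto simp: factorizations_def)
  have "weight S \<le> 2 * n * 3" using sum_mset_le_const[of M weight "2 * n"] wM sumM M(2) by simp
  moreover have "2 * (3 * n) \<le> weight S" using weight_factorization_ge[OF N(1)] N(2) by simp
  ultimately have wS: "weight S = 6 * n" by simp
  have wM': "weight A = 2 * n" if "A \<in># M" for A
    by (rule sum_mset_eq_const_le[of M weight "2 * n" A]) (use wM sumM wS M(2) that in auto)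
  have wN: "weight A = 2" if "A \<in># N" for A
  proof (rule sum_mset_eq_const_ge[of N 2 weight A])
    show "2 \<le> weight B" if "B \<in># N" for B
      using weight_atom_ge in_factorization_seqs[OF N(1) that] by blast
  qed (use sumN wS N(2) that in auto)
  have rep: "\<exists>g. A = replicate_mset (2 * n) g \<and> g \<in> carrier G \<and> g \<noteq> \<one> \<and> inv g \<noteq> g" if A: "A \<in># M" for A
  proof -
    have at: "A \<in> seq_atoms G" using in_factorization_seqs[OF M(1) A] .
    have sz: "size A = 2 * n" and one: "\<one> \<notin># A" using weight_atom[OF at] wM'[OF A] n by auto
    have "A \<noteq> {#}" using at by (simp add: seq_atoms_iff)
    then obtain g where g: "g \<in># A" by blast
    have eq: "A = replicate_mset (2 * n) g"
      using atom_of_maximal_size[OF fin at _ g] sz card by simp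
    have gc: "g \<in> carrier G" using seq_atoms_carrier[OF at g] .
    \<comment> \<open>An atom made of \<open>2 n\<close> copies of an involution would have only
      even multiplicities.\<close>
    have "inv g \<noteq> g"
    proof
      assume "inv g = g"
      then have "x \<otimes> x = \<one>" if "x \<in># A" for x
        using that gc r_inv[OF gc] by (auto simp: eq split: if_splits)
      then obtain x where "odd (count A x)"
        using involutive_atom_odd_count[OF at] sz n by auto
      then show False by (simp add: eq split: if_splits)
    qed
    then show ?thesis using eq gc g one by blast
  qed
  obtain Ms where Ms: "mset Ms = M" using ex_mset by blast
  then have "length Ms = 3" using M(2) by auto
  then obtain A B C where "Ms = [A, B, C]" by (auto simp: numeral_3_eq_3 length_Suc_conv)
  then have ABC: "M = {#A, B, C#}" using Ms by simp
  obtain a b c where abc: "A = replicate_mset (2 * n) a" "B = replicate_mset (2 * n) b" "C = replicate_mset (2 * n) c"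
    "a \<in> carrier G" "b \<in> carrier G" "c \<in> carrier G" "inv a \<noteq> a" "inv b \<noteq> b" "inv c \<noteq> c" "a \<noteq> \<one>" "b \<noteq> \<one>" "c \<noteq> \<one>"
    using rep[of A] rep[of B] rep[of C] ABC by auto
  have S_eq: "S = A + B + C" using M(1) ABC by (simp add: factorizations_def add.assoc)
  have sym: "count S h = count S (inv h)" if h: "h \<in> carrier G" for h
  proof -
    have "count V h = count V (inv h)" if V: "V \<in># N" for V
    proof -
      have at: "V \<in> seq_atoms G" using in_factorization_seqs[OF N(1) V] .
      from weight_atom[OF at] wN[OF V] consider "V = {#\<one>#}" | "size V = 2" by auto
      then show ?thesis
      proof cases
        case 1
        then show ?thesis using inv_eq_1_iff[OF h] by (cases "h = \<one>") auto
      next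
        case 2
        have "V \<noteq> {#}" using at by (simp add: seq_atoms_iff)
        then obtain g where g: "g \<in># V" by blast
        have gc: "g \<in> carrier G" using seq_atoms_carrier[OF at g] .
        have "V = {#g, inv g#}" using size_two_atom[OF at 2 g] .
        moreover have "h = g \<longleftrightarrow> inv h = inv g" "h = inv g \<longleftrightarrow> inv h = g" using h gc by (metis inv_inv)+
        ultimately show ?thesis using h gc by auto
      qed
    qed
    then have "count (\<Sum>\<^sub># N) h = count (\<Sum>\<^sub># N) (inv h)" by (induction N) auto
    then show ?thesis using N(1) by (simp add: factorizations_def)
  qed
  have cnt: "count {#a, b, c#} h = count {#a, b, c#} (inv h)" if "h \<in> carrier G" for h
  proof -
    have "count S x = 2 * n * count {#a, b, c#} x" for x
      by (simp add: S_eq abc(1-3))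
    then show ?thesis using sym[OF that] n by simp
  qed
  have inj: "inv u = inv v \<longleftrightarrow> u = v" "inv (inv u) = u" if "u \<in> carrier G" "v \<in> carrier G" for u v
    using that by (metis inv_inv)+
  from cnt[OF abc(4)] cnt[OF abc(5)] cnt[OF abc(6)] abc(4-9) show False
    by (auto simp: inj split: if_splits)
qed

end

section \<open>Comparison of the systems of sets of lengths\<close>

lemma (in group) cyclic_of_generator:
  assumes fin: "finite (carrier G)" and g: "g \<in> carrier G"
    and gen: "\<And>h. h \<in> carrier G \<Longrightarrow> \<exists>i::nat. h = g [^] i"
  shows "comm_group G" "card (carrier G) = ord g"
proof -
  show "comm_group G"
  proof (rule group_comm_groupI)
    fix x y assume "x \<in> carrier G" "y \<in> carrier G"
    then obtain i j :: nat where "x = g [^] i" "y = g [^] j" using gen by meson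
    then show "x \<otimes> y = y \<otimes> x" using g by (simp add: nat_pow_mult add.commute)
  qed
  have o: "ord g > 0" using ord_ge_1[OF fin g] by simp
  have "carrier G \<subseteq> (\<lambda>i. g [^] i) ` {..<ord g}"
  proof
    fix h assume "h \<in> carrier G"
    then obtain i :: nat where "h = g [^] i" using gen by blast
    moreover have "g [^] i = g [^] (i mod ord g)"
    proof -
      have "g [^] i = g [^] (ord g * (i div ord g) + i mod ord g)" by simp
      also have "\<dots> = (g [^] ord g) [^] (i div ord g) \<otimes> g [^] (i mod ord g)"
        using g by (simp only: nat_pow_mult[symmetric] nat_pow_pow nat_pow_closed)
      also have "\<dots> = g [^] (i mod ord g)" using g by simp
      finally show ?thesis .
    qed
    ultimately show "h \<in> (\<lambda>i. g [^] i) ` {..<ord g}" using o by auto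
  qed
  then have "card (carrier G) \<le> ord g" using surj_card_le[of "{..<ord g}" "carrier G"] by simp
  then show "card (carrier G) = ord g" using ord_le_group_order[OF fin g] by (simp add: order_def)
qed

lemma odd_prime_factor:
  assumes "N > 0" "\<nexists>k. N = (2::nat) ^ k"
  obtains p where "prime p" "odd p" "p dvd N"
proof -
  obtain t where t: "N = 2 ^ multiplicity 2 N * t" "\<not> 2 dvd t"
    by (rule multiplicity_decompose'[of N 2]) (use assms(1) in auto)
  then have "t \<noteq> 1" using assms(2) by (metis mult.right_neutral)
  then obtain p where p: "prime p" "p dvd t" using prime_factor_nat by blast
  then have "odd p" using t(2) dvd_trans by blast
  moreover have "p dvd N" using p(2) t(1) by (metis dvd_mult)
  ultimately show thesis using that p(1) by blast
qed

text \<open>This is the theorem of Cauchy; \<open>sylow_thm\<close> applies to any prime power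
  dividing the order, here to \<open>p\<close> itself.\<close>

lemma (in group) element_of_prime_order:
  assumes fin: "finite (carrier G)" and p: "prime p" "p dvd order G"
  obtains h where "h \<in> carrier G" "h \<noteq> \<one>" "h [^] p = \<one>"
proof -
  obtain m where m: "order G = p ^ 1 * m" using p(2) by auto
  obtain P where P: "subgroup P G" "card P = p"
    using sylow_thm[OF p(1) is_group m fin] by auto
  have "\<not> P \<subseteq> {\<one>}"
    using P(2) prime_gt_1_nat[OF p(1)] card_mono[of "{\<one>}" P] by auto
  then obtain h where h: "h \<in> P" "h \<noteq> \<one>" by blast
  interpret P: group "G\<lparr>carrier := P\<rparr>" using P(1) by (rule subgroup_imp_group)
  have "h [^]\<^bsub>G\<lparr>carrier := P\<rparr>\<^esub> order (G\<lparr>carrier := P\<rparr>) = \<one>\<^bsub>G\<lparr>carrier := P\<rparr>\<^esub>"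
    by (rule P.pow_order_eq_1) (use h in simp)
  then have "h [^] p = \<one>"
    using P(2) by (simp add: order_def nat_pow_consistent[symmetric])
  then show thesis using that h subgroup.subset[OF P(1)] by blast
qed

text \<open>For odd \<open>m\<close> the largest sizes \<open>2 n\<close> and \<open>2 m\<close> of
  atoms differ. For even \<open>m\<close> the transferred size \<open>2 n\<close> is even, as
  \<open>no_progression_dihedral_even\<close> requires.\<close>

lemma dihedral_odd_ne_dihedral:
  assumes n: "n \<ge> 3" "odd n" and m: "m \<ge> 3" "m \<noteq> n"
  shows "group_length_system (dihedral n) \<noteq> group_length_system (dihedral m)"
proof
  assume eq: "group_length_system (dihedral n) = group_length_system (dihedral m)"
  have G: "group (dihedral n)" "group (dihedral m)" using group_dihedral n m by auto
  have D: "davenport (dihedral m) (2 * n)"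
    by (rule davenport_transfer[OF G eq _ davenport_dihedral_odd[OF n]]) (use n in simp)
  show False
  proof (cases "odd m")
    case True
    then show False
      using davenport_unique[OF D davenport_dihedral_odd[OF m(1)]] m(2) by simp
  next
    case False
    then obtain k where "progression k (2 * n - 2) \<notin> group_length_system (dihedral m)"
      using no_progression_dihedral_even[OF m(1) _ _ D] by auto
    then show False using progression_dihedral_odd[OF n] eq by blast
  qed
qed

lemma dihedral_odd_ne_nilpotent:
  fixes G (structure)
  assumes n: "n \<ge> 3" "odd n" and fin: "finite (carrier G)" and nil: "nilpotent_group G"
    and not2: "\<not> (\<not> comm_group G \<and> (\<exists>k::nat. order G = 2 ^ k))"
  shows "group_length_system (dihedral n) \<noteq> group_length_system G"
proof
  assume eq: "group_length_system (dihedral n) = group_length_system G"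
  interpret group G using nil by (simp add: nilpotent_group_def)
  have "group (dihedral n)" using group_dihedral n by simp
  then have D: "davenport G (2 * n)"
    by (rule davenport_transfer[OF _ is_group eq _ davenport_dihedral_odd[OF n]]) (use n in simp)
  have D4: "4 \<le> 2 * n" using n by simp
  have fam: "progression k (2 * n - 2) \<in> group_length_system G" for k
    using progression_dihedral_odd[OF n] eq by simp
  obtain U where U: "U \<in> seq_atoms G" "size U = 2 * n"
    "(\<exists>g\<in>#U. ord g = 2 * n) \<or>
     ((\<forall>g\<in>#U. g \<otimes> g = \<one>) \<and> (\<forall>A\<in>seq_atoms G. set_mset A \<subseteq> set_mset U \<longrightarrow> size A = 2 \<or> size A = 2 * n))"
    using progression_atom[OF fin D D4 fam] by metis
  have no_longer: "size A \<noteq> 2 * n + 1" if "A \<in> seq_atoms G" for A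
    using D that by (auto simp: davenport_def)
  show False
  proof (cases "\<exists>g\<in>#U. ord g = 2 * n")
    case True
    then obtain g where g: "g \<in> carrier G" "ord g = 2 * n" using seq_atoms_carrier[OF U(1)] by blast
    \<comment> \<open>An element that is not a power of \<open>g\<close> would yield an atom of size
      \<open>2 n + 1\<close>.\<close>
    have gen: "\<exists>i::nat. h = g [^] i" if "h \<in> carrier G" for h
      using noncyclic_long_atom[OF fin g(1) that] no_longer g(2) by auto
    have "comm_group G" "card (carrier G) = 2 * n"
      using cyclic_of_generator[OF fin g(1) gen] g(2) by auto
    then show False
      using comm_group.not_three_maximal_atoms[OF _ fin _ n(1)] length_three_dihedral_odd[OF n] eq by metis
  next
    case False
    then have inv: "g \<otimes> g = \<one>" if "g \<in># U" for g using U(3) that by blast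
    have no_central: "\<exists>xs. set xs \<subseteq> set_mset U \<and> lprod xs = h"
      if "h \<in> carrier G" "\<And>x. x \<in># U \<Longrightarrow> h \<otimes> x = x \<otimes> h" for h
      using central_long_atom[OF U(1) that] no_longer U(2) by fastforce
    have Uc: "set_mset U \<subseteq> carrier G" using seq_atoms_carrier[OF U(1)] by blast
    show False
    proof (cases "comm_group G")
      case True
      interpret comm_group G by fact
      show False
      proof (cases "\<forall>h\<in>carrier G. h \<otimes> h = \<one>")
        case True
        then have "progression k (2 * n - 3) \<in> group_length_system G" for k
          using elementary_progression[OF _ U(1), of k] U(2) D4 by simp
        then show False using no_progression_dihedral_odd[OF n] eq by simp
      next
        case False
        then obtain h where h: "h \<in> carrier G" "h \<otimes> h \<noteq> \<one>" by blast
        then obtain xs where xs: "set xs \<subseteq> set_mset U" "lprod xs = h"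
          using no_central[of h] m_comm Uc by blast
        \<comment> \<open>In an abelian group products of involutions have trivial square, so
          \<open>h\<close> is not among them.\<close>
        have "lprod xs \<otimes> lprod xs = \<one>" using xs(1)
        proof (induction xs)
          case (Cons x xs)
          have c: "x \<in> carrier G" "lprod xs \<in> carrier G" using Cons.prems Uc by auto
          have "lprod (x # xs) \<otimes> lprod (x # xs) = (x \<otimes> x) \<otimes> (lprod xs \<otimes> lprod xs)"
            using c by (simp add: m_ac)
          then show ?case using Cons inv[of x] by simp
        qed simp
        then show False using xs h by simp
      qed
    next
      case False
      \<comment> \<open>An element of odd prime order commutes with the involutions in
        \<open>U\<close>, so by maximality of \<open>U\<close> it is a product of them; such
        products have \<open>2\<close>-power order.\<close>
      then have "\<nexists>k. order G = 2 ^ k" using not2 by blast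
      moreover have "order G > 0" using fin by (simp add: order_gt_0_iff_finite)
      ultimately obtain p where p: "prime p" "odd p" "p dvd order G"
        using odd_prime_factor by blast
      obtain h where h: "h \<in> carrier G" "h \<noteq> \<one>" "h [^] p = \<one>"
        using element_of_prime_order[OF fin p(1,3)] by blast
      obtain c where c: "lower_central G c = {\<one>}" using nil by (auto simp: nilpotent_group_def)
      have "h \<otimes> x = x \<otimes> h" if "x \<in># U" for x
        using involution_commutes_odd_order[OF c _ inv[OF that] h(1,3) p(2)] Uc that by auto
      then obtain xs where xs: "set xs \<subseteq> set_mset U" "lprod xs = h" using no_central[OF h(1)] by blast
      have "h [^] (2 ^ c :: nat) = \<one>"
        using involutions_generate_two_group[OF c Uc inv lprod_in_generate[OF xs(1)]] xs(2) by simp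
      then have "ord h dvd 2 ^ c" "ord h dvd p" using h pow_eq_id by blast+
      moreover have "coprime (2 ^ c) p" using p(2) by simp
      ultimately have "is_unit (ord h)" using coprime_common_divisor by blast
      then show False using ord_eq_1[OF h(1)] h(2) by simp
    qed
  qed
qed

lemma dihedral_odd_ne_strongly_primary:
  assumes n: "n \<ge> 3" "odd n" and H: "strongly_primary H"
  shows "group_length_system (dihedral n) \<noteq> length_system H"
proof -
  interpret group "dihedral n" using group_dihedral n by simp
  obtain U where "U \<in> seq_atoms (dihedral n)" "size U = 2 * n"
    using davenport_dihedral_odd[OF n] by (auto simp: davenport_def)
  then show ?thesis using strongly_primary_length_system[OF H, of U] n(1) by simp
qed

theorem corollary6p13:
  fixes n :: nat
    and G :: "('g, 'r) monoid_scheme"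
    and H :: "('h, 's) monoid_scheme"
  assumes "n \<ge> 3" and "odd n"
  shows "(\<forall>m::nat. m \<ge> 3 \<and> m \<noteq> n \<longrightarrow>
            group_length_system (dihedral n) \<noteq> group_length_system (dihedral m)) \<and>
         (finite (carrier G) \<and> nilpotent_group G \<and>
            \<not> (\<not> comm_group G \<and> (\<exists>k::nat. order G = 2 ^ k)) \<longrightarrow>
            group_length_system (dihedral n) \<noteq> group_length_system G) \<and>
         (strongly_primary H \<longrightarrow>
            group_length_system (dihedral n) \<noteq> length_system H)"
proof (intro conjI allI impI)
  show "group_length_system (dihedral n) \<noteq> group_length_system (dihedral m)"
    if "m \<ge> 3 \<and> m \<noteq> n" for m
    using dihedral_odd_ne_dihedral assms that by blast
  show "group_length_system (dihedral n) \<noteq> group_length_system G"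
    if "finite (carrier G) \<and> nilpotent_group G \<and> \<not> (\<not> comm_group G \<and> (\<exists>k::nat. order G = 2 ^ k))"
    using dihedral_odd_ne_nilpotent assms that by blast
  show "group_length_system (dihedral n) \<noteq> length_system H" if "strongly_primary H"
    using dihedral_odd_ne_strongly_primary assms that by blast
qed


end
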